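(* Let $p=m>1$, and let either $N\ge2$ and $-2<\sigma_1\le\sigma_2$, or $N=1$ and $0\le\sigma_1\le\sigma_2$. Define $$\sigma_{2,c}:=\sigma_1+\frac{[2(N-1)+\sigma_1](m-1)}{3m+1}.$$ Consider the equation $|x|^{\sigma_1}\partial_tu=\Delta u^m+|x|^{\sigma_2}u^m$ in $\mathbb{R}^N$. Then: 1. For any $N\ge1$ and any $\sigma_2$ with $\sigma_1\le\sigma_2<\sigma_{2,c}$, there exist separate variable solutions presenting finite time blow-up, of the form $$u(x,t)=(T-t)^{-\alpha}F(|x|),\qquad \alpha=\frac1{m-1}.$$ 2. For any $N\ge1$, there are no radially symmetric separate variable solutions (of the form $u(x,t)=(T-t)^{-1/(m-1)}F(|x|)$) provided that $$\sigma_2\ge\sigma_1+\frac{(m-1)(N+\sigma_1)}{m+1},$$ where the right-hand side is strictly larger than $\sigma_{2,c}$. 3. If $N>\dfrac{m\sigma_1+4m+2}{m+1}$, there is no radially symmetric separate variable solution (of the form $u(x,t)=(T-t)^{-1/(m-1)}F(|x|)$) whenever $\sigma_2\ge\sigma_{2,c}$.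
   Context: Solutions are nonnegative weak solutions on $\mathbb{R}^N\times(0,T)$, with $T>0$. A separate variable solution means a solution $u(x,t)=(T-t)^{-1/(m-1)}F(|x|)$ with a non-trivial profile $F:[0,\infty)\to[0,\infty)$. *)

theory Defs
  imports "HOL-Analysis.Analysis" "HOL-Probability.Essential_Supremum"
begin

definition time_deriv :: "('a::euclidean_space \<times> real \<Rightarrow> real) \<Rightarrow> 'a \<times> real \<Rightarrow> real" where
  "time_deriv \<phi> = (\<lambda>(x, t). deriv (\<lambda>s. \<phi> (x, s)) t)"

definition space_deriv ::
  "'a::euclidean_space \<Rightarrow> ('a \<times> real \<Rightarrow> real) \<Rightarrow> 'a \<times> real \<Rightarrow> real" where
  "space_deriv b \<phi> = (\<lambda>(x, t). deriv (\<lambda>h. \<phi> (x + h *\<^sub>R b, t)) 0)"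

definition space_laplacian :: "('a::euclidean_space \<times> real \<Rightarrow> real) \<Rightarrow> 'a \<times> real \<Rightarrow> real" where
  "space_laplacian \<phi> z = (\<Sum>b\<in>Basis. space_deriv b (space_deriv b \<phi>) z)"

definition C1_in_time :: "('a::euclidean_space \<times> real \<Rightarrow> real) \<Rightarrow> bool" where
  "C1_in_time \<phi> \<longleftrightarrow>
     (\<forall>x t. (\<lambda>s. \<phi> (x, s)) differentiable (at t)) \<and> continuous_on UNIV (time_deriv \<phi>)"

definition C1_in_space :: "('a::euclidean_space \<times> real \<Rightarrow> real) \<Rightarrow> bool" where
  "C1_in_space \<phi> \<longleftrightarrow>
     (\<forall>b\<in>Basis. (\<forall>x t. (\<lambda>h. \<phi> (x + h *\<^sub>R b, t)) differentiable (at 0)) \<and>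
        continuous_on UNIV (space_deriv b \<phi>))"

text \<open>
  Test functions with two continuous derivatives in space and one in time, compactly
  supported in \<open>\<real>\<^sup>N \<times> (0, T)\<close>; they are given on the whole space-time, extended by zero.
\<close>

definition test_function :: "real \<Rightarrow> ('a::euclidean_space \<times> real \<Rightarrow> real) \<Rightarrow> bool" where
  "test_function T \<phi> \<longleftrightarrow>
     continuous_on UNIV \<phi> \<and> C1_in_time \<phi> \<and> C1_in_space \<phi> \<and>
     (\<forall>b\<in>Basis. C1_in_space (space_deriv b \<phi>)) \<and>
     (\<exists>K. compact K \<and> K \<subseteq> UNIV \<times> {0<..<T} \<and> (\<forall>z. z \<notin> K \<longrightarrow> \<phi> z = 0))"

definition locally_integrable ::
  "real \<Rightarrow> ('a::euclidean_space \<times> real \<Rightarrow> real) \<Rightarrow> bool" where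
  "locally_integrable T f \<longleftrightarrow>
     (\<forall>K. compact K \<longrightarrow> K \<subseteq> UNIV \<times> {0<..<T} \<longrightarrow> f absolutely_integrable_on K)"

text \<open>
  Nonnegative weak solutions of \<open>|x|\<^sup>\<sigma>\<^sup>1 u\<^sub>t = \<Delta>(u\<^sup>m) + |x|\<^sup>\<sigma>\<^sup>2 u\<^sup>m\<close> in \<open>\<real>\<^sup>N \<times> (0, T)\<close>: all derivatives
  are moved to the test function. The convention \<open>0 powr \<sigma> = 0\<close> affects the weights
  only on the null set \<open>x = 0\<close>.
\<close>

definition weak_solution ::
  "real \<Rightarrow> real \<Rightarrow> real \<Rightarrow> real \<Rightarrow> ('a::euclidean_space \<Rightarrow> real \<Rightarrow> real) \<Rightarrow> bool" where
  "weak_solution m \<sigma>1 \<sigma>2 T u \<longleftrightarrow>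
     (\<forall>x. \<forall>t\<in>{0<..<T}. 0 \<le> u x t) \<and>
     locally_integrable T (\<lambda>(x, t). norm x powr \<sigma>1 * u x t) \<and>
     locally_integrable T (\<lambda>(x, t). u x t powr m) \<and>
     locally_integrable T (\<lambda>(x, t). norm x powr \<sigma>2 * u x t powr m) \<and>
     (\<forall>\<phi>. test_function T \<phi> \<longrightarrow>
        (LINT (x, t) : UNIV \<times> {0<..<T} | lebesgue.
             norm x powr \<sigma>1 * u x t * time_deriv \<phi> (x, t)
           + u x t powr m * space_laplacian \<phi> (x, t)
           + norm x powr \<sigma>2 * u x t powr m * \<phi> (x, t)) = 0)"

text \<open>
  Weak solutions are only determined up to null sets, so a trivial profile is one that
  vanishes almost everywhere on \<open>[0, \<infinity>)\<close>.
\<close>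

definition separate_variable_solution ::
  "real \<Rightarrow> real \<Rightarrow> real \<Rightarrow> real \<Rightarrow> ('a::euclidean_space \<Rightarrow> real \<Rightarrow> real) \<Rightarrow> (real \<Rightarrow> real) \<Rightarrow> bool" where
  "separate_variable_solution m \<sigma>1 \<sigma>2 T u F \<longleftrightarrow>
     weak_solution m \<sigma>1 \<sigma>2 T u \<and>
     (\<forall>r\<ge>0. 0 \<le> F r) \<and>
     \<not> (AE r in lebesgue. 0 \<le> r \<longrightarrow> F r = 0) \<and>
     (\<forall>x. \<forall>t\<in>{0<..<T}. u x t = (T - t) powr (- (1 / (m - 1))) * F (norm x))"

definition blows_up_at :: "real \<Rightarrow> ('a::euclidean_space \<Rightarrow> real \<Rightarrow> real) \<Rightarrow> bool" where
  "blows_up_at T u \<longleftrightarrow>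
     (\<forall>t\<in>{0<..<T}. esssup lebesgue (\<lambda>x. ereal \<bar>u x t\<bar>) < \<infinity>) \<and>
     ((\<lambda>t. esssup lebesgue (\<lambda>x. ereal \<bar>u x t\<bar>)) \<longlongrightarrow> \<infinity>) (at_left T)"

definition sigma_2c :: "real \<Rightarrow> real \<Rightarrow> real \<Rightarrow> real" where
  "sigma_2c N m \<sigma>1 = \<sigma>1 + (2 * (N - 1) + \<sigma>1) * (m - 1) / (3 * m + 1)"

end

theory Submission
  imports Defs "HOL-Complex_Analysis.Great_Picard"
begin

text \<open>With \<open>s = |x|\<^sup>2\<close> and \<open>w(s) = F(|x|)\<^sup>m\<close> the profile equation becomes \<open>w'' + (k / s) w' = h(s, w)\<close>,
  \<open>k = N / 2\<close>, where \<open>h\<close> is a difference of two powers. A weighted energy, quadratic in \<open>(w, w')\<close> plus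
  a potential, with weight exponents \<open>a\<close> and \<open>c\<close>, has a derivative of one sign for suitable \<open>a\<close> and \<open>c\<close>.

  Nonexistence: the energy vanishes at the origin and is increasing. It also vanishes at every zero of
  \<open>w\<close>, so a nontrivial \<open>w\<close> is eventually positive. Far out it has no local minimum, hence it decreases,
  and the positive energy forces it to reach \<open>0\<close> at a finite radius, a contradiction.

  Existence: the equation is not Lipschitz at \<open>w = 0\<close>, so from a large \<open>s0\<close> a solution can leave \<open>0\<close>,
  driven by the barrier \<open>C (s - s0)\<^bsup>2 / (1 - q)\<^esup>\<close> with \<open>q = 1 / m\<close>. Extended by \<open>0\<close> on \<open>[0, s0]\<close>, it has
  decreasing, hence negative, energy, and therefore stays positive and bounded. The dead core makes the
  singular weights at the origin harmless.

  Weak solutions and profiles correspond to each other by testing with \<open>\<eta>(t) \<zeta>(|x|\<^sup>2)\<close> and the lemma of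
  du Bois-Reymond.\<close>

section \<open>The energy of a profile\<close>

text \<open>The energy comes from the multipliers s^a w' and c s^(a-1) w. Cancelling the power
  w^(q+1) in its derivative forces c = (a + \<tau>1)/(q + 1); the derivative is then a weighted
  combination of squares, with coefficient A = a/2 - k + c of (s w')^2 and coefficients B = (a +
  \<tau>2)/2 - c and D = c (k + 1 - a)(a - 2)/2 of two weighted copies of w^2. Two values of a
  matter. With a = k + 1 one has D = 0, and B >= 0 is the bound in the second claim. The other value
  gives A = 0; then B has the sign of \<sigma>2 - \<open>sigma_2c\<close>, which is where the
  critical exponent comes from, and a > 2 is the bound on N in the third claim.

  The variable |x|^2 is preferred to |x| because \<zeta>(|x|^2) is as smooth as \<zeta> at the
  origin, without any condition on \<zeta> there. A profile of a weak solution is not even assumed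
  measurable, so measurability, smoothness and the vanishing of the flux s^k w' at the origin all
  have to be extracted from the weak formulation before the energy can be used.\<close>

lemma DERIV_max_powr:
  fixes x p :: real
  assumes "p > 1"
  shows "((\<lambda>x. max x 0 powr p) has_real_derivative p * max x 0 powr (p - 1)) (at x)"
proof -
  consider "x > 0" | "x < 0" | "x = 0" by linarith
  then show ?thesis
  proof cases
    case 1
    have "((\<lambda>x. x powr p) has_real_derivative p * x powr (p - 1)) (at x)"
      using 1 by (auto intro!: derivative_eq_intros)
    moreover have "\<forall>\<^sub>F y in nhds x. max y 0 powr p = y powr p"
      using 1 by (intro eventually_nhds_in_open[of "{0<..}", THEN eventually_mono]) auto
    ultimately show ?thesis
      using 1 by (subst DERIV_cong_ev[OF refl _ refl]) auto
  next
    case 2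
    have "\<forall>\<^sub>F y in nhds x. max y 0 powr p = (0::real)"
      using 2 by (intro eventually_nhds_in_open[of "{..<0}", THEN eventually_mono]) auto
    then have "((\<lambda>x. max x 0 powr p) has_real_derivative 0) (at x)"
      by (subst DERIV_cong_ev[OF refl _ refl, where g = "\<lambda>_. 0"]) auto
    then show ?thesis using 2 by simp
  next
    case 3
    have "((\<lambda>h::real. \<bar>h\<bar> powr (p - 1)) \<longlongrightarrow> 0) (at 0)"
      using assms by (intro tendsto_zero_powrI[where b = "p - 1"]) (auto intro!: tendsto_eq_intros)
    then have "((\<lambda>h::real. max h 0 powr p / h) \<longlongrightarrow> 0) (at 0)"
    proof (rule Lim_null_comparison[rotated], intro always_eventually allI)
      fix h :: real
      show "norm (max h 0 powr p / h) \<le> \<bar>h\<bar> powr (p - 1)"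
        using powr_diff[of h p 1] by (cases "h > 0") simp_all
    qed
    then show ?thesis
      using 3 assms by (simp add: DERIV_def)
  qed
qed

text \<open>If g b > 0, then g vanishes at the last point of [a, b] with g <= 0, and its negative
  derivative there makes it negative just afterwards, a contradiction. A sign of g' at the zeros of
  g suffices, which suits quantities that are controlled only where they vanish.\<close>

lemma barrier_nonpos:
  fixes g g' :: "real \<Rightarrow> real"
  assumes deriv: "\<And>t. a \<le> t \<Longrightarrow> (g has_real_derivative g' t) (at t)"
    and "g a \<le> 0" and neg: "\<And>t. a \<le> t \<Longrightarrow> g t = 0 \<Longrightarrow> g' t < 0" and "a \<le> b"
  shows "g b \<le> 0"
proof (rule ccontr)
  assume "\<not> g b \<le> 0"
  then have gb: "g b > 0" by simp
  define S where "S = {t \<in> {a..b}. g t \<le> 0}"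
  have cont: "continuous_on {a..b} g"
    using deriv by (intro continuous_at_imp_continuous_on ballI DERIV_isCont) auto
  have "closed S" unfolding S_def
    using continuous_closed_preimage[OF cont, of "{..0}"]
    by (simp add: vimage_def Int_def)
  moreover have ne: "S \<noteq> {}" "bdd_above S"
    using assms by (auto simp: S_def intro!: bdd_aboveI[of _ b])
  ultimately have sS: "Sup S \<in> S" by (intro closed_contains_Sup) auto
  define s where "s = Sup S"
  have s: "a \<le> s" "s < b" "g s \<le> 0"
    using sS gb by (auto simp: S_def s_def order.order_iff_strict)
  have above: "g t > 0" if "s < t" "t \<le> b" for t
    using that cSup_upper[of t S] ne s by (force simp: S_def s_def)
  have "g s = 0"
  proof (rule ccontr)
    assume "g s \<noteq> 0"
    with s have "g s < 0" by simp
    moreover have "isCont g s" using deriv s DERIV_isCont by blast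
    ultimately have "\<forall>\<^sub>F t in at s. g t < 0"
      using order_tendstoD(2)[of g "g s" "at s" 0] by (auto simp: isCont_def)
    then have "\<forall>\<^sub>F t in at_right s. g t < 0"
      by (simp add: eventually_at_split)
    then have "\<forall>\<^sub>F t in at_right s. g t < 0 \<and> t \<in> {s<..<b}"
      using eventually_at_right_real[OF s(2)] by eventually_elim auto
    then obtain t where "g t < 0" "t \<in> {s<..<b}"
      using eventually_happens by fastforce
    with above[of t] show False by auto
  qed
  then have "g' s < 0" using neg s by auto
  with deriv[of s] s have "\<exists>d>0. \<forall>h>0. h < d \<longrightarrow> g (s + h) < g s"
    by (intro DERIV_neg_dec_right) auto
  then obtain d where d: "d > 0" "\<And>h. h > 0 \<Longrightarrow> h < d \<Longrightarrow> g (s + h) < g s" by auto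
  define h where "h = min (d/2) (b - s)"
  have "h > 0" "h < d" "s + h \<le> b" using d s by (auto simp: h_def)
  with d(2)[of h] above[of "s + h"] \<open>g s = 0\<close> show False by auto
qed

text \<open>Dividing 4 s w'' + 2 N w' = s^(\<sigma>1/2) w^(1/m) / (m - 1) - s^(\<sigma>2/2) w by 4 s
  gives the intended values k = N/2, \<tau>1 = \<sigma>1/2 - 1, \<tau>2 = \<sigma>2/2 - 1, \<beta> =
  1/4, \<gamma> = 1/(4 (m - 1)), q = 1/m. Then \<open>k_tau1\<close> says N + \<sigma>1 > 0, the
  integrability of |x|^\<sigma>1 at the origin.\<close>

locale radial_profile =
  fixes k \<tau>1 \<tau>2 \<beta> \<gamma> q :: real
  assumes q_pos: "0 < q" and q_less: "q < 1" and beta_pos: "0 < \<beta>" and gamma_pos: "0 < \<gamma>"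
    and tau1: "-2 < \<tau>1" and tau_le: "\<tau>1 \<le> \<tau>2" and k_pos: "0 < k" and k_tau1: "0 < k + 1 + \<tau>1"
begin

text \<open>The cut \<open>max y 0\<close> extends the nonlinearity continuously to negative y, so
  that initial value problems can be solved before the sign of the solution is known.\<close>

definition source :: "real \<Rightarrow> real \<Rightarrow> real" where
  "source s y = \<gamma> * s powr \<tau>1 * max y 0 powr q - \<beta> * s powr \<tau>2 * y"

definition solves_at :: "(real \<Rightarrow> real) \<Rightarrow> (real \<Rightarrow> real) \<Rightarrow> real \<Rightarrow> bool" where
  "solves_at w p s \<longleftrightarrow> (w has_real_derivative p s) (at s) \<and>
     (p has_real_derivative source s (w s) - k / s * p s) (at s)"

text \<open>A functional of Pohozaev type. Its last term is there because its derivative cancels the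
  remaining products s^(a-2) w w'.\<close>

definition energy :: "real \<Rightarrow> real \<Rightarrow> (real \<Rightarrow> real) \<Rightarrow> (real \<Rightarrow> real) \<Rightarrow> real \<Rightarrow> real" where
  "energy a c w p s =
     s powr a * ((p s)\<^sup>2 / 2 + \<beta> * s powr \<tau>2 * (w s)\<^sup>2 / 2
        - \<gamma> * s powr \<tau>1 * max (w s) 0 powr (q + 1) / (q + 1))
     + c * s powr (a - 1) * w s * p s + c * (k + 1 - a) / 2 * s powr (a - 2) * (w s)\<^sup>2"

text \<open>The terms in w^(q+1) carry the common factor c - (a + \<tau>1)/(q + 1), which the choice
  of c annihilates. What is left has no mixed term, so its sign can be read off the
  coefficients.\<close>

lemma energy_derivative:
  assumes "solves_at w p s" "s > 0" "c = (a + \<tau>1) / (q + 1)"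
  shows "(energy a c w p has_real_derivative
     s powr (a - 3) * ((a / 2 - k + c) * (s * p s)\<^sup>2
        + (\<beta> * ((a + \<tau>2) / 2 - c) * s powr (\<tau>2 + 2) + c * (k + 1 - a) / 2 * (a - 2)) * (w s)\<^sup>2)) (at s)"
proof -
  define P where "P = s powr (a - 3)"
  define X1 where "X1 = s powr \<tau>1"
  define X2 where "X2 = s powr \<tau>2"
  define Q where "Q = max (w s) 0 powr q"
  note w = assms(1)[unfolded solves_at_def, THEN conjunct1]
  note p = assms(1)[unfolded solves_at_def, THEN conjunct2, unfolded source_def]
  have e: "s powr (a - 1) = s * s * P" "s powr (a - 2) = s * P" "s powr a = s * s * s * P"
    "s powr (\<tau>2 + 2) = s * s * X2"  "s powr (a - 2 - 1) = P" "s powr (a - 1 - 1) = s * P"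
    using assms(2) by (auto simp: P_def X1_def X2_def powr_diff powr_add powr_numeral field_simps power2_eq_square power3_eq_cube)
  \<comment> \<open>Names for the shifted powers and for the reciprocals turn the identity to be
    checked into a polynomial one.\<close>
  define Y1 where "Y1 = s powr (\<tau>1 - 1)"
  define Y2 where "Y2 = s powr (\<tau>2 - 1)"
  define \<iota> where "\<iota> = 1 / (q + 1)"
  define \<kappa> where "\<kappa> = k / s"
  have Y: "X1 = s * Y1" "X2 = s * Y2" "k = s * \<kappa>"
    using assms(2) by (auto simp: X1_def X2_def Y1_def Y2_def powr_diff \<kappa>_def)
  have c: "c = (a + \<tau>1) * \<iota>" using assms(3) by (simp add: \<iota>_def)
  define V where "V = (\<lambda>s. max (w s) 0 powr (q + 1) / (q + 1))"
  have V: "V s = Q * w s * \<iota>"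
    by (auto simp: V_def Q_def \<iota>_def powr_add max_def)
  have dV: "(V has_real_derivative Q * p s) (at s)"
    using DERIV_cdivide[OF DERIV_chain2[OF DERIV_max_powr[of "q + 1" "w s"] w], of "q + 1"] q_pos
    by (simp add: Q_def V_def)
  have pw: "((\<lambda>s. s powr b) has_real_derivative b * s powr (b - 1)) (at s)" for b
    using assms(2) by (auto intro!: derivative_eq_intros)
  have p': "(p has_real_derivative \<gamma> * X1 * Q - \<beta> * X2 * w s - \<kappa> * p s) (at s)"
    using p by (simp add: X1_def X2_def Q_def \<kappa>_def)
  have eq: "(a * (s * s * P)) * ((p s)\<^sup>2 / 2 + \<beta> * X2 * (w s)\<^sup>2 / 2 - \<gamma> * X1 * (Q * w s * \<iota>)) +
      (s * s * s * P) * (p s * (\<gamma> * X1 * Q - \<beta> * X2 * w s - \<kappa> * p s)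
        + (\<beta> * (\<tau>2 * Y2) * (w s)\<^sup>2 / 2 + \<beta> * X2 * (w s * p s))
        - (\<gamma> * (\<tau>1 * Y1) * (Q * w s * \<iota>) + \<gamma> * X1 * (Q * p s)))
      + (c * ((a - 1) * (s * P)) * w s * p s + c * (s * s * P) * (p s * p s)
      + c * (s * s * P) * w s * (\<gamma> * X1 * Q - \<beta> * X2 * w s - \<kappa> * p s))
      + (c * (k + 1 - a) / 2 * ((a - 2) * P) * (w s)\<^sup>2
      + c * (k + 1 - a) / 2 * (s * P) * (2 * w s * p s))
    = P * ((a / 2 - k + c) * (s * p s)\<^sup>2
        + (\<beta> * ((a + \<tau>2) / 2 - c) * (s * s * X2) + c * (k + 1 - a) / 2 * (a - 2)) * (w s)\<^sup>2)"
    unfolding Y c by (simp add: field_simps power2_eq_square)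
  have "((\<lambda>s. s powr a * ((p s)\<^sup>2 / 2 + \<beta> * s powr \<tau>2 * (w s)\<^sup>2 / 2 - \<gamma> * s powr \<tau>1 * V s)
     + c * s powr (a - 1) * w s * p s + c * (k + 1 - a) / 2 * s powr (a - 2) * (w s)\<^sup>2)
     has_real_derivative P * ((a / 2 - k + c) * (s * p s)\<^sup>2
        + (\<beta> * ((a + \<tau>2) / 2 - c) * (s * s * X2) + c * (k + 1 - a) / 2 * (a - 2)) * (w s)\<^sup>2)) (at s)"
  proof -
    have sq: "((\<lambda>s. (f s)\<^sup>2) has_real_derivative 2 * f s * f') (at s)"
      if "(f has_real_derivative f') (at s)" for f f'
      using DERIV_power[OF that, of 2] by (simp add: mult_ac)
    have d1: "((\<lambda>s. (p s)\<^sup>2 / 2) has_real_derivative p s * (\<gamma> * X1 * Q - \<beta> * X2 * w s - \<kappa> * p s)) (at s)"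
      using DERIV_cdivide[OF sq[OF p'], of 2] by simp
    have d2: "((\<lambda>s. \<beta> * s powr \<tau>2 * (w s)\<^sup>2 / 2) has_real_derivative
        \<beta> * (\<tau>2 * Y2) * (w s)\<^sup>2 / 2 + \<beta> * X2 * (w s * p s)) (at s)"
      by (rule DERIV_cong[OF DERIV_cdivide[OF DERIV_mult[OF DERIV_cmult[OF pw] sq[OF w]]]])
        (simp add: X2_def Y2_def field_simps)
    have d3: "((\<lambda>s. \<gamma> * s powr \<tau>1 * V s) has_real_derivative
        \<gamma> * (\<tau>1 * Y1) * (Q * w s * \<iota>) + \<gamma> * X1 * (Q * p s)) (at s)"
      by (rule DERIV_cong[OF DERIV_mult[OF DERIV_cmult[OF pw] dV]])
        (simp add: X1_def Y1_def V)
    have d4: "((\<lambda>s. c * s powr (a - 1) * w s * p s) has_real_derivative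
        c * ((a - 1) * (s * P)) * w s * p s + c * (s * s * P) * (p s * p s)
      + c * (s * s * P) * w s * (\<gamma> * X1 * Q - \<beta> * X2 * w s - \<kappa> * p s)) (at s)"
      by (rule DERIV_cong[OF DERIV_mult[OF DERIV_mult[OF DERIV_cmult[OF pw] w] p']])
        (simp add: e algebra_simps)
    have d5: "((\<lambda>s. c * (k + 1 - a) / 2 * s powr (a - 2) * (w s)\<^sup>2) has_real_derivative
        c * (k + 1 - a) / 2 * ((a - 2) * P) * (w s)\<^sup>2
      + c * (k + 1 - a) / 2 * (s * P) * (2 * w s * p s)) (at s)"
      by (rule DERIV_cong[OF DERIV_mult[OF DERIV_cmult[OF pw] sq[OF w]]])
        (simp add: e P_def)
    show ?thesis
      unfolding eq[symmetric]
      by (rule DERIV_cong[OF DERIV_add[OF DERIV_add[OF DERIV_mult[OF pw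
              DERIV_diff[OF DERIV_add[OF d1 d2] d3]] d4] d5]])
        (simp add: e V X1_def X2_def)
  qed
  then show ?thesis
    unfolding energy_def[abs_def] V_def e(4) P_def[symmetric] by simp
qed

end

lemma tendsto_cmult_powr_zero:
  fixes b D :: real
  assumes "b > 0"
  shows "((\<lambda>s. D * s powr b) \<longlongrightarrow> 0) (at_right 0)"
proof -
  have "\<forall>\<^sub>F s in at_right (0::real). 0 \<le> s"
    using eventually_at_right_less[of "0::real"] by eventually_elim simp
  then have "((\<lambda>s::real. s powr b) \<longlongrightarrow> 0) (at_right 0)"
    using assms by (intro tendsto_zero_powrI[where b = b]) auto
  then show ?thesis by (rule tendsto_mult_right_zero)
qed

text \<open>By monotonicity f s >= f t >= g t for small t, and g t tends to 0. The minorant g allows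
  for functions f that contain a nonnegative part whose limit at 0 is not yet known.\<close>

lemma nonneg_of_increasing_from_zero:
  fixes f f' g :: "real \<Rightarrow> real"
  assumes deriv: "\<And>t. 0 < t \<Longrightarrow> t \<le> \<delta> \<Longrightarrow> (f has_real_derivative f' t) (at t)"
    and pos: "\<And>t. 0 < t \<Longrightarrow> t \<le> \<delta> \<Longrightarrow> 0 \<le> f' t"
    and le: "\<And>t. 0 < t \<Longrightarrow> t \<le> \<delta> \<Longrightarrow> g t \<le> f t"
    and lim: "(g \<longlongrightarrow> 0) (at_right 0)" and s: "0 < s" "s \<le> \<delta>"
  shows "0 \<le> f s"
proof -
  have "\<forall>\<^sub>F t in at_right 0. g t \<le> f s"
    using eventually_at_right_real[OF s(1)]
  proof eventually_elim
    case (elim t)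
    then have "g t \<le> f t" using s by (intro le) auto
    also have "f t \<le> f s"
    proof (rule DERIV_nonneg_imp_nondecreasing[where f = f])
      fix x assume "t \<le> x" "x \<le> s"
      then show "\<exists>y. (f has_real_derivative y) (at x) \<and> 0 \<le> y"
        using elim s deriv[of x] pos[of x] by auto
    qed (use elim in auto)
    finally show ?case .
  qed
  then show ?thesis
    using tendsto_upperbound[OF lim] by simp
qed

section \<open>Behaviour of a profile and of its energy at the origin\<close>

context radial_profile begin

lemma tau2: "-2 < \<tau>2" "0 < k + 1 + \<tau>2"
  using tau1 tau_le k_tau1 by auto

lemma flux_derivative:
  assumes "solves_at w p s" "s > 0"
  shows "((\<lambda>s. s powr k * p s) has_real_derivative s powr k * source s (w s)) (at s)"
proof -
  have "((\<lambda>s. s powr k * p s) has_real_derivative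
      k * s powr (k - 1) * p s + (source s (w s) - k / s * p s) * s powr k) (at s)"
    using assms unfolding solves_at_def by (intro DERIV_mult) (auto intro!: derivative_eq_intros)
  then show ?thesis
    by (rule DERIV_cong) (use assms in \<open>simp add: powr_diff field_simps\<close>)
qed

text \<open>Comparison with the supersolution \<open>1 - \<kappa> s\<^bsup>2 + \<tau>2\<^esup>\<close>: the Wronskian of the two functions increases from \<open>0\<close>.\<close>

lemma profile_bounded_near_zero:
  assumes sol: "\<And>s. s > 0 \<Longrightarrow> solves_at w p s" and nonneg: "\<And>s. s > 0 \<Longrightarrow> 0 \<le> w s"
    and lim: "((\<lambda>s. s powr k * p s) \<longlongrightarrow> 0) (at_right 0)"
  obtains \<delta> M where "0 < \<delta>" "\<delta> \<le> 1" "0 < M" "\<And>s. 0 < s \<Longrightarrow> s \<le> \<delta> \<Longrightarrow> w s \<le> M"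
proof -
  \<comment> \<open>This value gives P below the property (s^k P')' = - \<beta> s^(k + \<tau>2);
    since P <= 1, it is a supersolution of the linear part of the equation.\<close>
  define \<kappa> where "\<kappa> = \<beta> / ((2 + \<tau>2) * (k + 1 + \<tau>2))"
  have kap: "\<kappa> > 0" using tau2 beta_pos by (simp add: \<kappa>_def)
  have kap': "\<kappa> * (2 + \<tau>2) * (k + 1 + \<tau>2) = \<beta>" using tau2 by (simp add: \<kappa>_def)
  define P where "P = (\<lambda>s. 1 - \<kappa> * s powr (2 + \<tau>2))"
  have "((\<lambda>s. \<kappa> * s powr (2 + \<tau>2)) \<longlongrightarrow> 0) (at_right 0)"
    using tau2 by (intro tendsto_cmult_powr_zero) auto
  then have "\<forall>\<^sub>F s in at_right 0. \<kappa> * s powr (2 + \<tau>2) < 1 / 2"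
    by (rule order_tendstoD) simp
  then obtain b where b: "b > 0" "\<And>s. 0 < s \<Longrightarrow> s < b \<Longrightarrow> \<kappa> * s powr (2 + \<tau>2) < 1 / 2"
    unfolding eventually_at_right_field by auto
  define \<delta> where "\<delta> = min 1 (b / 2)"
  have \<delta>: "0 < \<delta>" "\<delta> \<le> 1" "\<delta> < b" using b(1) by (auto simp: \<delta>_def)
  have P: "1 / 2 < P s" "P s \<le> 1" if "0 < s" "s \<le> \<delta>" for s
    using b(2)[of s] that \<delta> kap by (auto simp: P_def)
  have dP: "(P has_real_derivative - \<kappa> * (2 + \<tau>2) * s powr (1 + \<tau>2)) (at s)" if "0 < s" for s
    unfolding P_def
    using DERIV_diff[OF DERIV_const DERIV_cmult[OF has_real_derivative_powr[OF that, of "2 + \<tau>2"], of \<kappa>], of 1]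
    by (simp add: mult.assoc add.commute)
  define W where "W = (\<lambda>s. s powr k * p s * P s + \<kappa> * (2 + \<tau>2) * s powr (k + 1 + \<tau>2) * w s)"
  have dW: "(W has_real_derivative s powr k *
      (P s * \<gamma> * s powr \<tau>1 * max (w s) 0 powr q + \<beta> * s powr \<tau>2 * w s * (1 - P s))) (at s)" if "s > 0" for s
  proof -
    have w: "(w has_real_derivative p s) (at s)" using sol[OF that] by (simp add: solves_at_def)
    have "((\<lambda>s. \<kappa> * (2 + \<tau>2) * s powr (k + 1 + \<tau>2)) has_real_derivative \<beta> * s powr (k + \<tau>2)) (at s)"
      using DERIV_cmult[OF has_real_derivative_powr[OF that, of "k + 1 + \<tau>2"], of "\<kappa> * (2 + \<tau>2)"]
      by (simp add: kap' flip: mult.assoc)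
    from DERIV_add[OF DERIV_mult[OF flux_derivative[OF sol[OF that] that] dP[OF that]] DERIV_mult[OF this w]]
    show ?thesis unfolding W_def
    proof (rule DERIV_cong)
      have e: "s powr (1 + \<tau>2) = s * s powr \<tau>2" "s powr (k + \<tau>2) = s powr k * s powr \<tau>2"
        "s powr (k + 1 + \<tau>2) = s powr k * s * s powr \<tau>2"
        using that by (simp_all add: powr_add)
      show "s powr k * source s (w s) * P s + - \<kappa> * (2 + \<tau>2) * s powr (1 + \<tau>2) * (s powr k * p s)
          + (\<beta> * s powr (k + \<tau>2) * w s + p s * (\<kappa> * (2 + \<tau>2) * s powr (k + 1 + \<tau>2)))
        = s powr k * (P s * \<gamma> * s powr \<tau>1 * max (w s) 0 powr q + \<beta> * s powr \<tau>2 * w s * (1 - P s))"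
        unfolding source_def e by algebra
    qed
  qed
  \<comment> \<open>Only the flux part of W is known to vanish at 0. The other part contains w,
    which is not yet bounded, but it is nonnegative; so the flux part serves as the
    minorant.\<close>
  have W: "0 \<le> W s" if "0 < s" "s \<le> \<delta>" for s
  proof (rule nonneg_of_increasing_from_zero[OF dW _ _ _ that])
    have "(P \<longlongrightarrow> 1) (at_right 0)"
      unfolding P_def using tau2 tendsto_diff[OF tendsto_const tendsto_cmult_powr_zero[of "2 + \<tau>2" \<kappa>], of 1] by simp
    from tendsto_mult[OF lim this] show "((\<lambda>s. s powr k * p s * P s) \<longlongrightarrow> 0) (at_right 0)" by simp
    fix t assume t: "0 < t" "t \<le> \<delta>"
    show "t powr k * p t * P t \<le> W t"
      using nonneg[OF t(1)] kap tau2 by (simp add: W_def)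
    show "0 \<le> t powr k * (P t * \<gamma> * t powr \<tau>1 * max (w t) 0 powr q + \<beta> * t powr \<tau>2 * w t * (1 - P t))"
      using P[OF t] nonneg[OF t(1)] beta_pos gamma_pos
      by (intro mult_nonneg_nonneg add_nonneg_nonneg) auto
  qed auto
  \<comment> \<open>The derivative of w / P is W / (s^k P^2), hence nonnegative, and the value at
    \<delta> bounds w / P on the left.\<close>
  have mono: "w s / P s \<le> w \<delta> / P \<delta>" if s: "0 < s" "s \<le> \<delta>" for s
  proof (rule DERIV_nonneg_imp_nondecreasing[OF s(2), where f = "\<lambda>s. w s / P s"])
    fix t assume t: "s \<le> t" "t \<le> \<delta>"
    then have t0: "0 < t" using s by simp
    have eq: "p t * P t - w t * (- \<kappa> * (2 + \<tau>2) * t powr (1 + \<tau>2)) = W t / t powr k"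
      using t0 powr_add[of t k "1 + \<tau>2"] by (simp add: W_def add_divide_distrib add.assoc)
    have "P t \<noteq> 0" using P[OF t0 t(2)] by auto
    from DERIV_divide[OF _ dP[OF t0] this] sol[OF t0]
    have d: "((\<lambda>s. w s / P s) has_real_derivative W t / t powr k / (P t * P t)) (at t)"
      unfolding eq[symmetric] solves_at_def by blast
    have "W t / t powr k / (P t * P t) \<ge> 0"
      using W[OF t0 t(2)] by simp
    with d show "\<exists>y. ((\<lambda>s. w s / P s) has_real_derivative y) (at t) \<and> 0 \<le> y"
      by blast
  qed
  have "w s \<le> w \<delta> / P \<delta> + 1" if s: "0 < s" "s \<le> \<delta>" for s
  proof -
    have "w s \<le> w s / P s"
      using P[OF s] nonneg[OF s(1)] by (simp add: pos_le_divide_eq mult_left_le)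
    also note mono[OF s]
    finally show ?thesis by simp
  qed
  moreover have "0 < w \<delta> / P \<delta> + 1"
    using P[of \<delta>] nonneg[of \<delta>] \<delta> by (intro add_nonneg_pos) auto
  ultimately show ?thesis using \<delta> that by blast
qed

text \<open>With 0 <= w <= M the derivative of the flux s^k p lies between multiples of - s^(k +
  \<tau>2) and s^(k + \<tau>1). Both are integrable at 0, so integrating from the zero limit bounds
  the flux. On s <= 1 the exponent with \<tau>1 dominates because \<tau>1 <= \<tau>2.\<close>

lemma slope_near_zero:
  assumes sol: "\<And>s. s > 0 \<Longrightarrow> solves_at w p s" and nonneg: "\<And>s. s > 0 \<Longrightarrow> 0 \<le> w s"
    and lim: "((\<lambda>s. s powr k * p s) \<longlongrightarrow> 0) (at_right 0)"
    and \<delta>: "0 < \<delta>" "\<delta> \<le> 1" and M: "0 < M" "\<And>s. 0 < s \<Longrightarrow> s \<le> \<delta> \<Longrightarrow> w s \<le> M"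
  obtains C where "0 < C" "\<And>s. 0 < s \<Longrightarrow> s \<le> \<delta> \<Longrightarrow> \<bar>s * p s\<bar> \<le> C * s powr (2 + \<tau>1)"
proof -
  define C1 where "C1 = \<gamma> * M powr q / (k + 1 + \<tau>1)"
  define C2 where "C2 = \<beta> * M / (k + 1 + \<tau>2)"
  have C: "C1 > 0" "C2 > 0" using M gamma_pos beta_pos k_tau1 tau2 by (auto simp: C1_def C2_def)
  have up: "0 \<le> C1 * s powr (k + 1 + \<tau>1) - s powr k * p s" if s: "0 < s" "s \<le> \<delta>" for s
  proof (rule nonneg_of_increasing_from_zero[OF _ _ order_refl _ s])
    show "((\<lambda>s. C1 * s powr (k + 1 + \<tau>1) - s powr k * p s) \<longlongrightarrow> 0) (at_right 0)"
      using tendsto_diff[OF tendsto_cmult_powr_zero[OF k_tau1, of C1] lim] by simp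
    fix t assume t: "0 < t" "t \<le> \<delta>"
    have "((\<lambda>s. C1 * s powr (k + 1 + \<tau>1)) has_real_derivative \<gamma> * M powr q * t powr (k + \<tau>1)) (at t)"
      using t k_tau1 by (auto intro!: derivative_eq_intros simp: C1_def)
    from DERIV_diff[OF this flux_derivative[OF sol[OF t(1)] t(1)]]
    show "((\<lambda>s. C1 * s powr (k + 1 + \<tau>1) - s powr k * p s) has_real_derivative
       \<gamma> * M powr q * t powr (k + \<tau>1) - t powr k * source t (w t)) (at t)" .
    have "w t powr q \<le> M powr q" using M(2)[OF t] nonneg[OF t(1)] q_pos by (intro powr_mono2) auto
    then have "\<gamma> * t powr \<tau>1 * w t powr q \<le> \<gamma> * t powr \<tau>1 * M powr q"
      using gamma_pos by (intro mult_left_mono) auto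
    moreover have "0 \<le> \<beta> * t powr \<tau>2 * w t" using beta_pos nonneg[OF t(1)] by auto
    ultimately have "source t (w t) \<le> \<gamma> * M powr q * t powr \<tau>1"
      using nonneg[OF t(1)] by (simp add: source_def mult_ac)
    then have "t powr k * source t (w t) \<le> t powr k * (\<gamma> * M powr q * t powr \<tau>1)"
      by (intro mult_left_mono) auto
    then show "0 \<le> \<gamma> * M powr q * t powr (k + \<tau>1) - t powr k * source t (w t)"
      by (simp add: powr_add mult_ac)
  qed
  have low: "0 \<le> C2 * s powr (k + 1 + \<tau>2) + s powr k * p s" if s: "0 < s" "s \<le> \<delta>" for s
  proof (rule nonneg_of_increasing_from_zero[OF _ _ order_refl _ s])
    show "((\<lambda>s. C2 * s powr (k + 1 + \<tau>2) + s powr k * p s) \<longlongrightarrow> 0) (at_right 0)"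
      using tendsto_add[OF tendsto_cmult_powr_zero[OF tau2(2), of C2] lim] by simp
    fix t assume t: "0 < t" "t \<le> \<delta>"
    have "((\<lambda>s. C2 * s powr (k + 1 + \<tau>2)) has_real_derivative \<beta> * M * t powr (k + \<tau>2)) (at t)"
      using t tau2 by (auto intro!: derivative_eq_intros simp: C2_def)
    from DERIV_add[OF this flux_derivative[OF sol[OF t(1)] t(1)]]
    show "((\<lambda>s. C2 * s powr (k + 1 + \<tau>2) + s powr k * p s) has_real_derivative
       \<beta> * M * t powr (k + \<tau>2) + t powr k * source t (w t)) (at t)" .
    have "\<beta> * t powr \<tau>2 * w t \<le> \<beta> * t powr \<tau>2 * M"
      using beta_pos M(2)[OF t] by (intro mult_left_mono) auto
    moreover have "0 \<le> \<gamma> * t powr \<tau>1 * max (w t) 0 powr q" using gamma_pos by auto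
    ultimately have "- (\<beta> * M * t powr \<tau>2) \<le> source t (w t)"
      by (simp add: source_def mult_ac)
    then have "t powr k * (- (\<beta> * M * t powr \<tau>2)) \<le> t powr k * source t (w t)"
      by (intro mult_left_mono) auto
    then show "0 \<le> \<beta> * M * t powr (k + \<tau>2) + t powr k * source t (w t)"
      by (simp add: powr_add mult_ac)
  qed
  have "\<bar>s * p s\<bar> \<le> (C1 + C2) * s powr (2 + \<tau>1)" if s: "0 < s" "s \<le> \<delta>" for s
  proof -
    have "s powr (k + 1 + \<tau>2) \<le> s powr (k + 1 + \<tau>1)"
      using s \<delta> tau_le by (intro powr_mono') auto
    then have C2': "C2 * s powr (k + 1 + \<tau>2) \<le> C2 * s powr (k + 1 + \<tau>1)"
      using C by (intro mult_left_mono) auto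
    have "0 \<le> C1 * s powr (k + 1 + \<tau>1)" "0 \<le> C2 * s powr (k + 1 + \<tau>1)"
      using C by auto
    with C2' up[OF s] low[OF s] have "\<bar>s powr k * p s\<bar> \<le> (C1 + C2) * s powr (k + 1 + \<tau>1)"
      unfolding abs_le_iff distrib_right by linarith
    then have "s * s powr (- k) * \<bar>s powr k * p s\<bar> \<le> s * s powr (- k) * ((C1 + C2) * s powr (k + 1 + \<tau>1))"
      using s by (intro mult_left_mono) auto
    moreover have "s * s powr (- k) * \<bar>s powr k * p s\<bar> = \<bar>s * p s\<bar>"
      using s by (simp add: abs_mult powr_minus)
    moreover have "s * s powr (- k) * ((C1 + C2) * s powr (k + 1 + \<tau>1)) = (C1 + C2) * s powr (1 + (-k) + (k + 1 + \<tau>1))"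
      using s by (simp only: powr_add powr_one mult_ac)
    ultimately show ?thesis by simp
  qed
  with C show ?thesis by (intro that[of "C1 + C2"]) auto
qed

text \<open>From w <= M and |s p| <= C s^(2 + \<tau>1) every term of the energy is bounded by a
  positive power of s. The delicate one is s^(a-2) w^2: either a > 2, or a = k + 1 and its
  coefficient is 0.\<close>

lemma energy_limit_zero:
  assumes sol: "\<And>s. s > 0 \<Longrightarrow> solves_at w p s" and nonneg: "\<And>s. s > 0 \<Longrightarrow> 0 \<le> w s"
    and lim: "((\<lambda>s. s powr k * p s) \<longlongrightarrow> 0) (at_right 0)"
    and a: "a + \<tau>1 > 0" "a > 2 \<or> a = k + 1"
  shows "(energy a c w p \<longlongrightarrow> 0) (at_right 0)"
proof -
  obtain \<delta> M where \<delta>: "0 < \<delta>" "\<delta> \<le> 1" and M: "0 < M" "\<And>s. 0 < s \<Longrightarrow> s \<le> \<delta> \<Longrightarrow> w s \<le> M"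
    using profile_bounded_near_zero[OF sol nonneg lim] by metis
  obtain C where C: "0 < C" "\<And>s. 0 < s \<Longrightarrow> s \<le> \<delta> \<Longrightarrow> \<bar>s * p s\<bar> \<le> C * s powr (2 + \<tau>1)"
    using slope_near_zero[OF sol nonneg lim \<delta> M] by metis
  have small: "\<forall>\<^sub>F s in at_right 0. 0 < s \<and> s \<le> \<delta>"
    using eventually_at_right_real[OF \<delta>(1)] by eventually_elim auto
  note pw = tendsto_cmult_powr_zero
  have w: "\<bar>w s\<bar> \<le> M" if "0 < s" "s \<le> \<delta>" for s
    using M(2)[OF that] nonneg[OF that(1)] by auto
  have t1: "((\<lambda>s. s powr a * (p s)\<^sup>2) \<longlongrightarrow> 0) (at_right 0)"
  proof (rule Lim_null_comparison[OF _ pw[of "(a + \<tau>1) + (2 + \<tau>1)" "C\<^sup>2"]])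
    show "\<forall>\<^sub>F s in at_right 0. norm (s powr a * (p s)\<^sup>2) \<le> C\<^sup>2 * s powr ((a + \<tau>1) + (2 + \<tau>1))"
      using small
    proof eventually_elim
      case (elim s)
      have "\<bar>s * p s\<bar>\<^sup>2 \<le> (C * s powr (2 + \<tau>1))\<^sup>2" using C(2)[of s] elim by (intro power_mono) auto
      then have "s powr (a - 2) * \<bar>s * p s\<bar>\<^sup>2 \<le> s powr (a - 2) * (C * s powr (2 + \<tau>1))\<^sup>2"
        by (intro mult_left_mono) auto
      moreover have "s powr (a - 2) * \<bar>s * p s\<bar>\<^sup>2 = s powr a * (p s)\<^sup>2"
        using elim by (simp add: powr_diff powr_numeral power_mult_distrib abs_mult)
      moreover have "s powr (a - 2) * (C * s powr (2 + \<tau>1))\<^sup>2 = C\<^sup>2 * s powr ((a + \<tau>1) + (2 + \<tau>1))"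
        using elim powr_add[of s \<tau>1 \<tau>1]
        by (simp add: powr_diff powr_add powr_numeral power_mult_distrib power2_eq_square)
      ultimately show ?case by simp
    qed
  qed (use a tau1 in auto)
  have t2: "((\<lambda>s. s powr a * (s powr \<tau>2 * (w s)\<^sup>2)) \<longlongrightarrow> 0) (at_right 0)"
  proof (rule Lim_null_comparison[OF _ pw[of "a + \<tau>2" "M\<^sup>2"]])
    show "\<forall>\<^sub>F s in at_right 0. norm (s powr a * (s powr \<tau>2 * (w s)\<^sup>2)) \<le> M\<^sup>2 * s powr (a + \<tau>2)"
      using small
    proof eventually_elim
      case (elim s)
      have "(w s)\<^sup>2 \<le> M\<^sup>2" using w[of s] elim by (intro abs_le_square_iff[THEN iffD1]) auto
      then have "s powr (a + \<tau>2) * (w s)\<^sup>2 \<le> s powr (a + \<tau>2) * M\<^sup>2" by (intro mult_left_mono) auto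
      then show ?case by (simp add: powr_add mult_ac)
    qed
  qed (use a tau_le in auto)
  have t3: "((\<lambda>s. s powr a * (s powr \<tau>1 * max (w s) 0 powr (q + 1))) \<longlongrightarrow> 0) (at_right 0)"
  proof (rule Lim_null_comparison[OF _ pw[of "a + \<tau>1" "M powr (q + 1)"]])
    show "\<forall>\<^sub>F s in at_right 0. norm (s powr a * (s powr \<tau>1 * max (w s) 0 powr (q + 1)))
        \<le> M powr (q + 1) * s powr (a + \<tau>1)"
      using small
    proof eventually_elim
      case (elim s)
      have "max (w s) 0 powr (q + 1) \<le> M powr (q + 1)"
        using M(2)[of s] elim M(1) q_pos by (intro powr_mono2) auto
      then have "s powr (a + \<tau>1) * max (w s) 0 powr (q + 1) \<le> s powr (a + \<tau>1) * M powr (q + 1)"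
        by (intro mult_left_mono) auto
      then show ?case by (simp add: powr_add mult_ac)
    qed
  qed (use a in auto)
  have t4: "((\<lambda>s. s powr (a - 1) * (w s * p s)) \<longlongrightarrow> 0) (at_right 0)"
  proof (rule Lim_null_comparison[OF _ pw[of "a + \<tau>1" "M * C"]])
    show "\<forall>\<^sub>F s in at_right 0. norm (s powr (a - 1) * (w s * p s)) \<le> M * C * s powr (a + \<tau>1)"
      using small
    proof eventually_elim
      case (elim s)
      have "\<bar>w s\<bar> * \<bar>s * p s\<bar> \<le> M * (C * s powr (2 + \<tau>1))"
        using w[of s] C(2)[of s] elim M(1) by (intro mult_mono) auto
      then have "s powr (a - 2) * (\<bar>w s\<bar> * \<bar>s * p s\<bar>) \<le> s powr (a - 2) * (M * (C * s powr (2 + \<tau>1)))"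
        by (intro mult_left_mono) auto
      moreover have "s powr (a - 2) * (\<bar>w s\<bar> * \<bar>s * p s\<bar>) = norm (s powr (a - 1) * (w s * p s))"
        using elim by (simp add: powr_diff powr_numeral abs_mult power2_eq_square)
      moreover have "s powr (a - 2) * (M * (C * s powr (2 + \<tau>1))) = M * C * s powr (a + \<tau>1)"
        using elim by (simp add: powr_diff powr_add powr_numeral)
      ultimately show ?case by simp
    qed
  qed (use a in auto)
  have t5: "((\<lambda>s. (k + 1 - a) * (s powr (a - 2) * (w s)\<^sup>2)) \<longlongrightarrow> 0) (at_right 0)"
  proof (cases "a = k + 1")
    case False
    then have "a > 2" using a by auto
    have "((\<lambda>s. s powr (a - 2) * (w s)\<^sup>2) \<longlongrightarrow> 0) (at_right 0)"
    proof (rule Lim_null_comparison[OF _ pw[of "a - 2" "M\<^sup>2"]])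
      show "\<forall>\<^sub>F s in at_right 0. norm (s powr (a - 2) * (w s)\<^sup>2) \<le> M\<^sup>2 * s powr (a - 2)"
        using small
      proof eventually_elim
        case (elim s)
        have "(w s)\<^sup>2 \<le> M\<^sup>2" using w[of s] elim by (intro abs_le_square_iff[THEN iffD1]) auto
        then show ?case by (simp add: mult.commute mult_right_mono)
      qed
    qed (use \<open>a > 2\<close> in auto)
    then show ?thesis by (rule tendsto_mult_right_zero)
  qed simp
  have "((\<lambda>s. 1/2 * (s powr a * (p s)\<^sup>2) + \<beta> / 2 * (s powr a * (s powr \<tau>2 * (w s)\<^sup>2))
      - \<gamma> / (q + 1) * (s powr a * (s powr \<tau>1 * max (w s) 0 powr (q + 1)))
      + c * (s powr (a - 1) * (w s * p s)) + c / 2 * ((k + 1 - a) * (s powr (a - 2) * (w s)\<^sup>2))) \<longlongrightarrow> 0) (at_right 0)"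
    by (rule tendsto_eq_rhs[OF tendsto_add[OF tendsto_add[OF tendsto_diff[OF tendsto_add[OF
      tendsto_mult_left[OF t1] tendsto_mult_left[OF t2]] tendsto_mult_left[OF t3]]
      tendsto_mult_left[OF t4]] tendsto_mult_left[OF t5]]]) simp
  moreover have "(\<lambda>s. 1/2 * (s powr a * (p s)\<^sup>2) + \<beta> / 2 * (s powr a * (s powr \<tau>2 * (w s)\<^sup>2))
      - \<gamma> / (q + 1) * (s powr a * (s powr \<tau>1 * max (w s) 0 powr (q + 1)))
      + c * (s powr (a - 1) * (w s * p s)) + c / 2 * ((k + 1 - a) * (s powr (a - 2) * (w s)\<^sup>2))) = energy a c w p"
    by (rule ext) (simp add: energy_def field_simps)
  ultimately show ?thesis by simp
qed

end

section \<open>Positive tails do not exist\<close>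

lemma decreasing_of_deriv:
  fixes f f' :: "real \<Rightarrow> real"
  assumes "a \<le> b" "\<And>x. a \<le> x \<Longrightarrow> x \<le> b \<Longrightarrow> (f has_real_derivative f' x) (at x)"
    "\<And>x. a \<le> x \<Longrightarrow> x \<le> b \<Longrightarrow> f' x \<le> 0"
  shows "f b \<le> f a"
  by (rule DERIV_nonpos_imp_nonincreasing[where f = f]) (use assms in blast)+

lemma powr_unbounded:
  fixes b K :: real
  assumes "b > 0"
  obtains R where "R \<ge> 1" "\<And>s. s \<ge> R \<Longrightarrow> K \<le> s powr b"
proof
  define R where "R = max K 1 powr (1 / b)"
  show "R \<ge> 1" using assms by (simp add: R_def ge_one_powr_ge_zero)
  fix s assume "s \<ge> R"
  then have "R powr b \<le> s powr b" using assms \<open>R \<ge> 1\<close> by (intro powr_mono2) auto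
  moreover have "R powr b = max K 1" using assms by (simp add: R_def powr_powr)
  ultimately show "K \<le> s powr b" by simp
qed

context radial_profile begin

text \<open>A positive profile with nonnegative energy cannot have a local minimum far out, so it is
  eventually decreasing; its energy then forces it to reach \<open>0\<close> at a finite radius.\<close>

lemma no_positive_tail:
  assumes lt: "\<tau>1 < \<tau>2" and R: "R > 0"
    and sol: "\<And>s. s \<ge> R \<Longrightarrow> solves_at w p s" and pos: "\<And>s. s \<ge> R \<Longrightarrow> 0 < w s"
    and E: "\<And>s. s \<ge> R \<Longrightarrow> 0 \<le> energy a c w p s"
  shows False
proof -
  have tau2': "0 < 2 + \<tau>2" and lt': "0 < \<tau>2 - \<tau>1" using tau2 lt by auto
  \<comment> \<open>y is the ratio of the two terms of the source, which becomes \<gamma> s^\<tau>1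
    w^q (1 - y).\<close>
  define y where "y = (\<lambda>s. \<beta> * s powr (\<tau>2 - \<tau>1) * w s powr (1 - q) / \<gamma>)"
  \<comment> \<open>The potential in the energy is a positive multiple of y/2 - 1/(q + 1), so it is
    negative for y < 2/(q + 1). k0 is the midpoint of 1 and 2/(q + 1): for y >= k0 the source is
    negative with a margin, for y <= k0 the potential is, and \<kappa> is half of the latter
    margin.\<close>
  define k0 where "k0 = (q + 3) / (2 * (q + 1))"
  define \<kappa> where "\<kappa> = (1 - q) / (8 * (q + 1))"
  \<comment> \<open>Coefficient of (w/s)^2 left over after the mixed term of the energy is split by
    Young's inequality; beyond R1 below it is absorbed in half of the margin.\<close>
  define D where "D = max 0 (c\<^sup>2 / 2 + c * (k + 1 - a) / 2)"
  have k0: "k0 > 1" and kap: "\<kappa> > 0" using q_pos q_less by (auto simp: k0_def \<kappa>_def field_simps)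
  have k0': "1 / (q + 1) - k0 / 2 = 2 * \<kappa>"
  proof -
    have "1 / v - (v + 2) / (2 * v) / 2 = 2 * ((2 - v) / (8 * v))" if "v \<noteq> 0" for v :: real
      using that by (simp add: field_simps)
    from this[of "q + 1"] show ?thesis
      using q_pos unfolding k0_def \<kappa>_def by (simp add: add.assoc)
  qed
  have y_pos: "y s > 0" if "s \<ge> R" for s
    using pos[OF that] beta_pos gamma_pos R that by (simp add: y_def)
  have yeq: "\<gamma> * s powr \<tau>1 * w s powr q * y s = \<beta> * s powr \<tau>2 * w s" if "s \<ge> R" for s
    using pos[OF that] gamma_pos R that by (simp add: y_def powr_diff)
  have src: "source s (w s) = \<gamma> * s powr \<tau>1 * w s powr q * (1 - y s)" if "s \<ge> R" for s
    using yeq[OF that] pos[OF that] by (simp add: source_def right_diff_distrib)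
  have src_neg: "source s (w s) \<le> - ((1 - 1 / k0) * \<beta>) * s powr \<tau>2 * w s" if "s \<ge> R" "y s \<ge> k0" for s
  proof -
    have "\<gamma> * s powr \<tau>1 * w s powr q * k0 \<le> \<gamma> * s powr \<tau>1 * w s powr q * y s"
      using gamma_pos that by (intro mult_left_mono) auto
    then have "\<gamma> * s powr \<tau>1 * w s powr q \<le> \<beta> * s powr \<tau>2 * w s / k0"
      using yeq[OF that(1)] k0 by (simp add: pos_le_divide_eq)
    then show ?thesis using pos[OF that(1)] by (simp add: source_def algebra_simps)
  qed
  obtain R1 where R1: "R1 \<ge> 1" "\<And>s. s \<ge> R1 \<Longrightarrow> D * k0 / (\<beta> * \<kappa>) \<le> s powr (2 + \<tau>2)"
    using powr_unbounded[OF tau2'] by blast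
  \<comment> \<open>Where the potential is negative, a nonnegative energy has to be supplied by the
    kinetic term p^2.\<close>
  have key: "\<kappa> * \<gamma> * s powr \<tau>1 * w s powr (q + 1) \<le> (p s)\<^sup>2" if s: "s \<ge> R" "s \<ge> R1" and y: "y s \<le> k0" for s
  proof -
    have s0: "s > 0" using s R by auto
    define B where "B = \<gamma> * s powr \<tau>1 * w s powr (q + 1)"
    have B: "B \<ge> 0" using gamma_pos by (simp add: B_def)
    have By: "B * y s = \<beta> * s powr \<tau>2 * (w s)\<^sup>2"
      using yeq[OF s(1)] pos[OF s(1)] by (simp add: B_def powr_add power2_eq_square mult_ac)
    have Bk: "\<beta> * s powr \<tau>2 * (w s)\<^sup>2 \<le> B * k0"
      unfolding By[symmetric] using B y by (rule mult_left_mono[rotated])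
    have "energy a c w p s = s powr a * ((p s)\<^sup>2 / 2 + \<beta> * s powr \<tau>2 * (w s)\<^sup>2 / 2 - B / (q + 1)
        + c * (w s / s) * p s + c * (k + 1 - a) / 2 * (w s / s)\<^sup>2)"
      using s0 pos[OF s(1)] by (simp add: energy_def B_def powr_diff powr_numeral field_simps power2_eq_square)
    then have "0 \<le> (p s)\<^sup>2 / 2 + \<beta> * s powr \<tau>2 * (w s)\<^sup>2 / 2 - B / (q + 1)
        + c * (w s / s) * p s + c * (k + 1 - a) / 2 * (w s / s)\<^sup>2"
      using E[OF s(1)] s0 by (simp add: zero_le_mult_iff)
    moreover have "c * (w s / s) * p s \<le> (p s)\<^sup>2 / 2 + c\<^sup>2 / 2 * (w s / s)\<^sup>2"
    proof -
      have "(c * (w s / s) - p s)\<^sup>2 = c\<^sup>2 * (w s / s)\<^sup>2 + (p s)\<^sup>2 - 2 * (c * (w s / s) * p s)"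
        by algebra
      then show ?thesis using zero_le_power2[of "c * (w s / s) - p s"] by linarith
    qed
    moreover have "(c\<^sup>2 / 2 + c * (k + 1 - a) / 2) * (w s / s)\<^sup>2 \<le> D * (w s / s)\<^sup>2"
      by (intro mult_right_mono) (auto simp: D_def)
    ultimately have 1: "0 \<le> (p s)\<^sup>2 + B * k0 / 2 - B / (q + 1) + D * (w s / s)\<^sup>2"
      using Bk by (simp add: distrib_right)
    have "D * (w s / s)\<^sup>2 \<le> \<kappa> * B"
    proof -
      have "D * k0 \<le> s powr (2 + \<tau>2) * (\<beta> * \<kappa>)"
        using R1(2)[OF s(2)] kap beta_pos by (simp add: pos_divide_le_eq)
      then have "D * k0 * (w s / s)\<^sup>2 \<le> s powr (2 + \<tau>2) * (\<beta> * \<kappa>) * (w s / s)\<^sup>2"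
        by (intro mult_right_mono) auto
      also have "\<dots> = \<kappa> * (\<beta> * s powr \<tau>2 * (w s)\<^sup>2)"
        using s0 by (simp add: powr_add powr_numeral power_divide)
      also have "\<dots> \<le> \<kappa> * (B * k0)" using Bk kap by (intro mult_left_mono) auto
      finally have "D * (w s / s)\<^sup>2 * k0 \<le> \<kappa> * B * k0" by (simp add: mult_ac)
      then show ?thesis using k0 by simp
    qed
    moreover have "B / (q + 1) - B * k0 / 2 = 2 * \<kappa> * B"
      using arg_cong[OF k0', of "\<lambda>x. B * x"] by (simp add: right_diff_distrib mult_ac)
    ultimately have "\<kappa> * B \<le> (p s)\<^sup>2" using 1 by linarith
    then show ?thesis by (simp add: B_def mult.assoc)
  qed
  define r where "r = max R R1"
  have r: "r \<ge> R" "r \<ge> R1" "r \<ge> 1" "r > 0" using R1 by (auto simp: r_def)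
  define f where "f = (\<lambda>s. s powr k * p s)"
  have df: "(f has_real_derivative s powr k * source s (w s)) (at s)" if "s \<ge> R" for s
    unfolding f_def using flux_derivative[OF sol[OF that]] that R by simp
  have dw: "(w has_real_derivative p s) (at s)" if "s \<ge> R" for s
    using sol[OF that] by (simp add: solves_at_def)
  have dpw: "((\<lambda>s. C * s powr (k + 1 + \<tau>2) / (k + 1 + \<tau>2)) has_real_derivative C * s powr (k + \<tau>2)) (at s)"
    if "s > 0" for C s
    using DERIV_cdivide[OF DERIV_cmult[OF has_real_derivative_powr[OF that, of "k + 1 + \<tau>2"], of C], of "k + 1 + \<tau>2"]
      tau2 by simp
  \<comment> \<open>If p stayed positive, w would be bounded below, \<tau>1 < \<tau>2 would push y
    beyond k0, and the flux would fall at least like - s^(k + 1 + \<tau>2), becoming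
    negative.\<close>
  have "\<exists>s\<ge>r. p s \<le> 0"
  proof (rule ccontr)
    assume "\<not> ?thesis"
    then have pp: "p s > 0" if "s \<ge> r" for s using that by (meson not_le)
    have wmono: "w r \<le> w s" if "s \<ge> r" for s
      using decreasing_of_deriv[of r s "\<lambda>s. - w s" "\<lambda>s. - p s"] that dw pp r
      by (force intro: DERIV_minus less_imp_le)
    obtain R2 where R2: "R2 \<ge> 1" "\<And>s. s \<ge> R2 \<Longrightarrow> k0 * \<gamma> / (\<beta> * w r powr (1 - q)) \<le> s powr (\<tau>2 - \<tau>1)"
      using powr_unbounded[OF lt'] by blast
    define r' where "r' = max r R2"
    have r': "r' \<ge> r" "r' \<ge> R2" "r' > 0" "r' \<ge> R" using r by (auto simp: r'_def)
    have yk: "y s \<ge> k0" if "s \<ge> r'" for s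
    proof -
      have "k0 * \<gamma> \<le> s powr (\<tau>2 - \<tau>1) * (\<beta> * w r powr (1 - q))"
        using R2(2)[of s] that r' beta_pos pos[OF r(1)] by (simp add: pos_divide_le_eq)
      also have "\<dots> \<le> s powr (\<tau>2 - \<tau>1) * (\<beta> * w s powr (1 - q))"
        using wmono[of s] that r' beta_pos pos[OF r(1)] q_less by (intro mult_left_mono powr_mono2) auto
      finally show ?thesis using gamma_pos by (simp add: y_def pos_le_divide_eq mult_ac)
    qed
    define C where "C = (1 - 1 / k0) * \<beta> * w r"
    have C: "C > 0" using k0 beta_pos pos[OF r(1)] by (simp add: C_def)
    have bound: "f s \<le> f r' + C * r' powr (k + 1 + \<tau>2) / (k + 1 + \<tau>2) - C * s powr (k + 1 + \<tau>2) / (k + 1 + \<tau>2)" if "s \<ge> r'" for s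
    proof -
      have "f s + C * s powr (k + 1 + \<tau>2) / (k + 1 + \<tau>2) \<le> f r' + C * r' powr (k + 1 + \<tau>2) / (k + 1 + \<tau>2)"
      proof (rule decreasing_of_deriv[OF that])
        fix x assume x: "r' \<le> x" "x \<le> s"
        show "((\<lambda>s. f s + C * s powr (k + 1 + \<tau>2) / (k + 1 + \<tau>2)) has_real_derivative
            x powr k * source x (w x) + C * x powr (k + \<tau>2)) (at x)"
          using df[of x] dpw[of x C] x r' by (intro DERIV_add) auto
        have "source x (w x) \<le> - ((1 - 1 / k0) * \<beta>) * x powr \<tau>2 * w x"
          using src_neg[of x] yk[of x] x r' by auto
        also have "\<dots> = - ((1 - 1 / k0) * \<beta> * x powr \<tau>2 * w x)" by simp
        also have "\<dots> \<le> - ((1 - 1 / k0) * \<beta> * x powr \<tau>2 * w r)"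
          using wmono[of x] x r' k0 beta_pos by (intro le_imp_neg_le mult_left_mono) auto
        finally have "x powr k * source x (w x) \<le> x powr k * (- (C * x powr \<tau>2))"
          by (intro mult_left_mono) (auto simp: C_def mult_ac)
        then show "x powr k * source x (w x) + C * x powr (k + \<tau>2) \<le> 0"
          by (simp add: powr_add mult_ac)
      qed
      then show ?thesis by simp
    qed
    obtain R3 where R3: "R3 \<ge> 1" "\<And>s. s \<ge> R3 \<Longrightarrow>
        (f r' + C * r' powr (k + 1 + \<tau>2) / (k + 1 + \<tau>2)) * (k + 1 + \<tau>2) / C \<le> s powr (k + 1 + \<tau>2)"
      using powr_unbounded[OF tau2(2)] by blast
    define s where "s = max r' R3"
    have "s \<ge> r'" "s \<ge> R3" by (auto simp: s_def)
    have "f r' + C * r' powr (k + 1 + \<tau>2) / (k + 1 + \<tau>2) \<le> C * s powr (k + 1 + \<tau>2) / (k + 1 + \<tau>2)"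
      using R3(2)[OF \<open>s \<ge> R3\<close>] C tau2 by (simp add: pos_le_divide_eq pos_divide_le_eq mult_ac)
    then have "f s \<le> 0" using bound[OF \<open>s \<ge> r'\<close>] by simp
    moreover have "f s > 0" using pp[of s] \<open>s \<ge> r'\<close> r' by (simp add: f_def)
    ultimately show False by simp
  qed
  then obtain r2 where r2: "r2 \<ge> r" "p r2 \<le> 0" by blast
  \<comment> \<open>At a zero of p the bound \<open>key\<close> fails, so y > k0 > 1 and the source
    is negative: the flux can cross 0 only downwards.\<close>
  have p_nonpos: "p s \<le> 0" if "s \<ge> r2" for s
  proof -
    have "f s \<le> 0"
    proof (rule barrier_nonpos[of r2 f "\<lambda>s. s powr k * source s (w s)"])
      show "f r2 \<le> 0" using r2 r by (simp add: f_def mult_nonneg_nonpos)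
      fix t assume t: "r2 \<le> t"
      then have t': "t \<ge> R" "t \<ge> R1" "t > 0" using r2 r by auto
      show "(f has_real_derivative t powr k * source t (w t)) (at t)" using df t' by blast
      assume "f t = 0"
      then have "p t = 0" using t' by (simp add: f_def)
      moreover have "\<kappa> * \<gamma> * t powr \<tau>1 * w t powr (q + 1) > 0"
        using kap gamma_pos t' pos[OF t'(1)] by simp
      ultimately have "y t > k0" using key[OF t'(1,2)] by force
      then have "1 - y t < 0" using k0 by simp
      then show "t powr k * source t (w t) < 0"
        using t' gamma_pos pos[OF t'(1)] by (simp add: src mult_pos_neg)
    qed (use that in auto)
    then show ?thesis using that r2 r by (simp add: f_def mult_le_0_iff)
  qed
  have w_anti: "w t \<le> w s" if "r2 \<le> s" "s \<le> t" for s t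
    using decreasing_of_deriv[of s t w p] that dw p_nonpos r2 r by auto
  define L where "L = (\<lambda>s. ln (y s))"
  have dL: "(L has_real_derivative ((\<tau>2 - \<tau>1) + (1 - q) * (s * p s / w s)) / s) (at s)" if s: "s > R" for s
  proof -
    have s0: "s > 0" using s R by simp
    have "((\<lambda>s. ln (\<beta> / \<gamma>) + (\<tau>2 - \<tau>1) * ln s + (1 - q) * ln (w s)) has_real_derivative
       (\<tau>2 - \<tau>1) * (1 / s) + (1 - q) * (1 / w s * p s)) (at s)"
      using s0 pos[of s] dw[of s] s
      by (auto intro!: derivative_eq_intros)
    moreover have "\<forall>\<^sub>F s in nhds s. L s = ln (\<beta> / \<gamma>) + (\<tau>2 - \<tau>1) * ln s + (1 - q) * ln (w s)"
    proof (rule eventually_mono)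
      show "\<forall>\<^sub>F s in nhds s. s \<in> {R<..}" using s by (intro eventually_nhds_in_open) auto
      fix s assume "s \<in> {R<..}"
      then have "s > 0" "w s > 0" using R pos[of s] by auto
      then show "L s = ln (\<beta> / \<gamma>) + (\<tau>2 - \<tau>1) * ln s + (1 - q) * ln (w s)"
        using beta_pos gamma_pos by (simp add: L_def y_def ln_mult ln_div ln_powr)
    qed
    ultimately have "(L has_real_derivative (\<tau>2 - \<tau>1) * (1 / s) + (1 - q) * (1 / w s * p s)) (at s)"
      by (subst DERIV_cong_ev[OF refl _ refl])
    then show ?thesis
      by (rule DERIV_cong) (use s0 in \<open>simp add: field_simps\<close>)
  qed
  \<comment> \<open>The slope s p / w <= - K beats the growth of s^(\<tau>2 - \<tau>1) in y with one
    unit to spare, which gives (ln y)' <= - 1/s.\<close>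
  define K where "K = (\<tau>2 - \<tau>1 + 1) / (1 - q)"
  have K: "(1 - q) * K = \<tau>2 - \<tau>1 + 1" using q_less by (simp add: K_def)
  have L_slope: "((\<tau>2 - \<tau>1) + (1 - q) * (s * p s / w s)) / s \<le> - (1 / s)" if "s > 0" "s * p s / w s \<le> - K" for s
  proof -
    have "(1 - q) * (s * p s / w s) \<le> (1 - q) * (- K)" using that q_less by (intro mult_left_mono) auto
    then have "(\<tau>2 - \<tau>1) + (1 - q) * (s * p s / w s) \<le> -1" using K by simp
    then show ?thesis using that(1) by (simp add: divide_le_eq)
  qed
  \<comment> \<open>While y > k0, the source is at most - C s^\<tau>2 w with w decreasing, so
    integrating the flux makes s p / w drop below - K. Then ln y + ln s is nonincreasing, and ln y
    could not remain positive.\<close>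
  have low: "\<exists>s\<ge>r3. y s \<le> k0" if r3: "r3 > r2" for r3
  proof (rule ccontr)
    assume "\<not> ?thesis"
    then have yk: "y s > k0" if "s \<ge> r3" for s using that by (meson not_le)
    define C where "C = (1 - 1 / k0) * \<beta>"
    have C: "C > 0" using k0 beta_pos by (simp add: C_def)
    have r30: "r3 > 0" "r3 > R" "r3 > r2" using r3 r2 r by auto
    have bound: "f s \<le> (C * w s) * r3 powr (k + 1 + \<tau>2) / (k + 1 + \<tau>2) - (C * w s) * s powr (k + 1 + \<tau>2) / (k + 1 + \<tau>2)" if "s \<ge> r3" for s
    proof -
      have "f s + (C * w s) * s powr (k + 1 + \<tau>2) / (k + 1 + \<tau>2) \<le> f r3 + (C * w s) * r3 powr (k + 1 + \<tau>2) / (k + 1 + \<tau>2)"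
      proof (rule decreasing_of_deriv[OF that])
        fix x assume x: "r3 \<le> x" "x \<le> s"
        show "((\<lambda>t. f t + (C * w s) * t powr (k + 1 + \<tau>2) / (k + 1 + \<tau>2)) has_real_derivative
            x powr k * source x (w x) + (C * w s) * x powr (k + \<tau>2)) (at x)"
          using df[of x] dpw[of x "C * w s"] x r30 by (intro DERIV_add) auto
        have "source x (w x) \<le> - C * x powr \<tau>2 * w x"
          using src_neg[of x] yk[of x] x r30 by (auto simp: C_def)
        also have "\<dots> = - (C * x powr \<tau>2 * w x)" by simp
        also have "\<dots> \<le> - (C * x powr \<tau>2 * w s)"
          using w_anti[of x s] x r30 C by (intro le_imp_neg_le mult_left_mono) auto
        finally have "x powr k * source x (w x) \<le> x powr k * (- (C * x powr \<tau>2 * w s))"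
          by (intro mult_left_mono) auto
        then show "x powr k * source x (w x) + (C * w s) * x powr (k + \<tau>2) \<le> 0"
          by (simp add: powr_add mult_ac)
      qed
      moreover have "f r3 \<le> 0" using p_nonpos[of r3] r30 by (simp add: f_def mult_nonneg_nonpos)
      ultimately show ?thesis by simp
    qed
    define n where "n = k + 1 + \<tau>2"
    have n: "n > 0" using tau2 by (simp add: n_def)
    obtain R4 where R4: "R4 \<ge> 1" "\<And>s. s \<ge> R4 \<Longrightarrow> 2 * r3 powr n \<le> s powr n"
      using powr_unbounded[OF n] by blast
    obtain R5 where R5: "R5 \<ge> 1" "\<And>s. s \<ge> R5 \<Longrightarrow> 2 * n * K / C \<le> s powr (2 + \<tau>2)"
      using powr_unbounded[OF tau2'] by blast
    define r4 where "r4 = max r3 (max R4 R5)"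
    have r4: "r4 \<ge> r3" "r4 \<ge> R4" "r4 \<ge> R5" "r4 > 0" using r30 by (auto simp: r4_def)
    have slope: "s * p s / w s \<le> - K" if s: "s \<ge> r4" for s
    proof -
      have s0: "s > 0" "s \<ge> R" using s r4 r30 by auto
      have ws: "w s > 0" using pos s0 by auto
      have "f s \<le> C * w s / n * (r3 powr n - s powr n)"
        using bound[of s] s r4 by (simp add: n_def right_diff_distrib)
      also have "\<dots> \<le> C * w s / n * (- (s powr n / 2))"
        using R4(2)[of s] s r4 C ws n by (intro mult_left_mono) auto
      finally have "s powr (- k) * f s \<le> s powr (- k) * (C * w s / n * (- (s powr n / 2)))"
        by (intro mult_left_mono) auto
      moreover have "s powr (- k) * f s = p s" using s0 by (simp add: f_def powr_minus)
      moreover have "s powr (- k) * s powr n = s powr (1 + \<tau>2)"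
        using s0 by (simp add: n_def flip: powr_add)
      ultimately have "p s \<le> - (C * w s / (2 * n) * s powr (1 + \<tau>2))"
        by (simp add: mult_ac)
      then have "s * p s / w s \<le> s * (- (C * w s / (2 * n) * s powr (1 + \<tau>2))) / w s"
        using s0 ws by (intro divide_right_mono mult_left_mono) auto
      also have "\<dots> = - (C / (2 * n) * s powr (2 + \<tau>2))"
        using s0 ws by (simp add: powr_add powr_numeral power2_eq_square)
      also have "\<dots> \<le> - K"
        using R5(2)[of s] s r4 C n by (simp add: pos_divide_le_eq pos_le_divide_eq mult_ac)
      finally show ?thesis .
    qed
    have Lb: "L s + ln s \<le> L r4 + ln r4" if "s \<ge> r4" for s
    proof (rule decreasing_of_deriv[OF that])
      fix x assume x: "r4 \<le> x" "x \<le> s"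
      show "((\<lambda>s. L s + ln s) has_real_derivative ((\<tau>2 - \<tau>1) + (1 - q) * (x * p x / w x)) / x + 1 / x) (at x)"
        using dL[of x] x r4 r30 by (intro DERIV_add DERIV_ln_divide) auto
      show "((\<tau>2 - \<tau>1) + (1 - q) * (x * p x / w x)) / x + 1 / x \<le> 0"
        using L_slope[OF _ slope[OF x(1)]] x r4 by simp
    qed
    define s where "s = max r4 (exp (L r4 + ln r4))"
    have "s \<ge> r4" "s > 0" using r4 by (auto simp: s_def)
    have "exp (L r4 + ln r4) \<le> s" by (simp add: s_def)
    then have "L r4 + ln r4 \<le> ln s" using \<open>s > 0\<close> by (simp add: ln_ge_iff)
    then have "L s \<le> 0" using Lb[OF \<open>s \<ge> r4\<close>] by simp
    moreover have "L s > 0" using yk[of s] k0 \<open>s \<ge> r4\<close> r4 by (simp add: L_def)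
    ultimately show False by simp
  qed
  obtain R6 where R6: "R6 \<ge> 1" "\<And>s. s \<ge> R6 \<Longrightarrow> K\<^sup>2 * k0 / (\<kappa> * \<beta>) \<le> s powr (2 + \<tau>2)"
    using powr_unbounded[OF tau2'] by blast
  \<comment> \<open>By \<open>key\<close> and the definition of y, (s p / w)^2 >= \<kappa> \<beta>
    s^(2 + \<tau>2) / y, which for y <= k0 is at least K^2 beyond R6.\<close>
  have slope: "s * p s / w s \<le> - K" if s: "s > r2" "s \<ge> R6" and y: "y s \<le> k0" for s
  proof -
    have s': "s \<ge> R" "s \<ge> R1" "s > 0" using s r2 r by auto
    have ws: "w s > 0" using pos s' by auto
    have kb: "0 < \<kappa> * \<beta>" "0 < \<gamma> * s powr \<tau>1 * w s powr q" using kap beta_pos gamma_pos ws s' by auto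
    have "K\<^sup>2 * k0 \<le> \<kappa> * \<beta> * s powr (2 + \<tau>2)"
      using R6(2)[OF s(2)] kb by (simp add: pos_divide_le_eq mult_ac)
    then have "K\<^sup>2 * y s \<le> \<kappa> * \<beta> * s powr (2 + \<tau>2)"
      using mult_left_mono[OF y, of "K\<^sup>2"] by simp
    then have "K\<^sup>2 * (\<gamma> * s powr \<tau>1 * w s powr q * y s) \<le> \<gamma> * s powr \<tau>1 * w s powr q * (\<kappa> * \<beta> * s powr (2 + \<tau>2))"
      using mult_left_mono[of "K\<^sup>2 * y s" "\<kappa> * \<beta> * s powr (2 + \<tau>2)" "\<gamma> * s powr \<tau>1 * w s powr q"] kb
      by (simp add: mult_ac)
    then have "(K * w s)\<^sup>2 * (\<beta> * s powr \<tau>2) \<le> s\<^sup>2 * (\<kappa> * \<gamma> * s powr \<tau>1 * w s powr (q + 1)) * (\<beta> * s powr \<tau>2)"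
      unfolding yeq[OF s'(1)] using ws s'
      mult_left_mono[of "K\<^sup>2 * (\<beta> * s powr \<tau>2 * w s)" "\<gamma> * s powr \<tau>1 * w s powr q * (\<kappa> * \<beta> * s powr (2 + \<tau>2))" "w s"]
      by (simp add: powr_add powr_numeral power2_eq_square mult_ac)
    then have "(K * w s)\<^sup>2 \<le> s\<^sup>2 * (\<kappa> * \<gamma> * s powr \<tau>1 * w s powr (q + 1))"
      using beta_pos s' by simp
    also have "\<dots> \<le> s\<^sup>2 * (p s)\<^sup>2"
      using key[OF s'(1,2) y] by (intro mult_left_mono) auto
    finally have "(K * w s)\<^sup>2 \<le> (s * (- p s))\<^sup>2" by (simp add: power_mult_distrib)
    then have "K * w s \<le> s * (- p s)"
      by (rule power2_le_imp_le) (use s' p_nonpos[of s] s in \<open>simp add: mult_nonneg_nonpos\<close>)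
    then show ?thesis using ws by (simp add: pos_divide_le_eq)
  qed
  obtain r3 where r3: "r3 \<ge> max (r2 + 1) R6" "y r3 \<le> k0" using low[of "max (r2 + 1) R6"] by fastforce
  have r3': "r3 > r2" "r3 \<ge> R6" "r3 > R" "r3 \<ge> 1" "r3 > 0" using r3(1) r2 r by auto
  \<comment> \<open>On the level y = k0 the preceding slope bound makes ln y strictly decreasing, so
    the region y <= k0 cannot be left.\<close>
  have stay: "y s \<le> k0" if "s \<ge> r3" for s
  proof -
    have "L s - ln k0 \<le> 0"
    proof (rule barrier_nonpos[of r3 "\<lambda>s. L s - ln k0" "\<lambda>s. ((\<tau>2 - \<tau>1) + (1 - q) * (s * p s / w s)) / s"])
      show "L r3 - ln k0 \<le> 0" using r3(2) y_pos[of r3] r3' k0 by (simp add: L_def)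
      fix t assume t: "r3 \<le> t"
      show "((\<lambda>s. L s - ln k0) has_real_derivative ((\<tau>2 - \<tau>1) + (1 - q) * (t * p t / w t)) / t) (at t)"
        using DERIV_diff[OF dL[of t] DERIV_const, of "ln k0"] t r3' by simp
      assume "L t - ln k0 = 0"
      then have "y t = k0" using y_pos[of t] t r3' k0 by (simp add: L_def)
      then have "t * p t / w t \<le> - K" using slope[of t] t r3' by auto
      then have "((\<tau>2 - \<tau>1) + (1 - q) * (t * p t / w t)) / t \<le> - (1 / t)"
        using L_slope t r3' by auto
      then show "((\<tau>2 - \<tau>1) + (1 - q) * (t * p t / w t)) / t < 0"
        using t r3' by (smt (verit) zero_less_divide_1_iff)
    qed (use that in auto)
    then show ?thesis using y_pos[of s] that r3' k0 by (simp add: L_def)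
  qed
  \<comment> \<open>Now - p >= const s^(\<tau>1/2) w^((q+1)/2) for all large s. As h - 1 = - (q +
    1)/2, this reads (w^h)' <= - C s^(\<tau>1/2) <= - C/s, so w^h + C ln s is nonincreasing and w^h
    cannot stay positive.\<close>
  define h where "h = (1 - q) / 2"
  have h: "h > 0" using q_less by (simp add: h_def)
  define C where "C = h * sqrt (\<kappa> * \<gamma>)"
  have C: "C > 0" using h kap gamma_pos by (simp add: C_def)
  have zb: "w s powr h + C * ln s \<le> w r3 powr h + C * ln r3" if "s \<ge> r3" for s
  proof (rule decreasing_of_deriv[OF that])
    fix x assume x: "r3 \<le> x" "x \<le> s"
    then have x': "x \<ge> R" "x \<ge> R1" "x > 0" "x > r2" "x \<ge> 1" using r3' r2 r by auto
    have wx: "w x > 0" using pos x' by auto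
    show "((\<lambda>s. w s powr h + C * ln s) has_real_derivative h * w x powr (h - 1) * p x + C * (1 / x)) (at x)"
      using DERIV_fun_powr[OF dw[OF x'(1)] wx, of h] x'
      by (intro DERIV_add DERIV_cmult DERIV_ln_divide) auto
    have "(sqrt (\<kappa> * \<gamma>) * x powr (\<tau>1 / 2) * w x powr ((q + 1) / 2))\<^sup>2 = \<kappa> * \<gamma> * x powr \<tau>1 * w x powr (q + 1)"
    proof -
      have sq: "(z powr (b / 2))\<^sup>2 = z powr b" for z b :: real
        using powr_add[of z "b / 2" "b / 2"] by (simp add: power2_eq_square)
      show ?thesis using kap gamma_pos unfolding power_mult_distrib sq by simp
    qed
    also have "\<dots> \<le> (- p x)\<^sup>2" using key[OF x'(1,2) stay[OF x(1)]] by simp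
    finally have "sqrt (\<kappa> * \<gamma>) * x powr (\<tau>1 / 2) * w x powr ((q + 1) / 2) \<le> - p x"
      by (rule power2_le_imp_le) (use p_nonpos[of x] x' in auto)
    then have "h * w x powr (h - 1) * (sqrt (\<kappa> * \<gamma>) * x powr (\<tau>1 / 2) * w x powr ((q + 1) / 2)) \<le> h * w x powr (h - 1) * (- p x)"
      using h by (intro mult_left_mono) auto
    moreover have "w x powr (h - 1) * w x powr ((q + 1) / 2) = 1"
      using wx by (simp add: h_def field_simps flip: powr_add)
    then have "h * w x powr (h - 1) * (sqrt (\<kappa> * \<gamma>) * x powr (\<tau>1 / 2) * w x powr ((q + 1) / 2)) = C * x powr (\<tau>1 / 2)"
      by (simp add: C_def mult_ac)
    moreover have "C * (1 / x) \<le> C * x powr (\<tau>1 / 2)"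
    proof -
      have "x powr (- 1) \<le> x powr (\<tau>1 / 2)" using x' tau1 by (intro powr_mono) auto
      then show ?thesis using C x' by (intro mult_left_mono) (auto simp: powr_minus inverse_eq_divide)
    qed
    ultimately show "h * w x powr (h - 1) * p x + C * (1 / x) \<le> 0" by simp
  qed
  define A where "A = w r3 powr h + C * ln r3"
  define s where "s = max r3 (exp (A / C))"
  have s: "s \<ge> r3" "s > 0" using r3' by (auto simp: s_def)
  have "exp (A / C) \<le> s" by (simp add: s_def)
  then have "A / C \<le> ln s" using s by (simp add: ln_ge_iff)
  then have "A \<le> C * ln s" using C by (simp add: pos_divide_le_eq mult.commute)
  then have "w s powr h \<le> 0" using zb[OF s(1)] unfolding A_def by linarith
  moreover have "w s powr h > 0" using pos[of s] s r3' by simp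
  ultimately show False by simp
qed

text \<open>At a zero of the nonnegative function \<open>w\<close> also \<open>p = w'\<close> vanishes, hence so does the energy.\<close>

theorem profile_trivial:
  assumes lt: "\<tau>1 < \<tau>2"
    and sol: "\<And>s. s > 0 \<Longrightarrow> solves_at w p s" and nonneg: "\<And>s. s > 0 \<Longrightarrow> 0 \<le> w s"
    and lim: "((\<lambda>s. s powr k * p s) \<longlongrightarrow> 0) (at_right 0)"
    and a: "a + \<tau>1 > 0" "a > 2 \<or> a = k + 1" and c: "c = (a + \<tau>1) / (q + 1)"
    and A: "0 \<le> a / 2 - k + c" and B: "0 \<le> (a + \<tau>2) / 2 - c" and D: "0 \<le> c * (k + 1 - a) / 2 * (a - 2)"
    and strict: "0 < a / 2 - k + c \<or> 0 < c * (k + 1 - a) / 2 * (a - 2)"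
    and s: "s > 0"
  shows "w s = 0"
proof (rule ccontr)
  assume "w s \<noteq> 0"
  then have ws: "w s > 0" using nonneg[OF s] by simp
  let ?A = "a / 2 - k + c" and ?D = "c * (k + 1 - a) / 2 * (a - 2)"
  define E where "E = energy a c w p"
  define E' where "E' = (\<lambda>s. s powr (a - 3) * (?A * (s * p s)\<^sup>2
        + (\<beta> * ((a + \<tau>2) / 2 - c) * s powr (\<tau>2 + 2) + ?D) * (w s)\<^sup>2))"
  have dE: "(E has_real_derivative E' s) (at s)" if "s > 0" for s
    unfolding E_def E'_def by (rule energy_derivative[OF sol[OF that] that c])
  have E'_ge: "s powr (a - 3) * (?A * (s * p s)\<^sup>2 + ?D * (w s)\<^sup>2) \<le> E' s" for s
    unfolding E'_def using B beta_pos by (intro mult_left_mono) (auto simp: distrib_right)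
  have E'_nonneg: "0 \<le> E' s" for s
    using A D by (intro order_trans[OF _ E'_ge]) auto
  have E_nonneg: "0 \<le> E s" if "s > 0" for s
    by (rule nonneg_of_increasing_from_zero[of s E E' E])
      (use dE E'_nonneg energy_limit_zero[OF sol nonneg lim a, of c] that in \<open>auto simp: E_def\<close>)
  have mono: "E t1 \<le> E t2" if "0 < t1" "t1 \<le> t2" for t1 t2
    using decreasing_of_deriv[OF that(2), of "\<lambda>s. - E s" "\<lambda>s. - E' s"] that dE E'_nonneg
    by (force intro: DERIV_minus)
  \<comment> \<open>E is nonnegative and nondecreasing, so a zero t of w forces E = 0 and E' = 0 to
    the left of t. By \<open>strict\<close> either w or p then vanishes on (0, t), and both
    contradict w s > 0.\<close>
  have pos: "w t > 0" if "t \<ge> s" for t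
  proof (rule ccontr)
    assume "\<not> w t > 0"
    then have wt: "w t = 0" using nonneg[of t] that s by simp
    have t0: "t > 0" using that s by simp
    have "p t = 0"
    proof (rule DERIV_local_min[of w "p t" t t])
      show "(w has_real_derivative p t) (at t)" using sol[OF t0] by (simp add: solves_at_def)
      show "\<forall>y. \<bar>t - y\<bar> < t \<longrightarrow> w t \<le> w y" using nonneg wt by auto
    qed (use t0 in auto)
    then have Et: "E t = 0" using wt by (simp add: E_def energy_def)
    have Ez: "E x = 0" if "0 < x" "x \<le> t" for x
      using mono[OF that] E_nonneg[OF that(1)] Et by simp
    have E'z: "E' x = 0" if x: "0 < x" "x < t" for x
    proof -
      have "\<forall>\<^sub>F z in nhds x. E z = 0"
        using eventually_nhds_in_open[of "{0<..<t}" x] x by (auto elim!: eventually_mono intro: Ez)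
      then have "(E has_real_derivative 0) (at x)"
        by (subst DERIV_cong_ev[OF refl _ refl, where g = "\<lambda>_. 0"]) auto
      with dE[OF x(1)] show ?thesis by (rule DERIV_unique)
    qed
    have z: "?A * (x * p x)\<^sup>2 + ?D * (w x)\<^sup>2 = 0" if x: "0 < x" "x < t" for x
    proof -
      have "x powr (a - 3) * (?A * (x * p x)\<^sup>2 + ?D * (w x)\<^sup>2) \<le> 0" using E'_ge[of x] E'z[OF x] by simp
      then have "?A * (x * p x)\<^sup>2 + ?D * (w x)\<^sup>2 \<le> 0" using x by (simp add: mult_le_0_iff)
      moreover have "?A * (x * p x)\<^sup>2 + ?D * (w x)\<^sup>2 \<ge> 0" using A D by (intro add_nonneg_nonneg) auto
      ultimately show ?thesis by simp
    qed
    have st: "s < t" using that wt ws by (cases "s = t") auto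
    have sz: "?A * (x * p x)\<^sup>2 = 0" "?D * (w x)\<^sup>2 = 0" if x: "0 < x" "x < t" for x
    proof -
      have "?A * (x * p x)\<^sup>2 \<ge> 0" "?D * (w x)\<^sup>2 \<ge> 0"
        using A D by (simp_all only: mult_nonneg_nonneg zero_le_power2)
      with z[OF x] show "?A * (x * p x)\<^sup>2 = 0" "?D * (w x)\<^sup>2 = 0" by linarith+
    qed
    from strict show False
    proof
      assume "0 < ?D"
      then have "0 < ?D * (w s)\<^sup>2" by (rule mult_pos_pos) (use ws in simp)
      with sz(2)[OF s st] show False by linarith
    next
      assume A0: "0 < ?A"
      have "w s \<le> w t"
      proof (rule DERIV_nonneg_imp_increasing_open[of s t w])
        fix x assume "s < x" "x < t"
        then have "p x = 0" using sz(1)[of x] s A0 by simp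
        then show "\<exists>y. (w has_real_derivative y) (at x) \<and> 0 \<le> y"
          using sol[of x] s \<open>s < x\<close> by (auto simp: solves_at_def)
      next
        show "continuous_on {s..t} w"
        proof (intro continuous_at_imp_continuous_on ballI)
          fix x assume "x \<in> {s..t}"
          then have "(w has_real_derivative p x) (at x)" using sol[of x] s by (auto simp: solves_at_def)
          then show "isCont w x" by (rule DERIV_isCont)
        qed
      qed (use st in auto)
      with wt ws show False by simp
    qed
  qed
  show False
    by (rule no_positive_tail[OF lt s sol pos, where a = a and c = c])
      (use s E_nonneg in \<open>auto simp: E_def\<close>)
qed

end

section \<open>A Peano theorem\<close>

text \<open>The integral form passes to uniform limits and can be glued at a common endpoint without
  matching one-sided derivatives.\<close>

definition ivp_on :: "(real \<Rightarrow> 'a::euclidean_space \<Rightarrow> 'a) \<Rightarrow> real \<Rightarrow> real \<Rightarrow> 'a \<Rightarrow> (real \<Rightarrow> 'a) \<Rightarrow> bool" where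
  "ivp_on f a b x0 X \<longleftrightarrow> continuous_on {a..b} X \<and>
     (\<forall>t\<in>{a..b}. X t = x0 + integral {a..t} (\<lambda>s. f s (X s)))"

lemma continuous_on_along:
  assumes "continuous_on ({a..b} \<times> UNIV) (\<lambda>(t, x). f t x)" "continuous_on S X" "S \<subseteq> {a..b}"
  shows "continuous_on S (\<lambda>s. f s (X s))"
proof -
  have "continuous_on S ((\<lambda>(t, x). f t x) \<circ> (\<lambda>s. (s, X s)))"
    using assms by (intro continuous_on_compose continuous_on_subset[OF assms(1)] continuous_intros) auto
  then show ?thesis by (simp add: o_def)
qed

lemma indefinite_integral_lipschitz:
  fixes g :: "real \<Rightarrow> 'a::euclidean_space"
  assumes g: "continuous_on {a..b} g" and M: "\<And>s. s \<in> {a..b} \<Longrightarrow> norm (g s) \<le> M"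
    and uv: "u \<in> {a..b}" "v \<in> {a..b}"
  shows "norm (integral {a..u} g - integral {a..v} g) \<le> M * \<bar>u - v\<bar>"
proof -
  have *: "norm (integral {a..u} g - integral {a..v} g) \<le> M * (u - v)"
    if "v \<le> u" "u \<in> {a..b}" "v \<in> {a..b}" for u v
  proof -
    have "integral {a..v} g + integral {v..u} g = integral {a..u} g"
      using that by (intro Henstock_Kurzweil_Integration.integral_combine integrable_continuous_real continuous_on_subset[OF g]) auto
    then have "integral {a..u} g - integral {a..v} g = integral {v..u} g" by (simp add: algebra_simps)
    moreover have "norm (integral {v..u} g) \<le> M * (u - v)"
      using that M by (intro integral_bound continuous_on_subset[OF g]) auto
    ultimately show ?thesis by simp
  qed
  show ?thesis
    using *[of u v] *[of v u] uv by (cases "v \<le> u") (auto simp: norm_minus_commute)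
qed

text \<open>Tonelli's approximations: the integral is evaluated with delay \<open>h\<close>, so that the iterates become
  stationary on \<open>[a, b]\<close> after finitely many steps.\<close>

fun tonelli :: "(real \<Rightarrow> 'a::euclidean_space \<Rightarrow> 'a) \<Rightarrow> real \<Rightarrow> 'a \<Rightarrow> real \<Rightarrow> nat \<Rightarrow> real \<Rightarrow> 'a" where
  "tonelli f a x0 h 0 = (\<lambda>t. x0)"
| "tonelli f a x0 h (Suc j) = (\<lambda>t. x0 + integral {a..max a (t - h)} (\<lambda>s. f s (tonelli f a x0 h j s)))"

text \<open>Linear growth gives an exponential bound on all approximations, hence a common Lipschitz
  constant, and Arzela-Ascoli yields a uniform limit. Dominated convergence passes to the limit
  under the integral, while the delay costs at most M times its length.\<close>

lemma ivp_on_exists: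
  fixes f :: "real \<Rightarrow> 'a::euclidean_space \<Rightarrow> 'a"
  assumes ab: "a \<le> b" and cont: "continuous_on ({a..b} \<times> UNIV) (\<lambda>(t, x). f t x)" and C: "C > 0"
    and bd: "\<And>t x. t \<in> {a..b} \<Longrightarrow> norm (f t x) \<le> C * (1 + norm x)"
  shows "\<exists>X. ivp_on f a b x0 X"
proof -
  define M where "M = C * ((1 + norm x0) * exp (C * (b - a)))"
  have W: "continuous_on {a..b} (tonelli f a x0 h j) \<and>
      (\<forall>t\<in>{a..b}. 1 + norm (tonelli f a x0 h j t) \<le> (1 + norm x0) * exp (C * (t - a)))" if h: "h \<ge> 0" for h j
  proof (induction j)
    case 0
    have "1 + norm x0 \<le> (1 + norm x0) * exp (C * (t - a))" if "t \<ge> a" for t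
      using mult_left_mono[of 1 "exp (C * (t - a))" "1 + norm x0"] that C by simp
    then show ?case by auto
  next
    case (Suc j)
    let ?W = "tonelli f a x0 h j"
    let ?g = "\<lambda>s. f s (?W s)"
    have g: "continuous_on {a..b} ?g" using Suc by (intro continuous_on_along[OF cont]) auto
    have I: "continuous_on {a..b} (\<lambda>u. integral {a..u} ?g)"
      using g by (intro indefinite_integral_continuous_1 integrable_continuous_real)
    have 1: "continuous_on {a..b} (\<lambda>t. integral {a..max a (t - h)} ?g)"
      by (rule continuous_on_compose2[OF I]) (use h in \<open>auto intro!: continuous_intros\<close>)
    have 2: "1 + norm (tonelli f a x0 h (Suc j) t) \<le> (1 + norm x0) * exp (C * (t - a))" if t: "t \<in> {a..b}" for t
    proof -
      have E: "((\<lambda>s. C * ((1 + norm x0) * exp (C * (s - a)))) has_integral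
          (1 + norm x0) * exp (C * (u - a)) - (1 + norm x0) * exp (C * (a - a))) {a..u}" if "a \<le> u" for u
        using that by (intro fundamental_theorem_of_calculus)
          (auto simp: has_real_derivative_iff_has_vector_derivative[symmetric] intro!: derivative_eq_intros)
      let ?u = "max a (t - h)"
      have u: "a \<le> ?u" "?u \<le> t" "?u \<le> b" using t h by auto
      have "norm (integral {a..?u} ?g) \<le> integral {a..?u} (\<lambda>s. C * ((1 + norm x0) * exp (C * (s - a))))"
      proof (rule Henstock_Kurzweil_Integration.integral_norm_bound_integral)
        show "?g integrable_on {a..?u}"
          using u by (intro integrable_continuous_real continuous_on_subset[OF g]) auto
        show "(\<lambda>s. C * ((1 + norm x0) * exp (C * (s - a)))) integrable_on {a..?u}"
          using E[OF u(1)] by blast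
        fix s assume s: "s \<in> {a..?u}"
        then have s': "s \<in> {a..b}" using u by auto
        have "norm (?g s) \<le> C * (1 + norm (?W s))" by (rule bd[OF s'])
        also have "\<dots> \<le> C * ((1 + norm x0) * exp (C * (s - a)))"
          using Suc s' C by (intro mult_left_mono) auto
        finally show "norm (?g s) \<le> C * ((1 + norm x0) * exp (C * (s - a)))" .
      qed
      also have "\<dots> = (1 + norm x0) * exp (C * (?u - a)) - (1 + norm x0)"
        using integral_unique[OF E[OF u(1)]] by simp
      also have "\<dots> \<le> (1 + norm x0) * exp (C * (t - a)) - (1 + norm x0)"
        using u C by (intro diff_right_mono mult_left_mono) auto
      finally have "norm (integral {a..?u} ?g) \<le> (1 + norm x0) * exp (C * (t - a)) - (1 + norm x0)" .
      then show ?thesis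
        using norm_triangle_ineq[of x0 "integral {a..?u} ?g"] by simp
    qed
    show ?case using 1 2 by (auto intro!: continuous_intros)
  qed
  have fW: "norm (f s (tonelli f a x0 h j s)) \<le> M" if "h \<ge> 0" "s \<in> {a..b}" for h j s
  proof -
    have "norm (f s (tonelli f a x0 h j s)) \<le> C * (1 + norm (tonelli f a x0 h j s))" by (rule bd[OF that(2)])
    also have "\<dots> \<le> C * ((1 + norm x0) * exp (C * (s - a)))"
      using W[OF that(1)] that(2) C by (intro mult_left_mono) auto
    also have "\<dots> \<le> M" unfolding M_def using that C by (intro mult_left_mono) auto
    finally show ?thesis .
  qed
  have M0: "M \<ge> 0" using C by (simp add: M_def)
  have contf: "continuous_on {a..b} (\<lambda>s. f s (tonelli f a x0 h j s))" if "h \<ge> 0" for h j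
    using W[OF that] by (intro continuous_on_along[OF cont]) auto
  \<comment> \<open>An iterate at time t depends on its predecessor only up to t - h, so each
    iteration extends the interval of agreement by h.\<close>
  have stat: "tonelli f a x0 h (Suc j) t = tonelli f a x0 h j t" if "h \<ge> 0" "t \<le> a + j * h" for h j t
    using that(2)
  proof (induction j arbitrary: t)
    case (Suc j)
    have "integral {a..max a (t - h)} (\<lambda>s. f s (tonelli f a x0 h (Suc j) s)) =
        integral {a..max a (t - h)} (\<lambda>s. f s (tonelli f a x0 h j s))"
    proof (rule Henstock_Kurzweil_Integration.integral_cong)
      fix s assume "s \<in> {a..max a (t - h)}"
      then have "s \<le> a + j * h" using Suc.prems that(1) by (auto simp: algebra_simps max_def split: if_splits)
      then show "f s (tonelli f a x0 h (Suc j) s) = f s (tonelli f a x0 h j s)"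
        using Suc.IH by simp
    qed
    then show ?case by (simp only: tonelli.simps(2)[of _ _ _ _ "Suc j"] tonelli.simps(2)[of _ _ _ _ j, symmetric])
      simp
  qed (use that(1) in simp)
  define h where "h = (\<lambda>n::nat. (b - a) / real (Suc n))"
  have h0: "h n \<ge> 0" for n using ab by (simp add: h_def)
  \<comment> \<open>\<open>Suc n\<close> steps of length \<open>h n\<close> reach b exactly, so X n
    satisfies the delayed integral equation on all of [a, b].\<close>
  define X where "X = (\<lambda>n. tonelli f a x0 (h n) (Suc n))"
  have X: "X n t = x0 + integral {a..max a (t - h n)} (\<lambda>s. f s (X n s))" if "t \<in> {a..b}" for n t
  proof -
    have "b = a + real (Suc n) * h n" by (simp add: h_def)
    then have "tonelli f a x0 (h n) (Suc (Suc n)) t = tonelli f a x0 (h n) (Suc n) t"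
      using that by (intro stat[OF h0]) auto
    then show ?thesis by (simp add: X_def)
  qed
  have Xlip: "norm (X n t - X n t') \<le> M * \<bar>t - t'\<bar>" if "t \<in> {a..b}" "t' \<in> {a..b}" for n t t'
  proof -
    have "norm (X n t - X n t') = norm (integral {a..max a (t - h n)} (\<lambda>s. f s (X n s)) -
        integral {a..max a (t' - h n)} (\<lambda>s. f s (X n s)))"
      using X[OF that(1), of n] X[OF that(2), of n] by (metis add_diff_cancel_left)
    also have "\<dots> \<le> M * \<bar>max a (t - h n) - max a (t' - h n)\<bar>"
      using that h0[of n] contf[OF h0, of n "Suc n"] fW[OF h0, of _ n "Suc n"] unfolding X_def
      by (intro indefinite_integral_lipschitz[where b = b]) auto
    also have "\<dots> \<le> M * \<bar>t - t'\<bar>" using M0 by (intro mult_left_mono) auto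
    finally show ?thesis .
  qed
  obtain g k where g: "continuous_on {a..b} g" and k: "strict_mono (k :: nat \<Rightarrow> nat)"
    and lim: "\<And>e. 0 < e \<Longrightarrow> \<exists>N. \<forall>n x. n \<ge> N \<and> x \<in> {a..b} \<longrightarrow> norm (X (k n) x - g x) < e"
  proof (rule Arzela_Ascoli[of "{a..b}" X "(1 + norm x0) * exp (C * (b - a))"])
    show "compact {a..b}" by simp
    show "norm (X n x) \<le> (1 + norm x0) * exp (C * (b - a))" if "x \<in> {a..b}" for n x
    proof -
      have "1 + norm (X n x) \<le> (1 + norm x0) * exp (C * (x - a))"
        using W[OF h0, of n "Suc n"] that unfolding X_def by blast
      also have "\<dots> \<le> (1 + norm x0) * exp (C * (b - a))"
        using that C by (intro mult_left_mono) auto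
      finally show ?thesis by simp
    qed
    fix x e :: real assume "x \<in> {a..b}" "0 < e"
    then show "\<exists>d. 0 < d \<and> (\<forall>n y. y \<in> {a..b} \<and> norm (x - y) < d \<longrightarrow> norm (X n x - X n y) < e)"
    proof (intro exI[of _ "e / (M + 1)"] conjI allI impI)
      fix n y assume y: "y \<in> {a..b} \<and> norm (x - y) < e / (M + 1)"
      have "norm (X n x - X n y) \<le> M * \<bar>x - y\<bar>" using Xlip \<open>x \<in> {a..b}\<close> y by blast
      also have "\<dots> \<le> (M + 1) * \<bar>x - y\<bar>" by (intro mult_right_mono) auto
      also have "\<dots> < e" using y M0 by (simp add: pos_less_divide_eq mult.commute)
      finally show "norm (X n x - X n y) < e" .
    qed (use M0 \<open>0 < e\<close> in auto)
  qed blast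
  have ptw: "(\<lambda>n. X (k n) t) \<longlonglongrightarrow> g t" if "t \<in> {a..b}" for t
    using lim that unfolding LIMSEQ_iff by blast
  have "g t = x0 + integral {a..t} (\<lambda>s. f s (g s))" if t: "t \<in> {a..b}" for t
  proof -
    have "(\<lambda>n. integral {a..t} (\<lambda>s. f s (X (k n) s))) \<longlonglongrightarrow> integral {a..t} (\<lambda>s. f s (g s))"
    proof (rule dominated_convergence(2)[where h = "\<lambda>_. M"])
      show "(\<lambda>s. f s (X (k n) s)) integrable_on {a..t}" for n
        unfolding X_def using t
        by (intro integrable_continuous_real continuous_on_subset[OF contf[OF h0]]) auto
      show "norm (f s (X (k n) s)) \<le> M" if "s \<in> {a..t}" for n s
        unfolding X_def using that t by (intro fW[OF h0]) auto
      fix s assume s: "s \<in> {a..t}"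
      have "continuous_on UNIV ((\<lambda>(t, x). f t x) \<circ> (\<lambda>x. (s, x)))"
        using s t by (intro continuous_on_compose continuous_on_subset[OF cont] continuous_intros) auto
      then have "isCont (\<lambda>x. f s x) (g s)" by (simp add: o_def continuous_on_eq_continuous_at)
      then show "(\<lambda>n. f s (X (k n) s)) \<longlonglongrightarrow> f s (g s)"
        using ptw[of s] s t by (intro isCont_tendsto_compose[where g = "f s"]) auto
    qed (rule integrable_const_ivl)
    moreover have "(\<lambda>n. integral {a..max a (t - h (k n))} (\<lambda>s. f s (X (k n) s)) -
        integral {a..t} (\<lambda>s. f s (X (k n) s))) \<longlonglongrightarrow> 0"
    proof (rule Lim_null_comparison)
      have "(\<lambda>n. M * h n) \<longlonglongrightarrow> 0"
        unfolding h_def using LIMSEQ_Suc[OF lim_const_over_n[of "M * (b - a)"]] by simp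
      from LIMSEQ_subseq_LIMSEQ[OF this k] show "(\<lambda>n. M * h (k n)) \<longlonglongrightarrow> 0" by (simp add: o_def)
      show "\<forall>\<^sub>F n in sequentially. norm (integral {a..max a (t - h (k n))} (\<lambda>s. f s (X (k n) s)) -
        integral {a..t} (\<lambda>s. f s (X (k n) s))) \<le> M * h (k n)"
      proof (intro always_eventually allI)
        fix n
        have "norm (integral {a..max a (t - h (k n))} (\<lambda>s. f s (X (k n) s)) -
            integral {a..t} (\<lambda>s. f s (X (k n) s))) \<le> M * \<bar>max a (t - h (k n)) - t\<bar>"
          using t h0[of "k n"] contf[OF h0, of "k n" "Suc (k n)"] fW[OF h0, of _ "k n" "Suc (k n)"] unfolding X_def
          by (intro indefinite_integral_lipschitz[where b = b]) auto
        also have "\<dots> \<le> M * h (k n)" using M0 t h0[of "k n"] by (intro mult_left_mono) auto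
        finally show "norm (integral {a..max a (t - h (k n))} (\<lambda>s. f s (X (k n) s)) -
            integral {a..t} (\<lambda>s. f s (X (k n) s))) \<le> M * h (k n)" .
      qed
    qed
    ultimately have "(\<lambda>n. integral {a..max a (t - h (k n))} (\<lambda>s. f s (X (k n) s))) \<longlonglongrightarrow> integral {a..t} (\<lambda>s. f s (g s))"
      using tendsto_add by fastforce
    then have "(\<lambda>n. X (k n) t) \<longlonglongrightarrow> x0 + integral {a..t} (\<lambda>s. f s (g s))"
      by (subst X[OF t]) (intro tendsto_intros)
    with ptw[OF t] show ?thesis by (rule LIMSEQ_unique)
  qed
  with g show ?thesis by (auto simp: ivp_on_def)
qed

lemma ivp_on_extend:
  fixes f :: "real \<Rightarrow> 'a::euclidean_space \<Rightarrow> 'a"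
  assumes X: "ivp_on f a b x0 X" and ab: "a \<le> b" "b \<le> b'"
    and cont: "continuous_on ({a..b'} \<times> UNIV) (\<lambda>(t, x). f t x)" and C: "C > 0"
    and bd: "\<And>t x. t \<in> {a..b'} \<Longrightarrow> norm (f t x) \<le> C * (1 + norm x)"
  shows "\<exists>Y. ivp_on f a b' x0 Y \<and> (\<forall>t\<in>{a..b}. Y t = X t)"
proof -
  have "continuous_on ({b..b'} \<times> UNIV) (\<lambda>(t, x). f t x)"
    using ab by (intro continuous_on_subset[OF cont]) auto
  from ivp_on_exists[OF ab(2) this C, of "X b"] obtain Z where Z: "ivp_on f b b' (X b) Z"
    using bd ab by force
  define Y where "Y = (\<lambda>t. if t \<le> b then X t else Z t)"
  have Zb: "Z b = X b" using Z ab by (simp add: ivp_on_def)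
  have eqX: "Y t = X t" if "t \<le> b" for t using that by (simp add: Y_def)
  have eqZ: "Y t = Z t" if "t \<ge> b" for t using that Zb by (auto simp: Y_def)
  have contY: "continuous_on {a..b'} Y"
  proof -
    have "continuous_on ({a..b} \<union> {b..b'}) Y"
    proof (rule continuous_on_closed_Un)
      show "continuous_on {a..b} Y"
        using X by (subst continuous_on_cong[OF refl eqX]) (auto simp: ivp_on_def)
      show "continuous_on {b..b'} Y"
        using Z by (subst continuous_on_cong[OF refl eqZ]) (auto simp: ivp_on_def)
    qed auto
    moreover have "{a..b} \<union> {b..b'} = {a..b'}" using ab by auto
    ultimately show ?thesis by simp
  qed
  have g: "continuous_on {a..b'} (\<lambda>s. f s (Y s))" by (rule continuous_on_along[OF cont contY]) simp
  have "Y t = x0 + integral {a..t} (\<lambda>s. f s (Y s))" if t: "t \<in> {a..b'}" for t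
  proof (cases "t \<le> b")
    case True
    have "Y t = x0 + integral {a..t} (\<lambda>s. f s (X s))"
      using True X t by (simp add: eqX ivp_on_def)
    also have "integral {a..t} (\<lambda>s. f s (X s)) = integral {a..t} (\<lambda>s. f s (Y s))"
      using True by (intro Henstock_Kurzweil_Integration.integral_cong) (simp add: eqX)
    finally show ?thesis .
  next
    case False
    have "Y t = X b + integral {b..t} (\<lambda>s. f s (Z s))"
      using False Z t by (simp add: eqZ ivp_on_def)
    also have "X b = x0 + integral {a..b} (\<lambda>s. f s (X s))" using X ab unfolding ivp_on_def by auto
    also have "integral {a..b} (\<lambda>s. f s (X s)) = integral {a..b} (\<lambda>s. f s (Y s))"
      by (intro Henstock_Kurzweil_Integration.integral_cong) (simp add: eqX)
    also have "integral {b..t} (\<lambda>s. f s (Z s)) = integral {b..t} (\<lambda>s. f s (Y s))"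
      by (intro Henstock_Kurzweil_Integration.integral_cong) (simp add: eqZ)
    also have "x0 + integral {a..b} (\<lambda>s. f s (Y s)) + integral {b..t} (\<lambda>s. f s (Y s)) = x0 + integral {a..t} (\<lambda>s. f s (Y s))"
      using False ab t
      by (subst Henstock_Kurzweil_Integration.integral_combine[symmetric, of a b t]) (auto intro!: integrable_continuous_real continuous_on_subset[OF g])
    finally show ?thesis .
  qed
  with contY eqX show ?thesis unfolding ivp_on_def by auto
qed

text \<open>Solutions need not be unique, so those on [a, b + n] cannot be patched together
  afterwards; dependent choice picks each one as an extension of its predecessor.\<close>

lemma ivp_global_extension:
  fixes f :: "real \<Rightarrow> 'a::euclidean_space \<Rightarrow> 'a"
  assumes X: "ivp_on f a b x0 X" and ab: "a \<le> b"
    and cont: "continuous_on ({a..} \<times> UNIV) (\<lambda>(t, x). f t x)"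
    and bd: "\<And>T. \<exists>C>0. \<forall>t\<in>{a..T}. \<forall>x. norm (f t x) \<le> C * (1 + norm x)"
  obtains Y where "\<And>T. T \<ge> b \<Longrightarrow> ivp_on f a T x0 Y" "\<And>t. t \<in> {a..b} \<Longrightarrow> Y t = X t"
proof -
  have "\<exists>F. \<forall>n. (ivp_on f a (b + real n) x0 (F n) \<and> (\<forall>t\<in>{a..b}. F n t = X t)) \<and>
      (\<forall>t\<in>{a..b + real n}. F (Suc n) t = F n t)"
  proof (rule dependent_nat_choice)
    show "\<exists>x. ivp_on f a (b + real 0) x0 x \<and> (\<forall>t\<in>{a..b}. x t = X t)" using X by auto
    fix x n assume x: "ivp_on f a (b + real n) x0 x \<and> (\<forall>t\<in>{a..b}. x t = X t)"
    obtain C where C: "C > 0" "\<And>t z. t \<in> {a..b + real (Suc n)} \<Longrightarrow> norm (f t z) \<le> C * (1 + norm z)"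
      using bd[of "b + real (Suc n)"] by blast
    have "\<exists>Y. ivp_on f a (b + real (Suc n)) x0 Y \<and> (\<forall>t\<in>{a..b + real n}. Y t = x t)"
      using x ab C by (intro ivp_on_extend[where C = C] continuous_on_subset[OF cont]) auto
    then obtain Y where "ivp_on f a (b + real (Suc n)) x0 Y" "\<forall>t\<in>{a..b + real n}. Y t = x t" by blast
    with x show "\<exists>y. (ivp_on f a (b + real (Suc n)) x0 y \<and> (\<forall>t\<in>{a..b}. y t = X t)) \<and>
        (\<forall>t\<in>{a..b + real n}. y t = x t)"
      by (intro exI[of _ Y]) auto
  qed
  then obtain F where F: "\<And>n. ivp_on f a (b + real n) x0 (F n)" "\<And>n t. t \<in> {a..b} \<Longrightarrow> F n t = X t"
    "\<And>n t. t \<in> {a..b + real n} \<Longrightarrow> F (Suc n) t = F n t" by blast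
  have F_eq: "F m t = F n t" if "t \<in> {a..b + real n}" "n \<le> m" for m n t
    using that(2) by (induction m rule: dec_induct) (use that(1) F(3) in auto)
  define Y where "Y = (\<lambda>t. F (nat \<lceil>t - b\<rceil>) t)"
  have Y: "Y t = F n t" if "t \<in> {a..b + real n}" for t n
  proof -
    have "nat \<lceil>t - b\<rceil> \<le> n" using that by (simp add: nat_le_iff ceiling_le_iff)
    moreover have "t \<le> b + real (nat \<lceil>t - b\<rceil>)" by linarith
    ultimately show ?thesis using F_eq[of t "nat \<lceil>t - b\<rceil>" n] that by (simp add: Y_def)
  qed
  show ?thesis
  proof (rule that[of Y])
    fix T assume "T \<ge> b"
    define n where "n = nat \<lceil>T - b\<rceil>"
    have T: "T \<le> b + real n" unfolding n_def by linarith
    have YF: "Y t = F n t" if "t \<in> {a..T}" for t using Y[of t n] T that by auto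
    have "continuous_on {a..T} (F n)"
      using F(1)[of n] T by (auto simp: ivp_on_def intro: continuous_on_subset)
    then have "continuous_on {a..T} Y" by (subst continuous_on_cong[OF refl YF]) auto
    moreover have "Y t = x0 + integral {a..t} (\<lambda>s. f s (Y s))" if t: "t \<in> {a..T}" for t
    proof -
      have "Y t = x0 + integral {a..t} (\<lambda>s. f s (F n s))"
        using YF[OF t] F(1)[of n] t T by (auto simp: ivp_on_def)
      also have "integral {a..t} (\<lambda>s. f s (F n s)) = integral {a..t} (\<lambda>s. f s (Y s))"
        using t by (intro Henstock_Kurzweil_Integration.integral_cong) (simp add: YF)
      finally show ?thesis .
    qed
    ultimately show "ivp_on f a T x0 Y" by (simp add: ivp_on_def)
  next
    fix t assume "t \<in> {a..b}"
    then show "Y t = X t" using Y[of t 0] F(2)[of t 0] by simp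
  qed
qed

lemma ivp_on_derivative:
  assumes "ivp_on f a b x0 X" "continuous_on ({a..b} \<times> UNIV) (\<lambda>(t, x). f t x)" "t \<in> {a..b}"
  shows "(X has_vector_derivative f t (X t)) (at t within {a..b})"
proof -
  have X: "continuous_on {a..b} X" using assms(1) by (simp add: ivp_on_def)
  have "((\<lambda>t. x0 + integral {a..t} (\<lambda>s. f s (X s))) has_vector_derivative 0 + f t (X t)) (at t within {a..b})"
    by (intro has_vector_derivative_add has_vector_derivative_const
        integral_has_vector_derivative[OF continuous_on_along[OF assms(2) X]] assms(3)) simp
  then have "((\<lambda>t. x0 + integral {a..t} (\<lambda>s. f s (X s))) has_vector_derivative f t (X t)) (at t within {a..b})"
    by simp
  then show ?thesis
    by (rule has_vector_derivative_transform[OF assms(3), rotated])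
      (use assms(1) in \<open>simp add: ivp_on_def\<close>)
qed

section \<open>Existence of dead-core profiles\<close>

lemma increasing_of_deriv_interior:
  fixes f f' :: "real \<Rightarrow> real"
  assumes "a \<le> b" "continuous_on {a..b} f"
    "\<And>x. a < x \<Longrightarrow> x < b \<Longrightarrow> (f has_real_derivative f' x) (at x)"
    "\<And>x. a < x \<Longrightarrow> x < b \<Longrightarrow> 0 \<le> f' x"
  shows "f a \<le> f b"
proof (cases "a = b")
  case False
  then show ?thesis
    using assms by (intro DERIV_nonneg_imp_increasing_open[of a b f]) auto
qed simp

lemma has_real_derivative_glue_zero:
  fixes f :: "real \<Rightarrow> real"
  assumes "(f has_real_derivative 0) (at x within {x..b})" "x < b" "f x = 0"
  shows "((\<lambda>t. if t \<le> x then 0 else f t) has_real_derivative 0) (at x)"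
proof -
  let ?g = "\<lambda>t. if t \<le> x then 0 else f t"
  have "((\<lambda>t. (?g t - ?g x) / (t - x)) \<longlongrightarrow> 0) (at_left x)"
    by (rule Lim_transform_eventually[OF tendsto_const])
      (auto simp: eventually_at_filter)
  moreover have "((\<lambda>t. (?g t - ?g x) / (t - x)) \<longlongrightarrow> 0) (at_right x)"
  proof (rule Lim_transform_eventually)
    have "((\<lambda>t. (f t - f x) / (t - x)) \<longlongrightarrow> 0) (at x within {x..b})"
      using assms(1) by (simp add: has_field_derivative_iff)
    moreover have "at x within {x..b} = at_right x"
      using assms(2) by (rule at_within_Icc_at_right)
    ultimately show "((\<lambda>t. (f t - f x) / (t - x)) \<longlongrightarrow> 0) (at_right x)" by simp
    show "\<forall>\<^sub>F t in at_right x. (f t - f x) / (t - x) = (?g t - ?g x) / (t - x)"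
      using assms(3) by (auto simp: eventually_at_filter)
  qed
  ultimately have "((\<lambda>t. (?g t - ?g x) / (t - x)) \<longlongrightarrow> 0) (at x)"
    by (simp add: filterlim_split_at)
  then show ?thesis by (simp add: has_field_derivative_iff)
qed

context radial_profile begin

lemma continuous_on_source:
  assumes "continuous_on S g" "continuous_on S h" "\<And>x. x \<in> S \<Longrightarrow> 0 < g x"
  shows "continuous_on S (\<lambda>x. source (g x) (h x))"
proof -
  have "continuous_on S (\<lambda>x. max (h x) 0 powr q)"
    using assms(2) q_pos by (intro continuous_on_powr' continuous_intros) auto
  moreover have "continuous_on S (\<lambda>x. g x powr b)" for b
    using assms(1,3) by (intro continuous_intros) force+
  ultimately show ?thesis
    unfolding source_def using assms(2)
    by (intro continuous_on_diff continuous_on_mult continuous_on_const)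
qed

text \<open>The unknowns are w and the flux s^k w', so the drift k/s disappears. The argument h
  makes room for a truncation of w inside the source.\<close>

definition system :: "(real \<Rightarrow> real \<Rightarrow> real) \<Rightarrow> real \<Rightarrow> real \<times> real \<Rightarrow> real \<times> real" where
  "system h s x = (s powr (- k) * snd x, s powr k * source s (h s (fst x)))"

lemma system_continuous:
  assumes "continuous_on ({a..} \<times> UNIV) (\<lambda>(s, y). h s y)" "a > 0"
  shows "continuous_on ({a..} \<times> UNIV) (\<lambda>(s, x). system h s x)"
proof -
  have "continuous_on ({a..} \<times> (UNIV :: (real \<times> real) set)) ((\<lambda>(s, y). h s y) \<circ> (\<lambda>z. (fst z, fst (snd z))))"
    by (intro continuous_on_compose continuous_on_subset[OF assms(1)] continuous_intros) auto
  then have h: "continuous_on ({a..} \<times> UNIV) (\<lambda>z::real \<times> real \<times> real. h (fst z) (fst (snd z)))"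
    by (simp add: o_def)
  have pw: "continuous_on ({a..} \<times> (UNIV :: (real \<times> real) set)) (\<lambda>z. fst z powr b)" for b
    using assms(2) by (intro continuous_intros) auto
  have src: "continuous_on ({a..} \<times> (UNIV :: (real \<times> real) set)) (\<lambda>z. source (fst z) (h (fst z) (fst (snd z))))"
    using assms(2) by (intro continuous_on_source h continuous_intros) auto
  have "continuous_on ({a..} \<times> (UNIV :: (real \<times> real) set)) (\<lambda>z. (fst z powr (- k) * snd (snd z),
      fst z powr k * source (fst z) (h (fst z) (fst (snd z)))))"
    by (intro continuous_on_Pair continuous_on_mult pw src continuous_intros)
  then show ?thesis by (simp add: system_def case_prod_beta)
qed

text \<open>The nonlinearity is sublinear: y^q <= 1 + y for y >= 0 as q < 1. On a bounded interval
  away from 0 the powers of s are bounded.\<close>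

lemma system_growth:
  assumes "a > 0" "\<And>s y. s \<ge> a \<Longrightarrow> \<bar>h s y\<bar> \<le> H + \<bar>y\<bar>" "H \<ge> 0"
  shows "\<exists>C>0. \<forall>s\<in>{a..T}. \<forall>x. norm (system h s x) \<le> C * (1 + norm x)"
proof -
  have "\<exists>C>0. \<forall>s\<in>{a..T}. s powr b \<le> C" for b
  proof -
    have "compact ((\<lambda>s. s powr b) ` {a..T})"
      using assms(1) by (intro compact_continuous_image continuous_intros) auto
    then have "bounded ((\<lambda>s. s powr b) ` {a..T})" by (rule compact_imp_bounded)
    then obtain C where C: "C > 0" "\<And>x. x \<in> (\<lambda>s. s powr b) ` {a..T} \<Longrightarrow> norm x \<le> C"
      unfolding bounded_pos by blast
    then have "\<forall>s\<in>{a..T}. s powr b \<le> C" by force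
    with C(1) show ?thesis by blast
  qed
  then obtain C1 C2 C3 C4 where C: "C1 > 0" "C2 > 0" "C3 > 0" "C4 > 0"
    and B: "\<And>s. s \<in> {a..T} \<Longrightarrow> s powr (- k) \<le> C1" "\<And>s. s \<in> {a..T} \<Longrightarrow> s powr k \<le> C2"
      "\<And>s. s \<in> {a..T} \<Longrightarrow> s powr \<tau>1 \<le> C3" "\<And>s. s \<in> {a..T} \<Longrightarrow> s powr \<tau>2 \<le> C4"
    by metis
  define C0 where "C0 = C1 + C2 * (\<gamma> * C3 + \<beta> * C4) * (1 + H)"
  have "norm (system h s x) \<le> C0 * (1 + norm x)" if s: "s \<in> {a..T}" for s x
  proof -
    let ?y = "h s (fst x)"
    have y: "\<bar>?y\<bar> \<le> H + norm x" using assms(2)[of s "fst x"] norm_fst_le[of "fst x" "snd x"] s by simp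
    have "max ?y 0 powr q \<le> 1 + \<bar>?y\<bar>"
    proof -
      have "max ?y 0 powr q \<le> (1 + \<bar>?y\<bar>) powr q" using q_pos by (intro powr_mono2) auto
      also have "\<dots> \<le> (1 + \<bar>?y\<bar>) powr 1" using q_less by (intro powr_mono) auto
      finally show ?thesis by simp
    qed
    then have "\<gamma> * s powr \<tau>1 * max ?y 0 powr q \<le> \<gamma> * C3 * (1 + \<bar>?y\<bar>)"
      using B(3)[OF s] gamma_pos C by (intro mult_mono) auto
    moreover have "\<beta> * s powr \<tau>2 * \<bar>?y\<bar> \<le> \<beta> * C4 * (1 + \<bar>?y\<bar>)"
      using B(4)[OF s] beta_pos C by (intro mult_mono) auto
    moreover have "\<bar>source s ?y\<bar> \<le> \<gamma> * s powr \<tau>1 * max ?y 0 powr q + \<beta> * s powr \<tau>2 * \<bar>?y\<bar>"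
      unfolding source_def using gamma_pos beta_pos
      by (intro order_trans[OF abs_triangle_ineq4]) (auto simp: abs_mult)
    ultimately have "\<bar>source s ?y\<bar> \<le> (\<gamma> * C3 + \<beta> * C4) * (1 + \<bar>?y\<bar>)" by (simp add: distrib_right)
    also have "\<dots> \<le> (\<gamma> * C3 + \<beta> * C4) * ((1 + H) * (1 + norm x))"
    proof (rule mult_left_mono)
      show "1 + \<bar>?y\<bar> \<le> (1 + H) * (1 + norm x)"
      proof -
        have "0 \<le> H * norm x" using assms(3) by simp
        moreover have "(1 + H) * (1 + norm x) = 1 + H + norm x + H * norm x" by algebra
        ultimately show ?thesis using y by linarith
      qed
    qed (use C gamma_pos beta_pos in auto)
    finally have "s powr k * \<bar>source s ?y\<bar> \<le> C2 * ((\<gamma> * C3 + \<beta> * C4) * ((1 + H) * (1 + norm x)))"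
      using B(2)[OF s] C by (intro mult_mono) auto
    moreover have "s powr (- k) * \<bar>snd x\<bar> \<le> C1 * (1 + norm x)"
      using B(1)[OF s] C norm_snd_le[of "snd x" "fst x"] by (intro mult_mono) auto
    moreover have "norm (system h s x) \<le> s powr (- k) * \<bar>snd x\<bar> + s powr k * \<bar>source s ?y\<bar>"
      unfolding system_def by (intro order_trans[OF norm_Pair_le]) (simp add: abs_mult)
    ultimately show ?thesis by (simp add: C0_def algebra_simps)
  qed
  moreover have "C0 > 0" using C gamma_pos beta_pos assms(3) by (simp add: C0_def add_pos_nonneg)
  ultimately show ?thesis by blast
qed

lemma ivp_system_derivatives:
  assumes X: "ivp_on (system h) a b x0 X" and h: "continuous_on ({a..} \<times> UNIV) (\<lambda>(s, y). h s y)"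
    and a: "a > 0" and t: "t \<in> {a..b}"
  shows "((\<lambda>t. fst (X t)) has_real_derivative t powr (- k) * snd (X t)) (at t within {a..b})"
    "((\<lambda>t. snd (X t)) has_real_derivative t powr k * source t (h t (fst (X t)))) (at t within {a..b})"
proof -
  have "continuous_on ({a..b} \<times> UNIV) (\<lambda>(s, x). system h s x)"
    by (rule continuous_on_subset[OF system_continuous[OF h a]]) auto
  from ivp_on_derivative[OF X this t]
  have d: "(X has_vector_derivative system h t (X t)) (at t within {a..b})" .
  show "((\<lambda>t. fst (X t)) has_real_derivative t powr (- k) * snd (X t)) (at t within {a..b})"
    using bounded_linear.has_vector_derivative[OF bounded_linear_fst d]
    by (simp add: system_def has_real_derivative_iff_has_vector_derivative)
  show "((\<lambda>t. snd (X t)) has_real_derivative t powr k * source t (h t (fst (X t)))) (at t within {a..b})"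
    using bounded_linear.has_vector_derivative[OF bounded_linear_snd d]
    by (simp add: system_def has_real_derivative_iff_has_vector_derivative)
qed

text \<open>The right-hand side is not Lipschitz at \<open>0\<close>; below the barrier \<open>C (s - s0)\<^bsup>2 / (1 - q)\<^esup>\<close> it is replaced
  by its value on the barrier, so that every solution stays above the barrier.\<close>

lemma detached_local_solution:
  assumes s0: "s0 > 0"
  obtains \<delta> X where "\<delta> > 0" "ivp_on (system (\<lambda>s y. y)) s0 (s0 + \<delta>) (0, 0) X"
    "\<And>s. s0 < s \<Longrightarrow> s \<le> s0 + \<delta> \<Longrightarrow> 0 < fst (X s)"
proof -
  define m1 where "m1 = min (s0 powr \<tau>1) ((s0 + 1) powr \<tau>1)"
  define S1 where "S1 = max (s0 powr \<tau>1) ((s0 + 1) powr \<tau>1)"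
  define S2 where "S2 = max (s0 powr \<tau>2) ((s0 + 1) powr \<tau>2)"
  have pos: "m1 > 0" "S1 > 0" "S2 > 0" using s0 by (simp_all add: m1_def S1_def S2_def less_max_iff_disj)
  have pw: "min (s0 powr b) ((s0 + 1) powr b) \<le> s powr b \<and> s powr b \<le> max (s0 powr b) ((s0 + 1) powr b)"
    if "s \<in> {s0..s0 + 1}" for s b
  proof (cases "b \<ge> 0")
    case True
    then have "s0 powr b \<le> s powr b" "s powr b \<le> (s0 + 1) powr b"
      using that s0 by (auto intro!: powr_mono2)
    then show ?thesis by auto
  next
    case False
    then have "s powr b \<le> s0 powr b" "(s0 + 1) powr b \<le> s powr b"
      using that s0 by (auto intro!: powr_mono2')
    then show ?thesis by auto
  qed
  \<comment> \<open>Below height \<eta> the absorbing term \<beta> s^\<tau>2 y is at most half of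
    the term in y^q, so the source is at least G y^q.\<close>
  define \<eta> where "\<eta> = (\<gamma> * m1 / (2 * \<beta> * S2)) powr (1 / (1 - q))"
  have eta: "\<eta> > 0" using gamma_pos beta_pos pos by (simp add: \<eta>_def)
  have eta_q: "\<eta> powr (1 - q) = \<gamma> * m1 / (2 * \<beta> * S2)"
    using gamma_pos beta_pos pos q_less by (simp add: \<eta>_def powr_powr)
  define G where "G = \<gamma> * m1 / 2"
  have G: "G > 0" using gamma_pos pos by (simp add: G_def)
  have src_low: "G * y powr q \<le> source s y" if s: "s \<in> {s0..s0 + 1}" and y: "0 \<le> y" "y \<le> \<eta>" for s y
  proof -
    have "y powr (1 - q) \<le> \<eta> powr (1 - q)" using y q_less by (intro powr_mono2) auto
    then have "y powr (1 - q) * (\<beta> * S2) \<le> G"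
      unfolding eta_q G_def using beta_pos pos by (simp add: field_simps)
    then have "y powr q * (y powr (1 - q) * (\<beta> * S2)) \<le> y powr q * G" by (intro mult_left_mono) auto
    moreover have "y powr q * y powr (1 - q) = y" using y by (simp flip: powr_add)
    ultimately have "\<beta> * S2 * y \<le> G * y powr q" by (simp add: mult_ac)
    moreover have "\<beta> * s powr \<tau>2 * y \<le> \<beta> * S2 * y"
      using pw[OF s, of \<tau>2] beta_pos y by (intro mult_right_mono mult_left_mono) (auto simp: S2_def)
    moreover have "\<gamma> * m1 * y powr q \<le> \<gamma> * s powr \<tau>1 * y powr q"
      using pw[OF s, of \<tau>1] gamma_pos by (intro mult_right_mono mult_left_mono) (auto simp: m1_def)
    ultimately show ?thesis using y by (simp add: source_def G_def)
  qed
  have src_up: "source s y \<le> \<gamma> * S1 * \<eta> powr q" if s: "s \<in> {s0..s0 + 1}" and y: "0 \<le> y" "y \<le> \<eta>" for s y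
  proof -
    have "s powr \<tau>1 \<le> S1" using pw[OF s, of \<tau>1] by (simp add: S1_def)
    then have "\<gamma> * s powr \<tau>1 * y powr q \<le> \<gamma> * S1 * \<eta> powr q"
      using pos(2) gamma_pos y q_pos by (intro mult_mono powr_mono2) auto
    moreover have "0 \<le> \<beta> * s powr \<tau>2 * y" using beta_pos y by auto
    ultimately show ?thesis using y by (simp add: source_def)
  qed
  \<comment> \<open>The homogeneity exponent of y'' = y^q: it satisfies P q + 2 = P.\<close>
  define P where "P = 2 / (1 - q)"
  have P: "P > 1" "P * q + 1 = P - 1" using q_pos q_less by (auto simp: P_def field_simps)
  have Pq: "P * q > 0" using P q_pos by simp
  \<comment> \<open>Integrating G b^q twice from s0, with s^k and s^(-k) replaced by their lower
    bounds on [s0, s0 + 1], returns the barrier b itself for exactly this C.\<close>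
  define C where "C = (s0 powr k * (s0 + 1) powr (- k) * G / (P * (P - 1))) powr (1 / (1 - q))"
  have C: "C > 0" using s0 G P by (simp add: C_def)
  have C_q: "C powr (1 - q) = s0 powr k * (s0 + 1) powr (- k) * G / (P * (P - 1))"
    using s0 G P q_less by (simp add: C_def powr_powr)
  define b where "b = (\<lambda>s. C * max (s - s0) 0 powr P)"
  define h where "h = (\<lambda>s y. min \<eta> (max y (b s)))"
  have cont_b: "continuous_on S b" for S
    unfolding b_def using P by (intro continuous_intros continuous_on_powr') auto
  have cont_h: "continuous_on ({s0..} \<times> UNIV) (\<lambda>(s, y). h s y)"
  proof -
    have "continuous_on ({s0..} \<times> (UNIV::real set)) (\<lambda>z. b (fst z))"
      by (rule continuous_on_compose2[OF cont_b[of UNIV]]) (auto intro: continuous_intros)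
    then have "continuous_on ({s0..} \<times> UNIV) (\<lambda>z. min \<eta> (max (snd z) (b (fst z))))"
      by (intro continuous_intros)
    then show ?thesis by (simp add: h_def case_prod_beta)
  qed
  have b0: "b s \<ge> 0" for s using C by (simp add: b_def)
  have h_range: "0 \<le> h s y" "h s y \<le> \<eta>" for s y
    using eta b0[of s] by (auto simp: h_def)
  define Z where "Z = (s0 + 1) powr k * (\<gamma> * S1 * \<eta> powr q)"
  have Z: "Z > 0" using s0 gamma_pos pos eta by (simp add: Z_def)
  \<comment> \<open>Z bounds the flux, so the second bound on \<delta> keeps w below \<eta>; the
    third does the same for the barrier.\<close>
  define \<delta> where "\<delta> = min 1 (min (\<eta> * s0 powr k / Z) (\<eta> / C))"
  have \<delta>: "0 < \<delta>" "\<delta> \<le> 1" "\<delta> \<le> \<eta> * s0 powr k / Z" "\<delta> \<le> \<eta> / C"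
    using eta s0 Z C by (auto simp: \<delta>_def)
  obtain K where K: "K > 0" "\<And>s x. s \<in> {s0..s0 + \<delta>} \<Longrightarrow> norm (system h s x) \<le> K * (1 + norm x)"
    using system_growth[of s0 h \<eta> "s0 + \<delta>"] s0 eta h_range by (metis abs_of_nonneg abs_ge_zero add_increasing2 less_imp_le)
  have cs: "continuous_on ({s0..s0 + \<delta>} \<times> UNIV) (\<lambda>(s, x). system h s x)"
    by (rule continuous_on_subset[OF system_continuous[OF cont_h s0]]) auto
  have "\<exists>X. ivp_on (system h) s0 (s0 + \<delta>) (0, 0) X"
    by (rule ivp_on_exists[OF _ cs K]) (use \<delta> in auto)
  then obtain X where X: "ivp_on (system h) s0 (s0 + \<delta>) (0, 0) X" by blast
  define w where "w = (\<lambda>t. fst (X t))"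
  define z where "z = (\<lambda>t. snd (X t))"
  have cont: "continuous_on {s0..s} w" "continuous_on {s0..s} z" if "s \<le> s0 + \<delta>" for s
    using X that unfolding w_def z_def ivp_on_def
    by (auto intro!: continuous_intros elim!: continuous_on_subset)
  have init: "w s0 = 0" "z s0 = 0" using X \<delta> by (auto simp: ivp_on_def w_def z_def)
  have dw: "(w has_real_derivative t powr (- k) * z t) (at t)"
    and dz: "(z has_real_derivative t powr k * source t (h t (w t))) (at t)" if "s0 < t" "t < s0 + \<delta>" for t
    using ivp_system_derivatives[OF X cont_h s0, of t] that
    by (auto simp: w_def z_def at_within_Icc_at)
  have bt: "b t \<le> \<eta>" if "t \<in> {s0..s0 + \<delta>}" for t
  proof -
    have "max (t - s0) 0 powr P \<le> \<delta> powr P" using that P by (intro powr_mono2) auto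
    also have "\<dots> \<le> \<delta> powr 1" using \<delta> P by (intro powr_mono') auto
    finally have "b t \<le> C * \<delta>" using C \<delta> by (simp add: b_def)
    also have "\<dots> \<le> \<eta>" using \<delta>(4) C by (simp add: pos_le_divide_eq mult.commute)
    finally show ?thesis .
  qed
  have pwd: "continuous_on {s0..s} (\<lambda>t. (t - s0) powr r)" if "r > 0" for r s
    using that by (intro continuous_on_powr' continuous_intros) auto
  have dpw: "((\<lambda>t. (t - s0) powr r) has_real_derivative r * (t - s0) powr (r - 1)) (at t)" if "t > s0" for t r
  proof -
    have "((\<lambda>t. t - s0) has_real_derivative 1) (at t)" by (auto intro!: derivative_eq_intros)
    from DERIV_fun_powr[OF this, of r] that show ?thesis by simp
  qed
  define K1 where "K1 = s0 powr k * G * C powr q / (P - 1)"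
  have K1: "K1 * (P * q + 1) = s0 powr k * G * C powr q"
    unfolding K1_def P(2) using P(1) by simp
  have z_low: "K1 * (s - s0) powr (P * q + 1) \<le> z s" if s: "s \<in> {s0..s0 + \<delta>}" for s
  proof -
    have "z s0 - K1 * (s0 - s0) powr (P * q + 1) \<le> z s - K1 * (s - s0) powr (P * q + 1)"
    proof (rule increasing_of_deriv_interior[where f = "\<lambda>s. z s - K1 * (s - s0) powr (P * q + 1)"])
      show "continuous_on {s0..s} (\<lambda>s. z s - K1 * (s - s0) powr (P * q + 1))"
        using s Pq by (intro continuous_intros cont pwd) auto
      fix t assume t: "s0 < t" "t < s"
      show "((\<lambda>s. z s - K1 * (s - s0) powr (P * q + 1)) has_real_derivative
          t powr k * source t (h t (w t)) - K1 * ((P * q + 1) * (t - s0) powr (P * q + 1 - 1))) (at t)"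
        using s t by (intro DERIV_diff DERIV_cmult dz dpw) auto
      have "s0 powr k * (G * b t powr q) \<le> t powr k * source t (h t (w t))"
      proof (rule mult_mono)
        show "s0 powr k \<le> t powr k" using t s0 k_pos by (intro powr_mono2) auto
        have "G * b t powr q \<le> G * h t (w t) powr q"
          using bt[of t] b0[of t] G t s q_pos by (intro mult_left_mono powr_mono2) (auto simp: h_def)
        also have "\<dots> \<le> source t (h t (w t))" using t s \<delta> h_range by (intro src_low) auto
        finally show "G * b t powr q \<le> source t (h t (w t))" .
      qed (use G in auto)
      moreover have "b t powr q = C powr q * (t - s0) powr (P * q)"
        using t C by (simp add: b_def powr_mult powr_powr)
      ultimately show "0 \<le> t powr k * source t (h t (w t)) - K1 * ((P * q + 1) * (t - s0) powr (P * q + 1 - 1))"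
        unfolding mult.assoc[symmetric] K1 by (simp add: mult_ac)
    qed (use s in auto)
    then show ?thesis using init by simp
  qed
  have w_low: "b s \<le> w s" if s: "s \<in> {s0..s0 + \<delta>}" for s
  proof -
    have CC: "C * P = (s0 + 1) powr (- k) * K1"
    proof -
      have "C = C powr (1 - q) * C powr q" using C by (simp flip: powr_add)
      also have "\<dots> = s0 powr k * (s0 + 1) powr (- k) * G / (P * (P - 1)) * C powr q" unfolding C_q ..
      finally have "C * P = s0 powr k * (s0 + 1) powr (- k) * G / (P * (P - 1)) * C powr q * P" by simp
      then show ?thesis using P by (simp add: K1_def)
    qed
    have "w s0 - C * (s0 - s0) powr P \<le> w s - C * (s - s0) powr P"
    proof (rule increasing_of_deriv_interior[where f = "\<lambda>s. w s - C * (s - s0) powr P"])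
      show "continuous_on {s0..s} (\<lambda>s. w s - C * (s - s0) powr P)"
        using s P by (intro continuous_intros cont pwd) auto
      fix t assume t: "s0 < t" "t < s"
      show "((\<lambda>s. w s - C * (s - s0) powr P) has_real_derivative
          t powr (- k) * z t - C * (P * (t - s0) powr (P - 1))) (at t)"
        using s t by (intro DERIV_diff DERIV_cmult dw dpw) auto
      have "(s0 + 1) powr (- k) * (K1 * (t - s0) powr (P * q + 1)) \<le> t powr (- k) * z t"
      proof (rule mult_mono)
        show "(s0 + 1) powr (- k) \<le> t powr (- k)"
          using t s \<delta> s0 k_pos by (intro powr_mono2') auto
        show "K1 * (t - s0) powr (P * q + 1) \<le> z t" using z_low[of t] t s by auto
        show "0 \<le> K1 * (t - s0) powr (P * q + 1)" using P G by (simp add: K1_def)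
      qed simp
      then show "0 \<le> t powr (- k) * z t - C * (P * (t - s0) powr (P - 1))"
        unfolding mult.assoc[symmetric] CC P(2) by simp
    qed (use s in auto)
    then show ?thesis using init s by (simp add: b_def max_absorb1)
  qed
  have z_up: "z s \<le> Z" if s: "s \<in> {s0..s0 + \<delta>}" for s
  proof -
    have "Z * (s0 - s0) - z s0 \<le> Z * (s - s0) - z s"
    proof (rule increasing_of_deriv_interior[where f = "\<lambda>s. Z * (s - s0) - z s"])
      show "continuous_on {s0..s} (\<lambda>s. Z * (s - s0) - z s)"
        using s by (intro continuous_intros cont) auto
      fix t assume t: "s0 < t" "t < s"
      show "((\<lambda>s. Z * (s - s0) - z s) has_real_derivative Z * (1 - 0) - t powr k * source t (h t (w t))) (at t)"
        using s t by (intro DERIV_diff DERIV_cmult dz DERIV_ident DERIV_const) auto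
      have "source t (h t (w t)) \<ge> 0"
        using src_low[of t "h t (w t)"] h_range G t s \<delta> by (smt (verit) atLeastAtMost_iff mult_nonneg_nonneg powr_ge_zero)
      then have "t powr k * source t (h t (w t)) \<le> Z"
        unfolding Z_def using t s \<delta> s0 k_pos h_range by (intro mult_mono powr_mono2 src_up) auto
      then show "0 \<le> Z * (1 - 0) - t powr k * source t (h t (w t))" by simp
    qed (use s in auto)
    then have "z s \<le> Z * (s - s0)" using init by simp
    also have "\<dots> \<le> Z * 1" using s \<delta> Z by (intro mult_left_mono) auto
    finally show ?thesis by simp
  qed
  have w_up: "w s \<le> \<eta>" if s: "s \<in> {s0..s0 + \<delta>}" for s
  proof -
    have "s0 powr (- k) * Z * (s0 - s0) - w s0 \<le> s0 powr (- k) * Z * (s - s0) - w s"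
    proof (rule increasing_of_deriv_interior[where f = "\<lambda>s. s0 powr (- k) * Z * (s - s0) - w s"])
      show "continuous_on {s0..s} (\<lambda>s. s0 powr (- k) * Z * (s - s0) - w s)"
        using s by (intro continuous_intros cont) auto
      fix t assume t: "s0 < t" "t < s"
      show "((\<lambda>s. s0 powr (- k) * Z * (s - s0) - w s) has_real_derivative
          s0 powr (- k) * Z * (1 - 0) - t powr (- k) * z t) (at t)"
        using s t by (intro DERIV_diff DERIV_cmult dw DERIV_ident DERIV_const) auto
      have "t powr (- k) * z t \<le> t powr (- k) * Z" using z_up[of t] t s by (intro mult_left_mono) auto
      also have "\<dots> \<le> s0 powr (- k) * Z"
        using t s0 k_pos Z by (intro mult_right_mono powr_mono2') auto
      finally show "0 \<le> s0 powr (- k) * Z * (1 - 0) - t powr (- k) * z t" by simp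
    qed (use s in auto)
    then have "w s \<le> s0 powr (- k) * Z * (s - s0)" using init by simp
    also have "\<dots> \<le> s0 powr (- k) * Z * \<delta>" using s Z by (intro mult_left_mono) auto
    also have "\<dots> \<le> s0 powr (- k) * Z * (\<eta> * s0 powr k / Z)" using \<delta>(3) Z by (intro mult_left_mono) auto
    also have "\<dots> = \<eta>" using Z s0 by (simp add: powr_minus field_simps)
    finally show ?thesis .
  qed
  \<comment> \<open>Since b <= w <= \<eta>, both truncations in h are inactive and X solves the
    original system.\<close>
  have hw: "h s (w s) = w s" if "s \<in> {s0..s0 + \<delta>}" for s
    using w_low[OF that] w_up[OF that] by (simp add: h_def)
  have "ivp_on (system (\<lambda>s y. y)) s0 (s0 + \<delta>) (0, 0) X"
    unfolding ivp_on_def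
  proof (intro conjI ballI)
    show "continuous_on {s0..s0 + \<delta>} X" using X by (simp add: ivp_on_def)
    fix t assume t: "t \<in> {s0..s0 + \<delta>}"
    have "integral {s0..t} (\<lambda>s. system h s (X s)) = integral {s0..t} (\<lambda>s. system (\<lambda>s y. y) s (X s))"
      by (intro Henstock_Kurzweil_Integration.integral_cong) (use t hw in \<open>auto simp: system_def w_def\<close>)
    then show "X t = (0, 0) + integral {s0..t} (\<lambda>s. system (\<lambda>s y. y) s (X s))"
      using X t by (simp add: ivp_on_def)
  qed
  moreover have "0 < fst (X s)" if "s0 < s" "s \<le> s0 + \<delta>" for s
  proof -
    have "0 < b s" using that C by (simp add: b_def)
    also have "\<dots> \<le> w s" using w_low that by auto
    finally show ?thesis by (simp add: w_def)
  qed
  ultimately show ?thesis using that \<delta>(1) by blast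
qed

text \<open>Linear growth continues the local solution to all larger s. The extension by 0 to the
  left fits in both components, because w and p vanish at s0 and so does the source at the value
  0.\<close>

lemma detached_global_solution:
  assumes s0: "s0 > 0"
  obtains \<delta> w p where "\<delta> > 0" "\<And>s. s > 0 \<Longrightarrow> solves_at w p s" "\<And>s. s \<le> s0 \<Longrightarrow> w s = 0 \<and> p s = 0"
    "\<And>s. s0 < s \<Longrightarrow> s \<le> s0 + \<delta> \<Longrightarrow> 0 < w s"
proof -
  obtain \<delta> X where \<delta>: "\<delta> > 0" and X: "ivp_on (system (\<lambda>s y. y)) s0 (s0 + \<delta>) (0, 0) X"
    and posX: "\<And>s. s0 < s \<Longrightarrow> s \<le> s0 + \<delta> \<Longrightarrow> 0 < fst (X s)"
    using detached_local_solution[OF s0] by blast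
  have ch: "continuous_on ({s0..} \<times> UNIV) (\<lambda>(s, y). (\<lambda>(s::real) (y::real). y) s y)"
    by (simp add: case_prod_beta continuous_on_snd)
  obtain Y where Y: "\<And>T. T \<ge> s0 + \<delta> \<Longrightarrow> ivp_on (system (\<lambda>s y. y)) s0 T (0, 0) Y"
    and YX: "\<And>t. t \<in> {s0..s0 + \<delta>} \<Longrightarrow> Y t = X t"
    using ivp_global_extension[OF X _ system_continuous[OF ch s0]] system_growth[OF s0, of "\<lambda>s y. y" 0] \<delta>
    by (metis add_increasing2 add_0 less_imp_le order_refl)
  define w0 where "w0 = (\<lambda>t. fst (Y t))"
  define p0 where "p0 = (\<lambda>t. t powr (- k) * snd (Y t))"
  have Y0: "Y s0 = (0, 0)" using Y[of "s0 + \<delta>"] \<delta> by (auto simp: ivp_on_def zero_prod_def)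
  have d: "(w0 has_real_derivative p0 t) (at t within {s0..T})"
    "(p0 has_real_derivative source t (w0 t) - k / t * p0 t) (at t within {s0..T})"
    if t: "t \<ge> s0" "t \<le> T" "T \<ge> s0 + \<delta>" for t T
  proof -
    have t0: "t > 0" "t \<in> {s0..T}" using t s0 by auto
    note D = ivp_system_derivatives[OF Y[OF t(3)] ch s0 t0(2)]
    show "(w0 has_real_derivative p0 t) (at t within {s0..T})" using D(1) by (simp add: w0_def p0_def)
    have "((\<lambda>t. t powr (- k)) has_real_derivative - k * t powr (- k - 1)) (at t within {s0..T})"
      using has_real_derivative_powr[OF t0(1), of "- k"] by (rule has_field_derivative_at_within)
    from DERIV_mult[OF this D(2)]
    show "(p0 has_real_derivative source t (w0 t) - k / t * p0 t) (at t within {s0..T})"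
      unfolding p0_def w0_def
      by (rule DERIV_cong) (use t0 in \<open>simp add: powr_minus powr_diff field_simps\<close>)
  qed
  define w where "w = (\<lambda>t. if t \<le> s0 then 0 else w0 t)"
  define p where "p = (\<lambda>t. if t \<le> s0 then 0 else p0 t)"
  have src0: "source s 0 = 0" for s by (simp add: source_def)
  have "solves_at w p s" if s: "s > 0" for s
  proof -
    consider "s < s0" | "s = s0" | "s > s0" by linarith
    then show ?thesis
    proof cases
      case 1
      have ev: "\<forall>\<^sub>F t in nhds s. t < s0" using 1 by (intro eventually_nhds_in_open[of "{..<s0}", simplified]) auto
      have "(w has_real_derivative 0) (at s)"
        using ev by (subst DERIV_cong_ev[OF refl _ refl, where g = "\<lambda>_. 0"]) (auto simp: w_def elim!: eventually_mono)
      moreover have "(p has_real_derivative 0) (at s)"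
        using ev by (subst DERIV_cong_ev[OF refl _ refl, where g = "\<lambda>_. 0"]) (auto simp: p_def elim!: eventually_mono)
      ultimately show ?thesis using 1 by (simp add: solves_at_def w_def[THEN fun_cong] p_def[THEN fun_cong] src0)
    next
      case 2
      have z: "w0 s0 = 0" "p0 s0 = 0" using Y0 by (auto simp: w0_def p0_def)
      have "(w has_real_derivative 0) (at s0)" unfolding w_def
        using d(1)[of s0 "s0 + \<delta>"] \<delta> z by (intro has_real_derivative_glue_zero[of _ _ "s0 + \<delta>"]) auto
      moreover have "(p has_real_derivative 0) (at s0)" unfolding p_def
        using d(2)[of s0 "s0 + \<delta>"] \<delta> z src0 by (intro has_real_derivative_glue_zero[of _ _ "s0 + \<delta>"]) auto
      ultimately show ?thesis using 2 by (simp add: solves_at_def w_def[THEN fun_cong] p_def[THEN fun_cong] src0)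
    next
      case 3
      have ev: "\<forall>\<^sub>F t in nhds s. s0 < t" using 3 by (intro eventually_nhds_in_open[of "{s0<..}", simplified]) auto
      define T where "T = s + \<delta>"
      have T: "s < T" "s0 + \<delta> \<le> T" using 3 \<delta> by (auto simp: T_def)
      have at: "at s within {s0..T} = at s" using 3 T by (intro at_within_Icc_at) auto
      have "(w has_real_derivative p0 s) (at s)"
        using ev d(1)[of s T] 3 T unfolding at
        by (subst DERIV_cong_ev[OF refl _ refl, where g = w0]) (auto simp: w_def elim!: eventually_mono)
      moreover have "(p has_real_derivative source s (w0 s) - k / s * p0 s) (at s)"
        using ev d(2)[of s T] 3 T unfolding at
        by (subst DERIV_cong_ev[OF refl _ refl, where g = p0]) (auto simp: p_def elim!: eventually_mono)
      ultimately show ?thesis using 3 by (simp add: solves_at_def w_def[THEN fun_cong] p_def[THEN fun_cong])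
    qed
  qed
  moreover have "0 < w s" if "s0 < s" "s \<le> s0 + \<delta>" for s
    using posX[OF that] YX[of s] that by (simp add: w_def w0_def)
  ultimately show ?thesis using \<delta> by (intro that[of \<delta> w p]) (auto simp: w_def p_def)
qed

text \<open>Starting from a large dead core makes the energy decreasing, hence negative, which keeps the
  profile away from \<open>0\<close> and bounded.\<close>

theorem dead_core_profile:
  assumes c: "c = (a + \<tau>1) / (q + 1)" and A: "a / 2 - k + c = 0" and B: "(a + \<tau>2) / 2 - c < 0"
  obtains s0 w p M where "s0 > 0" "\<And>s. s > 0 \<Longrightarrow> solves_at w p s" "\<And>s. s \<le> s0 \<Longrightarrow> w s = 0 \<and> p s = 0"
    "\<And>s. s0 < s \<Longrightarrow> 0 < w s" "\<And>s. w s \<le> M"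
proof -
  define D where "D = c * (k + 1 - a) / 2 * (a - 2)"
  define d where "d = c * (k + 1 - a) / 2"
  define B' where "B' = \<beta> * (c - (a + \<tau>2) / 2)"
  have B': "B' > 0" using B beta_pos by (simp add: B'_def)
  have t2: "0 < \<tau>2 + 2" using tau2 by simp
  \<comment> \<open>Beyond R1 the coefficient D - B' s^(\<tau>2 + 2) of w^2 in the energy derivative
    is negative. This is why the core has to be large.\<close>
  obtain R1 where R1: "R1 \<ge> 1" "\<And>s. s \<ge> R1 \<Longrightarrow> (D + 1) / B' \<le> s powr (\<tau>2 + 2)"
    using powr_unbounded[OF t2] by blast
  \<comment> \<open>Beyond R2 the terms in (w/s)^2 produced by the lower order part of the energy
    are absorbed by half of the \<beta> term; this serves the upper bound on w.\<close>
  obtain R2 where R2: "R2 \<ge> 1" "\<And>s. s \<ge> R2 \<Longrightarrow> (c\<^sup>2 / 2 - d) * 4 / \<beta> \<le> s powr (\<tau>2 + 2)"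
    using powr_unbounded[OF t2] by blast
  define s0 where "s0 = max R1 R2"
  have s0: "s0 > 0" "s0 \<ge> R1" "s0 \<ge> R2" using R1(1) by (auto simp: s0_def)
  obtain \<delta> w p where \<delta>: "\<delta> > 0" and sol: "\<And>s. s > 0 \<Longrightarrow> solves_at w p s"
    and core: "\<And>s. s \<le> s0 \<Longrightarrow> w s = 0 \<and> p s = 0" and pos0: "\<And>s. s0 < s \<Longrightarrow> s \<le> s0 + \<delta> \<Longrightarrow> 0 < w s"
    using detached_global_solution[OF s0(1)] by blast
  define E where "E = energy a c w p"
  define E' where "E' = (\<lambda>s. s powr (a - 3) * ((D - B' * s powr (\<tau>2 + 2)) * (w s)\<^sup>2))"
  have dE: "(E has_real_derivative E' s) (at s)" if "s > 0" for s
    using energy_derivative[OF sol[OF that] that c] unfolding E_def E'_def A D_def B'_def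
    by (rule DERIV_cong) (simp add: algebra_simps)
  have coef: "D - B' * s powr (\<tau>2 + 2) < 0" if "s \<ge> s0" for s
  proof -
    have "D + 1 \<le> B' * s powr (\<tau>2 + 2)"
      using R1(2)[of s] that s0 B' by (simp add: pos_divide_le_eq mult.commute)
    then show ?thesis by simp
  qed
  have E'_le: "E' s \<le> 0" if "s \<ge> s0" for s
    unfolding E'_def using coef[OF that] by (intro mult_nonneg_nonpos mult_nonpos_nonneg) auto
  have E_mono: "E t \<le> E s" if "s0 \<le> s" "s \<le> t" for s t
    using that s0 by (intro decreasing_of_deriv[of s t E E'] dE E'_le) auto
  have E0: "E s0 = 0" using core[of s0] by (simp add: E_def energy_def)
  have E1: "E (s0 + \<delta>) < 0"
  proof -
    obtain \<xi> where \<xi>: "s0 < \<xi>" "\<xi> < s0 + \<delta>" "E (s0 + \<delta>) - E s0 = (s0 + \<delta> - s0) * E' \<xi>"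
      using MVT2[of s0 "s0 + \<delta>" E E'] dE s0 \<delta> by auto
    have "E' \<xi> < 0"
      unfolding E'_def using pos0[of \<xi>] \<xi> coef[of \<xi>] s0 by (intro mult_pos_neg mult_neg_pos) auto
    then show ?thesis using \<xi>(3) E0 \<delta> by (simp add: mult_pos_neg)
  qed
  have contw: "continuous_on {s1..s2} w" if "s1 > 0" for s1 s2
  proof (intro continuous_at_imp_continuous_on ballI)
    fix x assume "x \<in> {s1..s2}"
    then have "(w has_real_derivative p x) (at x)" using sol[of x] that by (auto simp: solves_at_def)
    then show "isCont w x" by (rule DERIV_isCont)
  qed
  \<comment> \<open>At a zero of w the energy reduces to s^a p^2 / 2 >= 0, while it is negative from
    s0 + \<delta> on.\<close>
  have nz: "w s \<noteq> 0" if "s \<ge> s0 + \<delta>" for s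
  proof
    assume "w s = 0"
    then have "E s \<ge> 0" by (simp add: E_def energy_def)
    moreover have "E s \<le> E (s0 + \<delta>)" using that \<delta> by (intro E_mono) auto
    ultimately show False using E1 by simp
  qed
  have pos: "0 < w s" if "s > s0" for s
  proof (cases "s \<le> s0 + \<delta>")
    case False
    show ?thesis
    proof (rule ccontr)
      assume "\<not> 0 < w s"
      then have "\<exists>x\<ge>s0 + \<delta>. x \<le> s \<and> w x = 0"
        using pos0[of "s0 + \<delta>"] \<delta> False contw[of "s0 + \<delta>" s] s0 by (intro IVT2') auto
      then show False using nz by blast
    qed
  qed (use pos0 that in auto)
  \<comment> \<open>Nonpositive energy leaves \<beta> s^\<tau>2 w^2 / 4 <= \<gamma> s^\<tau>1
    w^(q+1). Solving for w, and using \<tau>1 <= \<tau>2 to replace s by s0, gives M.\<close>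
  define M where "M = (4 * \<gamma> / \<beta> * s0 powr (\<tau>1 - \<tau>2)) powr (1 / (1 - q))"
  have "w s \<le> M" for s
  proof (cases "s > s0")
    case True
    then have s: "s > 0" "s \<ge> s0" "s \<ge> R2" and ws: "w s > 0" using s0 pos by auto
    have "E s \<le> 0" using E_mono[of s0 s] s E0 by simp
    moreover have "E s = s powr a * ((p s)\<^sup>2 / 2 + \<beta> * s powr \<tau>2 * (w s)\<^sup>2 / 2
        - \<gamma> * s powr \<tau>1 * w s powr (q + 1) / (q + 1) + c * (w s / s) * p s + d * (w s / s)\<^sup>2)"
      using s ws by (simp add: E_def energy_def d_def powr_diff powr_numeral field_simps power2_eq_square)
    ultimately have 1: "(p s)\<^sup>2 / 2 + \<beta> * s powr \<tau>2 * (w s)\<^sup>2 / 2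
        - \<gamma> * s powr \<tau>1 * w s powr (q + 1) / (q + 1) + c * (w s / s) * p s + d * (w s / s)\<^sup>2 \<le> 0"
      using s by (simp add: mult_le_0_iff)
    have 2: "- (c\<^sup>2 / 2 * (w s / s)\<^sup>2) \<le> (p s)\<^sup>2 / 2 + c * (w s / s) * p s"
    proof -
      have "(c * (w s / s) + p s)\<^sup>2 = c\<^sup>2 * (w s / s)\<^sup>2 + (p s)\<^sup>2 + 2 * (c * (w s / s) * p s)" by algebra
      then show ?thesis using zero_le_power2[of "c * (w s / s) + p s"] by linarith
    qed
    have 3: "(c\<^sup>2 / 2 - d) * (w s / s)\<^sup>2 \<le> \<beta> * s powr \<tau>2 * (w s)\<^sup>2 / 4"
    proof -
      have "(c\<^sup>2 / 2 - d) * 4 \<le> \<beta> * s powr (\<tau>2 + 2)"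
        using R2(2)[OF s(3)] beta_pos by (simp add: pos_divide_le_eq mult.commute)
      then have "(c\<^sup>2 / 2 - d) * (w s / s)\<^sup>2 \<le> \<beta> * s powr (\<tau>2 + 2) / 4 * (w s / s)\<^sup>2"
        by (intro mult_right_mono) auto
      also have "\<dots> = \<beta> * s powr \<tau>2 * (w s)\<^sup>2 / 4"
        using s by (simp add: powr_add powr_numeral power_divide)
      finally show ?thesis .
    qed
    have 4: "\<gamma> * s powr \<tau>1 * w s powr (q + 1) / (q + 1) \<le> \<gamma> * s powr \<tau>1 * w s powr (q + 1)"
      using q_pos gamma_pos divide_left_mono[of 1 "q + 1" "\<gamma> * s powr \<tau>1 * w s powr (q + 1)"] by simp
    have "\<beta> * s powr \<tau>2 * (w s)\<^sup>2 / 4 \<le> \<gamma> * s powr \<tau>1 * w s powr (q + 1)"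
      using 1 2 3 4 by (simp add: left_diff_distrib)
    moreover have "(w s)\<^sup>2 = w s powr (1 - q) * w s powr (q + 1)"
      using ws powr_add[of "w s" "1 - q" "q + 1"] by (simp add: powr_numeral)
    ultimately have "\<beta> * s powr \<tau>2 / 4 * w s powr (1 - q) * w s powr (q + 1) \<le> \<gamma> * s powr \<tau>1 * w s powr (q + 1)"
      by (simp add: mult_ac)
    then have "\<beta> * s powr \<tau>2 / 4 * w s powr (1 - q) \<le> \<gamma> * s powr \<tau>1" using ws by simp
    then have "w s powr (1 - q) \<le> 4 * \<gamma> / \<beta> * s powr (\<tau>1 - \<tau>2)"
      using s beta_pos by (simp add: powr_diff field_simps)
    also have "\<dots> \<le> 4 * \<gamma> / \<beta> * s0 powr (\<tau>1 - \<tau>2)"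
      using s s0 tau_le gamma_pos beta_pos by (intro mult_left_mono powr_mono2') auto
    finally have "(w s powr (1 - q)) powr (1 / (1 - q)) \<le> M"
      unfolding M_def using q_less by (intro powr_mono2) auto
    then show ?thesis using ws q_less by (simp add: powr_powr)
  next
    case False
    then show ?thesis using core[of s] by (simp add: M_def)
  qed
  then show ?thesis using that[of s0 w p M] s0 sol core pos by blast
qed

end

section \<open>From profiles to weak solutions\<close>

lemma zero_derivative_off_support:
  fixes f :: "'a::real_normed_vector \<Rightarrow> real"
  assumes K: "closed K" "\<And>z. z \<notin> K \<Longrightarrow> f z = 0" and z: "z \<notin> K"
  shows "((\<lambda>h. f (z + h *\<^sub>R v)) has_real_derivative 0) (at 0)"
proof -
  have "((\<lambda>h::real. z + h *\<^sub>R v) \<longlongrightarrow> z) (nhds 0)"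
    by (rule tendsto_eq_intros filterlim_ident refl | simp)+
  then have "\<forall>\<^sub>F h::real in nhds 0. z + h *\<^sub>R v \<in> - K"
    using z K(1) by (intro topological_tendstoD) (auto simp: open_Compl)
  then have "\<forall>\<^sub>F h::real in nhds 0. f (z + h *\<^sub>R v) = 0"
    by eventually_elim (use K in auto)
  then show ?thesis
    by (subst DERIV_cong_ev[OF refl _ refl, where g = "\<lambda>_. 0"]) auto
qed

lemma deriv_zero_off_support:
  fixes f :: "'a::real_normed_vector \<Rightarrow> real"
  assumes "closed K" "\<And>z. z \<notin> K \<Longrightarrow> f z = 0" "z \<notin> K"
    and "((\<lambda>h. f (z + h *\<^sub>R v)) has_real_derivative D) (at 0)"
  shows "D = 0"
  using DERIV_unique[OF assms(4) zero_derivative_off_support[OF assms(1-3)]] .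

lemma continuous_on_zero_extension:
  fixes f :: "'a::topological_space \<Rightarrow> real"
  assumes "open U" "closed K" "K \<subseteq> U" "continuous_on U f" "\<And>z. z \<notin> K \<Longrightarrow> f z = 0"
  shows "continuous_on UNIV f"
proof -
  have "continuous_on (- K) f"
    using assms(5) by (subst continuous_on_cong[OF refl, where g = "\<lambda>_. 0"]) auto
  then have "continuous_on (U \<union> - K) f"
    using assms by (intro continuous_on_open_Un) auto
  moreover have "U \<union> - K = UNIV" using assms(3) by auto
  ultimately show ?thesis by simp
qed

lemma integrable_continuous_compact_support:
  fixes f :: "'a::euclidean_space \<Rightarrow> real"
  assumes "continuous_on UNIV f" "compact K" "\<And>z. z \<notin> K \<Longrightarrow> f z = 0"
  shows "integrable lborel f"
proof -
  have "integrable lborel (\<lambda>x. indicator K x *\<^sub>R f x)"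
    using assms by (intro borel_integrable_compact continuous_on_subset[OF assms(1)]) auto
  moreover have "(\<lambda>x. indicator K x *\<^sub>R f x) = f"
    using assms(3) by (auto simp: indicator_def fun_eq_iff)
  ultimately show ?thesis by simp
qed

text \<open>The difference quotients of \<open>f\<close> have integral \<open>0\<close> by translation invariance.\<close>

lemma integral_directional_derivative:
  fixes f f' :: "'a::euclidean_space \<Rightarrow> real"
  assumes U: "open U" "K \<subseteq> U" and K: "compact K"
    and z: "\<And>z. z \<notin> K \<Longrightarrow> f z = 0" "\<And>z. z \<notin> K \<Longrightarrow> f' z = 0"
    and contU: "continuous_on U f" "continuous_on U f'"
    and dU: "\<And>z. z \<in> U \<Longrightarrow> ((\<lambda>h. f (z + h *\<^sub>R v)) has_real_derivative f' z) (at 0)"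
  shows "integrable lborel f'" "integral\<^sup>L lborel f' = 0"
proof -
  have cont: "continuous_on UNIV f" "continuous_on UNIV f'"
    using continuous_on_zero_extension[OF U(1) compact_imp_closed[OF K] U(2)] contU z by auto
  have f: "integrable lborel f" and f': "integrable lborel f'"
    using integrable_continuous_compact_support[OF _ K] cont z by auto
  have d0: "((\<lambda>h. f (x + h *\<^sub>R v)) has_real_derivative f' x) (at 0)" for x
  proof (cases "x \<in> U")
    case False
    then have x: "x \<notin> K" using U(2) by blast
    show ?thesis
      using zero_derivative_off_support[where K = K and f = f and z = x and v = v, OF compact_imp_closed[OF K] z(1) x]
      unfolding z(2)[OF x] .
  qed (rule dU)
  have d: "((\<lambda>h. f (x + h *\<^sub>R v)) has_real_derivative f' (x + h *\<^sub>R v)) (at h)" for x h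
  proof -
    have "((\<lambda>h'. f ((x + h *\<^sub>R v) + h' *\<^sub>R v)) has_real_derivative f' (x + h *\<^sub>R v)) (at (h + (- h)))"
      using d0[of "x + h *\<^sub>R v"] by simp
    then have "((\<lambda>h'. f ((x + h *\<^sub>R v) + (h' + (- h)) *\<^sub>R v)) has_real_derivative f' (x + h *\<^sub>R v)) (at h)"
      by (subst (asm) DERIV_shift)
    then show ?thesis by (simp add: algebra_simps)
  qed
  have "bounded (f' ` K)"
    by (intro compact_imp_bounded compact_continuous_image continuous_on_subset[OF cont(2)] K) auto
  then obtain M where M: "M > 0" "\<And>x. x \<in> K \<Longrightarrow> \<bar>f' x\<bar> \<le> M"
    unfolding bounded_pos by auto
  have M': "\<bar>f' x\<bar> \<le> M" for x using M z(2)[of x] by (cases "x \<in> K") auto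
  \<comment> \<open>K swept backwards along v: outside K' all difference quotients with step at most
    1 vanish, so M on K' dominates them.\<close>
  define K' where "K' = (\<lambda>(x, s). x - s *\<^sub>R v) ` (K \<times> {0..1::real})"
  have K': "compact K'" unfolding K'_def case_prod_beta
    using K by (intro compact_continuous_image compact_Times continuous_intros) auto
  have off: "f (x + h *\<^sub>R v) = 0" if "x \<notin> K'" "h \<in> {0..1}" for x h
  proof (rule z(1), rule notI)
    assume "x + h *\<^sub>R v \<in> K"
    then have "(\<lambda>(x, s). x - s *\<^sub>R v) (x + h *\<^sub>R v, h) \<in> K'"
      unfolding K'_def using that(2) by (intro imageI) auto
    then show False using that(1) by simp
  qed
  define h where "h = (\<lambda>n. inverse (real (Suc n)))"
  have h: "0 < h n" "h n \<le> 1" for n by (auto simp: h_def inverse_le_1_iff)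
  define D where "D = (\<lambda>n x. (f (x + h n *\<^sub>R v) - f x) / h n)"
  have shift: "integrable lborel (\<lambda>x. f (x + c))" "(\<integral>x. f (x + c) \<partial>lborel) = (\<integral>x. f x \<partial>lborel)" for c
  proof -
    have fm: "f \<in> borel_measurable borel" using cont by (intro borel_measurable_continuous_onI)
    have "integrable (distr lborel borel ((+) c)) f" using f by (simp add: lborel_distr_plus)
    then show "integrable lborel (\<lambda>x. f (x + c))"
      by (subst (asm) integrable_distr_eq) (use fm in \<open>auto simp: add.commute\<close>)
    have "(\<integral>x. f x \<partial>lborel) = integral\<^sup>L (distr lborel borel ((+) c)) f" by (simp add: lborel_distr_plus)
    also have "\<dots> = (\<integral>x. f (c + x) \<partial>lborel)" by (subst integral_distr) (use fm in auto)
    finally show "(\<integral>x. f (x + c) \<partial>lborel) = (\<integral>x. f x \<partial>lborel)" by (simp add: add.commute)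
  qed
  have D0: "integral\<^sup>L lborel (D n) = 0" for n
    unfolding D_def using shift[of "h n *\<^sub>R v"] f by simp
  have "(\<lambda>n. integral\<^sup>L lborel (D n)) \<longlonglongrightarrow> integral\<^sup>L lborel f'"
  proof (rule integral_dominated_convergence[where w = "\<lambda>x. M * indicator K' x"])
    show "f' \<in> borel_measurable lborel" using f' by auto
    show "D n \<in> borel_measurable lborel" for n
      unfolding D_def using shift(1)[of "h n *\<^sub>R v"] f by (intro borel_measurable_integrable) auto
    show "integrable lborel (\<lambda>x. M * indicator K' x)"
      using K' emeasure_bounded_finite[OF compact_imp_bounded[OF K']]
      by (intro integrable_mult_right integrable_real_indicator) (auto intro!: borel_closed compact_imp_closed)
    show "AE x in lborel. (\<lambda>n. D n x) \<longlonglongrightarrow> f' x"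
    proof (rule always_eventually, rule allI)
      fix x
      have "((\<lambda>y. (f (x + y *\<^sub>R v) - f x) / y) \<longlongrightarrow> f' x) (at 0)"
        using d0[of x] by (simp add: DERIV_def)
      moreover have "filterlim h (at 0) sequentially"
        unfolding filterlim_at using LIMSEQ_inverse_real_of_nat h by (auto simp: h_def)
      ultimately show "(\<lambda>n. D n x) \<longlonglongrightarrow> f' x"
        unfolding D_def by (rule filterlim_compose[of "\<lambda>y. (f (x + y *\<^sub>R v) - f x) / y"])
    qed
    show "AE x in lborel. norm (D n x) \<le> M * indicator K' x" for n
    proof (rule always_eventually, rule allI)
      fix x
      show "norm (D n x) \<le> M * indicator K' x"
      proof (cases "x \<in> K'")
        case True
        obtain s where "f (x + h n *\<^sub>R v) - f (x + 0 *\<^sub>R v) = (h n - 0) * f' (x + s *\<^sub>R v)"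
          using MVT2[of 0 "h n" "\<lambda>h. f (x + h *\<^sub>R v)" "\<lambda>h. f' (x + h *\<^sub>R v)"] d h by blast
        then have "D n x = f' (x + s *\<^sub>R v)" using h(1)[of n] by (simp add: D_def)
        then show ?thesis using M' True by simp
      next
        case False
        then show ?thesis using off[of x "h n"] off[of x 0] h[of n] by (simp add: D_def)
      qed
    qed
  qed
  then show "integral\<^sup>L lborel f' = 0" using D0 LIMSEQ_unique[OF tendsto_const] by force
  show "integrable lborel f'" by (rule f')
qed

lemma norm_powr_eq_inner: "norm (x::'a::real_inner) powr \<sigma> = (x \<bullet> x) powr (\<sigma> / 2)"
  using powr_powr[of "x \<bullet> x" "1/2" \<sigma>] by (simp add: norm_eq_sqrt_inner powr_half_sqrt)

lemma radial_line_derivative: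
  fixes x b :: "'a::euclidean_space"
  assumes "(g has_real_derivative g') (at ((x + h *\<^sub>R b) \<bullet> (x + h *\<^sub>R b)))"
  shows "((\<lambda>h. g ((x + h *\<^sub>R b) \<bullet> (x + h *\<^sub>R b))) has_real_derivative
    g' * (2 * ((x + h *\<^sub>R b) \<bullet> b))) (at h)"
proof -
  have "((\<lambda>h. (x + h *\<^sub>R b) \<bullet> (x + h *\<^sub>R b)) has_real_derivative 2 * ((x + h *\<^sub>R b) \<bullet> b)) (at h)"
  proof -
    have "(\<lambda>h. (x + h *\<^sub>R b) \<bullet> (x + h *\<^sub>R b)) = (\<lambda>h. x \<bullet> x + 2 * (x \<bullet> b) * h + (b \<bullet> b) * h\<^sup>2)"
      by (rule ext) (simp add: inner_add_left inner_add_right inner_commute power2_eq_square algebra_simps)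
    then show ?thesis
      by (auto intro!: derivative_eq_intros simp: inner_add_left inner_commute algebra_simps)
  qed
  from DERIV_chain2[OF assms this] show ?thesis .
qed

lemma sum_inner_Basis_square: "(\<Sum>b\<in>Basis. (x \<bullet> b)\<^sup>2) = x \<bullet> (x::'a::euclidean_space)"
  by (subst euclidean_inner) (simp add: power2_eq_square)

text \<open>All derivatives vanish off the same K, since its complement is open. They are restated
  as directional derivatives in space-time, along (0, 1) and (b, 0), the form in which they are
  integrated to 0.\<close>

lemma test_function_facts:
  fixes \<phi> :: "'a::euclidean_space \<times> real \<Rightarrow> real"
  assumes "test_function T \<phi>"
  obtains K where "compact K" "K \<subseteq> UNIV \<times> {0<..<T}"
    "\<And>z. z \<notin> K \<Longrightarrow> \<phi> z = 0" "\<And>z. z \<notin> K \<Longrightarrow> time_deriv \<phi> z = 0"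
    "\<And>z b. b \<in> Basis \<Longrightarrow> z \<notin> K \<Longrightarrow> space_deriv b \<phi> z = 0"
    "\<And>z b. b \<in> Basis \<Longrightarrow> z \<notin> K \<Longrightarrow> space_deriv b (space_deriv b \<phi>) z = 0"
    "continuous_on UNIV \<phi>" "continuous_on UNIV (time_deriv \<phi>)"
    "\<And>b. b \<in> Basis \<Longrightarrow> continuous_on UNIV (space_deriv b \<phi>)"
    "\<And>b. b \<in> Basis \<Longrightarrow> continuous_on UNIV (space_deriv b (space_deriv b \<phi>))"
    "\<And>z. ((\<lambda>h. \<phi> (z + h *\<^sub>R (0, 1))) has_real_derivative time_deriv \<phi> z) (at 0)"
    "\<And>z b. b \<in> Basis \<Longrightarrow> ((\<lambda>h. \<phi> (z + h *\<^sub>R (b, 0))) has_real_derivative space_deriv b \<phi> z) (at 0)"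
    "\<And>z b. b \<in> Basis \<Longrightarrow> ((\<lambda>h. space_deriv b \<phi> (z + h *\<^sub>R (b, 0))) has_real_derivative
       space_deriv b (space_deriv b \<phi>) z) (at 0)"
proof -
  have sp: "((\<lambda>h. \<psi> (z + h *\<^sub>R (b, 0))) has_real_derivative space_deriv b \<psi> z) (at 0)"
    if "C1_in_space \<psi>" "b \<in> Basis" for \<psi> :: "'a \<times> real \<Rightarrow> real" and z b
  proof (cases z)
    case (Pair x t)
    then show ?thesis
      using that by (simp add: C1_in_space_def space_deriv_def DERIV_deriv_iff_real_differentiable)
  qed
  have ti: "((\<lambda>h. \<phi> (z + h *\<^sub>R (0, 1))) has_real_derivative time_deriv \<phi> z) (at 0)" for z
  proof (cases z)
    case (Pair x t)
    have "((\<lambda>s. \<phi> (x, s)) has_real_derivative time_deriv \<phi> (x, t)) (at t)"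
      using assms by (simp add: test_function_def C1_in_time_def time_deriv_def DERIV_deriv_iff_real_differentiable)
    then have "((\<lambda>s. \<phi> (x, s)) has_real_derivative time_deriv \<phi> (x, t)) (at (0 + t))" by simp
    then have "((\<lambda>h. \<phi> (x, h + t)) has_real_derivative time_deriv \<phi> (x, t)) (at 0)"
      by (subst (asm) DERIV_shift)
    then show ?thesis using Pair by (simp add: add.commute)
  qed
  obtain K where K: "compact K" "K \<subseteq> UNIV \<times> {0<..<T}" "\<And>z. z \<notin> K \<Longrightarrow> \<phi> z = 0"
    using assms unfolding test_function_def by blast
  note cl = compact_imp_closed[OF K(1)]
  have C1: "C1_in_space \<phi>" "\<And>b. b \<in> Basis \<Longrightarrow> C1_in_space (space_deriv b \<phi>)"
    using assms by (auto simp: test_function_def)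
  have z1: "space_deriv b \<phi> z = 0" if "b \<in> Basis" "z \<notin> K" for z b
    by (rule deriv_zero_off_support[OF cl K(3) that(2) sp[OF C1(1) that(1)]])
  have z2: "space_deriv b (space_deriv b \<phi>) z = 0" if "b \<in> Basis" "z \<notin> K" for z b
    by (rule deriv_zero_off_support[OF cl z1[OF that(1)] that(2) sp[OF C1(2)[OF that(1)] that(1)]])
  have zt: "time_deriv \<phi> z = 0" if "z \<notin> K" for z
    by (rule deriv_zero_off_support[OF cl K(3) that ti])
  show ?thesis
    by (rule that[OF K(1,2,3) zt z1 z2]) (use assms C1 sp ti in \<open>auto simp: test_function_def C1_in_time_def C1_in_space_def\<close>)
qed

lemma locally_integrable_continuous:
  assumes "continuous_on (UNIV \<times> {0<..<T}) f"
  shows "locally_integrable T f"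
  unfolding locally_integrable_def
proof (intro allI impI)
  fix K :: "('a \<times> real) set"
  assume K: "compact K" "K \<subseteq> UNIV \<times> {0<..<T}"
  have "integrable lborel (\<lambda>x. indicator K x *\<^sub>R f x)"
    using K by (intro borel_integrable_compact continuous_on_subset[OF assms])
  then show "f absolutely_integrable_on K"
    unfolding set_integrable_def by (subst integrable_completion) auto
qed

text \<open>The integrand of the weak formulation is a sum of directional derivatives of compactly
  supported functions, plus terms without derivatives of the test function that cancel by the
  profile equation. This is Green's identity, written out one coordinate at a time.\<close>

lemma separated_weak_solution:
  fixes w p r :: "real \<Rightarrow> real"
  assumes m: "m > 1" and s0: "s0 > 0"
    and dw: "\<And>s. (w has_real_derivative p s) (at s)" and dp: "\<And>s. (p has_real_derivative r s) (at s)"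
    and cr: "continuous_on UNIV r" and nonneg: "\<And>s. 0 \<le> w s" and core: "\<And>s. s \<le> s0 \<Longrightarrow> w s = 0"
    and ode: "\<And>s. s > 0 \<Longrightarrow> 2 * real DIM('a::euclidean_space) * p s + 4 * s * r s =
       1 / (m - 1) * s powr (\<sigma>1 / 2) * w s powr (1 / m) - s powr (\<sigma>2 / 2) * w s"
    and core2: "p 0 = 0"
    and u: "\<And>x t. t \<in> {0<..<T} \<Longrightarrow> u x t = (T - t) powr (- (1 / (m - 1))) * w (x \<bullet> x) powr (1 / m)"
  shows "weak_solution m \<sigma>1 \<sigma>2 T (u :: 'a \<Rightarrow> real \<Rightarrow> real)"
proof -
  define \<alpha> where "\<alpha> = 1 / (m - 1)"
  have \<alpha>: "\<alpha> > 0" "m * \<alpha> = \<alpha> + 1" using m by (auto simp: \<alpha>_def field_simps)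
  define A where "A = (\<lambda>t. (T - t) powr (- \<alpha>))"
  define A2 where "A2 = (\<lambda>t. (T - t) powr (- \<alpha> - 1))"
  define V where "V = (\<lambda>x::'a. w (x \<bullet> x))"
  define \<psi> where "\<psi> = (\<lambda>x::'a. norm x powr \<sigma>1 * w (x \<bullet> x) powr (1 / m))"
  define \<psi>2 where "\<psi>2 = (\<lambda>x::'a. norm x powr \<sigma>2 * w (x \<bullet> x))"
  have cw: "continuous_on UNIV w" "continuous_on UNIV p"
    using DERIV_isCont[OF dw] DERIV_isCont[OF dp] by (auto intro!: continuous_at_imp_continuous_on)
  have ci: "continuous_on UNIV (\<lambda>x::'a. f (x \<bullet> x))" if "continuous_on UNIV f" for f :: "real \<Rightarrow> real"
    by (rule continuous_on_compose2[OF that]) (auto intro: continuous_intros)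
  \<comment> \<open>For negative b the weight is singular at the origin, but the product vanishes on
    the dead core around it.\<close>
  have cut: "continuous_on UNIV (\<lambda>x::'a. norm x powr b * w (x \<bullet> x) powr c)" if "c > 0" for b c
  proof (rule continuous_on_zero_extension[where U = "- {0}" and K = "{x. s0 \<le> x \<bullet> x}"])
    show "closed {x::'a. s0 \<le> x \<bullet> x}" by (intro closed_Collect_le continuous_intros)
    have 1: "continuous_on (- {0}) (\<lambda>x::'a. w (x \<bullet> x) powr c)"
      using that nonneg by (intro continuous_on_subset[OF continuous_on_powr'[OF ci[OF cw(1)] continuous_on_const]]) auto
    have 2: "continuous_on (- {0}) (\<lambda>x::'a. norm x powr b)" by (intro continuous_intros) auto
    show "continuous_on (- {0}) (\<lambda>x::'a. norm x powr b * w (x \<bullet> x) powr c)"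
      by (rule continuous_on_mult[OF 2 1])
    show "norm x powr b * w (x \<bullet> x) powr c = 0" if "x \<notin> {x. s0 \<le> x \<bullet> x}" for x :: 'a
      using that core[of "x \<bullet> x"] by simp
  qed (use s0 in auto)
  have c\<psi>: "continuous_on UNIV \<psi>" unfolding \<psi>_def using m by (intro cut) auto
  have c\<psi>2: "continuous_on UNIV \<psi>2" using cut[of 1 \<sigma>2] nonneg by (simp add: \<psi>2_def)
  have cV: "continuous_on UNIV V" unfolding V_def by (rule ci[OF cw(1)])
  have wq: "(w s powr (1 / m)) powr m = w s" for s using m nonneg by (simp add: powr_powr)
  have um: "u x t powr m = A2 t * V x" if "t \<in> {0<..<T}" for x t
  proof -
    have "u x t powr m = ((T - t) powr (- \<alpha>)) powr m * (w (x \<bullet> x) powr (1 / m)) powr m"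
      using that nonneg by (simp add: u \<alpha>_def powr_mult)
    also have "((T - t) powr (- \<alpha>)) powr m = A2 t"
      using \<alpha>(2) by (simp add: powr_powr A2_def mult.commute)
    finally show ?thesis by (simp add: wq V_def)
  qed
  have cA: "continuous_on (UNIV \<times> {..<T}) (\<lambda>z::'a \<times> real. (T - snd z) powr b)" for b
    by (intro continuous_intros) auto
  have cfst: "continuous_on S (\<lambda>z::'a \<times> real. f (fst z))" if "continuous_on UNIV f" for f :: "'a \<Rightarrow> real" and S
    by (rule continuous_on_compose2[OF that]) (auto intro: continuous_intros)
  have loc: "locally_integrable T (\<lambda>z::'a \<times> real. (T - snd z) powr b * f (fst z))" if "continuous_on UNIV f" for f b
    using that by (intro locally_integrable_continuous continuous_on_mult cfst continuous_on_subset[OF cA]) auto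
  have loc_cong: "locally_integrable T f" if "locally_integrable T g"
    "\<And>z::'a \<times> real. snd z \<in> {0<..<T} \<Longrightarrow> f z = g z" for f g
    unfolding locally_integrable_def
  proof (intro allI impI)
    fix K :: "('a \<times> real) set"
    assume K: "compact K" "K \<subseteq> UNIV \<times> {0<..<T}"
    have "g absolutely_integrable_on K" using that(1) K by (auto simp: locally_integrable_def)
    moreover have "(\<lambda>z. indicator K z *\<^sub>R f z) = (\<lambda>z. indicator K z *\<^sub>R g z)"
    proof
      fix z
      have "z \<in> K \<Longrightarrow> snd z \<in> {0<..<T}" using K by auto
      then show "indicator K z *\<^sub>R f z = indicator K z *\<^sub>R g z"
        using that(2)[of z] by (auto simp: indicator_def)
    qed
    ultimately show "f absolutely_integrable_on K" unfolding set_integrable_def by simp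
  qed
  define r2 where "r2 = (\<lambda>(b::'a) x::'a. 2 * p (x \<bullet> x) + 4 * (x \<bullet> b)\<^sup>2 * r (x \<bullet> x))"
  define r1 where "r1 = (\<lambda>(b::'a) x::'a. 2 * (x \<bullet> b) * p (x \<bullet> x))"
  have dV: "((\<lambda>h. V (x + h *\<^sub>R b)) has_real_derivative r1 b x) (at 0)" for x b
    using radial_line_derivative[of w "p (x \<bullet> x)" x 0 b] dw[of "x \<bullet> x"] by (simp add: V_def r1_def mult_ac)
  have dr1: "((\<lambda>h. r1 b (x + h *\<^sub>R b)) has_real_derivative r2 b x) (at 0)" if "b \<in> Basis" for x b
  proof -
    have 1: "((\<lambda>h. p ((x + h *\<^sub>R b) \<bullet> (x + h *\<^sub>R b))) has_real_derivative r (x \<bullet> x) * (2 * (x \<bullet> b))) (at 0)"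
      using radial_line_derivative[of p "r (x \<bullet> x)" x 0 b] dp[of "x \<bullet> x"] by simp
    have 2: "((\<lambda>h. 2 * ((x + h *\<^sub>R b) \<bullet> b)) has_real_derivative 2) (at 0)"
      using that by (auto intro!: derivative_eq_intros simp: inner_add_left)
    show ?thesis
      unfolding r1_def r2_def
      by (rule DERIV_cong[OF DERIV_mult[OF 2 1]]) (simp add: power2_eq_square)
  qed
  have cr1: "continuous_on UNIV (r1 b)" for b
    unfolding r1_def by (intro continuous_on_mult ci[OF cw(2)] continuous_intros)
  have cr2: "continuous_on UNIV (r2 b)" for b
    unfolding r2_def by (intro continuous_on_add continuous_on_mult ci[OF cw(2)] ci[OF cr] continuous_intros)
  have laplace: "(\<Sum>b\<in>Basis. r2 b x) = \<alpha> * \<psi> x - \<psi>2 x" for x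
  proof -
    have "(\<Sum>b\<in>Basis. r2 b x) = 2 * real DIM('a) * p (x \<bullet> x) + 4 * (x \<bullet> x) * r (x \<bullet> x)"
    proof -
      have "(\<Sum>b\<in>Basis. 4 * (x \<bullet> b)\<^sup>2 * r (x \<bullet> x)) = 4 * (\<Sum>b\<in>Basis. (x \<bullet> b)\<^sup>2) * r (x \<bullet> x)"
        by (simp only: sum_distrib_left sum_distrib_right)
      then show ?thesis by (simp add: r2_def sum.distrib sum_inner_Basis_square)
    qed
    also have "\<dots> = \<alpha> * \<psi> x - \<psi>2 x"
    proof (cases "x = 0")
      case False
      then show ?thesis using ode[of "x \<bullet> x"]
        by (simp add: \<alpha>_def \<psi>_def \<psi>2_def norm_powr_eq_inner mult.assoc)
    next
      case True
      then show ?thesis using core2 by (simp add: \<psi>_def \<psi>2_def)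
    qed
    finally show ?thesis .
  qed
  have weak: "(LINT (x, t) : UNIV \<times> {0<..<T} | lebesgue.
             norm x powr \<sigma>1 * u x t * time_deriv \<phi> (x, t)
           + u x t powr m * space_laplacian \<phi> (x, t)
           + norm x powr \<sigma>2 * u x t powr m * \<phi> (x, t)) = 0" if \<phi>: "test_function T \<phi>" for \<phi> :: "'a \<times> real \<Rightarrow> real"
  proof -
    obtain K where K: "compact K" "K \<subseteq> UNIV \<times> {0<..<T}"
      and z: "\<And>z. z \<notin> K \<Longrightarrow> \<phi> z = 0" "\<And>z. z \<notin> K \<Longrightarrow> time_deriv \<phi> z = 0"
        "\<And>z b. b \<in> Basis \<Longrightarrow> z \<notin> K \<Longrightarrow> space_deriv b \<phi> z = 0"
        "\<And>z b. b \<in> Basis \<Longrightarrow> z \<notin> K \<Longrightarrow> space_deriv b (space_deriv b \<phi>) z = 0"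
      and c: "continuous_on UNIV \<phi>" "continuous_on UNIV (time_deriv \<phi>)"
        "\<And>b. b \<in> Basis \<Longrightarrow> continuous_on UNIV (space_deriv b \<phi>)"
        "\<And>b. b \<in> Basis \<Longrightarrow> continuous_on UNIV (space_deriv b (space_deriv b \<phi>))"
      and d: "\<And>z. ((\<lambda>h. \<phi> (z + h *\<^sub>R (0, 1))) has_real_derivative time_deriv \<phi> z) (at 0)"
        "\<And>z b. b \<in> Basis \<Longrightarrow> ((\<lambda>h. \<phi> (z + h *\<^sub>R (b, 0))) has_real_derivative space_deriv b \<phi> z) (at 0)"
        "\<And>z b. b \<in> Basis \<Longrightarrow> ((\<lambda>h. space_deriv b \<phi> (z + h *\<^sub>R (b, 0))) has_real_derivative
           space_deriv b (space_deriv b \<phi>) z) (at 0)"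
      by (rule test_function_facts[OF \<phi>]) (rule that)
    let ?U = "UNIV \<times> {..<T} :: ('a \<times> real) set"
    have U: "open ?U" "K \<subseteq> ?U" using K(2) by (auto intro!: open_Times)
    have cA': "continuous_on ?U (\<lambda>z. A (snd z))" "continuous_on ?U (\<lambda>z. A2 (snd z))"
      unfolding A_def A2_def by (rule cA)+
    \<comment> \<open>\<open>f0'\<close> is the time derivative of f0, and \<open>fb'\<close> is the
      derivative in direction b of the Green flux V \<partial>\<phi> - \<phi> \<partial>V, in which
      the first order products cancel.\<close>
    define f0 where "f0 = (\<lambda>z. A (snd z) * \<phi> z * \<psi> (fst z))"
    define f0' where "f0' = (\<lambda>z. (\<alpha> * A2 (snd z) * \<phi> z + A (snd z) * time_deriv \<phi> z) * \<psi> (fst z))"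
    define fb where "fb = (\<lambda>b z. A2 (snd z) * (V (fst z) * space_deriv b \<phi> z - \<phi> z * r1 b (fst z)))"
    define fb' where "fb' = (\<lambda>b z. A2 (snd z) * (V (fst z) * space_deriv b (space_deriv b \<phi>) z - \<phi> z * r2 b (fst z)))"
    have I0: "integrable lborel f0'" "integral\<^sup>L lborel f0' = 0"
    proof -
      have 1: "((\<lambda>h. f0 (z + h *\<^sub>R (0, 1))) has_real_derivative f0' z) (at 0)" if "z \<in> ?U" for z
      proof -
        have "((\<lambda>h. T - (snd z + h)) has_real_derivative - 1) (at 0)"
          by (auto intro!: derivative_eq_intros)
        from DERIV_fun_powr[OF this, of "- \<alpha>"] that
        have "((\<lambda>h. A (snd z + h)) has_real_derivative \<alpha> * A2 (snd z)) (at 0)"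
          by (auto simp: A_def A2_def)
        from DERIV_cmult_right[OF DERIV_mult[OF this d(1)[of z]], of "\<psi> (fst z)"]
        show ?thesis by (simp add: f0_def f0'_def mult_ac add.commute zero_prod_def[symmetric])
      qed
      have 2: "continuous_on ?U f0" "continuous_on ?U f0'"
        unfolding f0_def f0'_def
        by (intro continuous_on_mult continuous_on_add continuous_on_const cfst[OF c\<psi>] cA'
            continuous_on_subset[OF c(1)] continuous_on_subset[OF c(2)] subset_UNIV)+
      show "integrable lborel f0'" "integral\<^sup>L lborel f0' = 0"
        by (rule integral_directional_derivative[OF U K(1) _ _ 2 1]; simp add: f0_def f0'_def z)+
    qed
    have Ib: "integrable lborel (fb' b)" "integral\<^sup>L lborel (fb' b) = 0" if b: "b \<in> Basis" for b
    proof -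
      have 1: "((\<lambda>h. fb b (z + h *\<^sub>R (b, 0))) has_real_derivative fb' b z) (at 0)" for z
      proof -
        have "((\<lambda>h. A2 (snd z) * (V (fst z + h *\<^sub>R b) * space_deriv b \<phi> (z + h *\<^sub>R (b, 0))
            - \<phi> (z + h *\<^sub>R (b, 0)) * r1 b (fst z + h *\<^sub>R b))) has_real_derivative
          A2 (snd z) * ((r1 b (fst z) * space_deriv b \<phi> (z + 0 *\<^sub>R (b, 0)) + space_deriv b (space_deriv b \<phi>) z * V (fst z + 0 *\<^sub>R b))
            - (space_deriv b \<phi> z * r1 b (fst z + 0 *\<^sub>R b) + r2 b (fst z) * \<phi> (z + 0 *\<^sub>R (b, 0))))) (at 0)"
          by (intro DERIV_cmult DERIV_diff DERIV_mult dV dr1 d b)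
        then show ?thesis by (simp add: fb_def fb'_def mult_ac zero_prod_def[symmetric])
      qed
      have 2: "continuous_on ?U (fb b)" "continuous_on ?U (fb' b)"
        unfolding fb_def fb'_def
        by (intro continuous_on_mult continuous_on_diff cfst[OF cV] cfst[OF cr1] cfst[OF cr2] cA'
            continuous_on_subset[OF c(1)] continuous_on_subset[OF c(3)] continuous_on_subset[OF c(4)] subset_UNIV b)+
      show "integrable lborel (fb' b)" "integral\<^sup>L lborel (fb' b) = 0"
        by (rule integral_directional_derivative[OF U K(1) _ _ 2 1]; simp add: fb_def fb'_def z b)+
    qed
    define S where "S = (\<lambda>z. f0' z + (\<Sum>b\<in>Basis. fb' b z))"
    have S: "integrable lborel S" "integral\<^sup>L lborel S = 0"
      unfolding S_def using I0 Ib by (auto simp: Bochner_Integration.integral_add Bochner_Integration.integral_sum)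
    have Seq: "S (x, t) = norm x powr \<sigma>1 * u x t * time_deriv \<phi> (x, t)
           + u x t powr m * space_laplacian \<phi> (x, t)
           + norm x powr \<sigma>2 * u x t powr m * \<phi> (x, t)" if t: "t \<in> {0<..<T}" for x t
    proof -
      have "(\<Sum>b\<in>Basis. fb' b (x, t)) = A2 t * (V x * space_laplacian \<phi> (x, t) - \<phi> (x, t) * (\<Sum>b\<in>Basis. r2 b x))"
        by (simp add: fb'_def space_laplacian_def sum_subtractf flip: sum_distrib_left)
      then have "S (x, t) = A t * \<psi> x * time_deriv \<phi> (x, t) + A2 t * V x * space_laplacian \<phi> (x, t) + A2 t * \<psi>2 x * \<phi> (x, t)"
        unfolding laplace by (simp add: S_def f0'_def algebra_simps)
      moreover have "A t * \<psi> x = norm x powr \<sigma>1 * u x t" using u[OF t] by (simp add: A_def \<alpha>_def \<psi>_def)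
      ultimately show ?thesis unfolding um[OF t] by (simp add: \<psi>2_def V_def mult_ac)
    qed
    have S0: "S z = 0" if "z \<notin> K" for z
      using that by (simp add: S_def f0'_def fb'_def z)
    have "(LINT (x, t) : UNIV \<times> {0<..<T} | lebesgue.
             norm x powr \<sigma>1 * u x t * time_deriv \<phi> (x, t)
           + u x t powr m * space_laplacian \<phi> (x, t)
           + norm x powr \<sigma>2 * u x t powr m * \<phi> (x, t)) = integral\<^sup>L lebesgue S"
      unfolding set_lebesgue_integral_def
    proof (rule Bochner_Integration.integral_cong[OF refl])
      fix z :: "'a \<times> real"
      obtain x t where zz: "z = (x, t)" by (cases z)
      show "indicator (UNIV \<times> {0<..<T}) z *\<^sub>R (case z of (x, t) \<Rightarrow> norm x powr \<sigma>1 * u x t * time_deriv \<phi> (x, t)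
           + u x t powr m * space_laplacian \<phi> (x, t) + norm x powr \<sigma>2 * u x t powr m * \<phi> (x, t)) = S z"
      proof (cases "t \<in> {0<..<T}")
        case True
        then show ?thesis using Seq[OF True, of x] by (simp add: zz)
      next
        case False
        then have "z \<notin> K" using K(2) zz by auto
        then show ?thesis using S0 False zz by simp
      qed
    qed
    also have "\<dots> = integral\<^sup>L lborel S" using S(1) by (intro integral_completion) auto
    finally show ?thesis using S(2) by simp
  qed
  show ?thesis unfolding weak_solution_def
  proof (intro conjI allI ballI impI)
    fix x t assume "t \<in> {0<..<T}"
    then show "0 \<le> u x t" by (simp add: u)
  next
    show "locally_integrable T (\<lambda>(x, t). norm x powr \<sigma>1 * u x t)"
      by (rule loc_cong[OF loc[OF c\<psi>, of "- \<alpha>"]]) (auto simp: u \<alpha>_def \<psi>_def)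
    show "locally_integrable T (\<lambda>(x, t). u x t powr m)"
      by (rule loc_cong[OF loc[OF cV, of "- \<alpha> - 1"]]) (auto simp: um A2_def)
    show "locally_integrable T (\<lambda>(x, t). norm x powr \<sigma>2 * u x t powr m)"
      by (rule loc_cong[OF loc[OF c\<psi>2, of "- \<alpha> - 1"]]) (auto simp: um A2_def \<psi>2_def V_def)
  qed (rule weak)
qed

section \<open>The density of the squared norm\<close>

text \<open>The derivative in s of the volume of the n-dimensional ball of radius
  \<open>sqrt s\<close>.\<close>

definition radial_density :: "nat \<Rightarrow> real \<Rightarrow> real" where
  "radial_density n s = (if 0 < s then unit_ball_vol n * (n / 2) * s powr (n / 2 - 1) else 0)"

lemma radial_density_nonneg: "0 \<le> radial_density n s"
  by (simp add: radial_density_def)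

lemma radial_density_measurable[measurable]: "radial_density n \<in> borel_measurable borel"
  unfolding radial_density_def[abs_def] by measurable

lemma radial_density_pos:
  assumes "s > 0" "n > 0"
  shows "0 < radial_density n s"
  using assms unit_ball_vol_pos[of n] by (simp add: radial_density_def)

text \<open>Both measures give the half-line up to a the volume of a ball of radius
  \<open>sqrt a\<close>, and half-lines form an intersection-stable generator of the Borel
  sets.\<close>

lemma distr_inner_self:
  "distr lborel borel (\<lambda>x::'a::euclidean_space. x \<bullet> x) = density lborel (\<lambda>s. ennreal (radial_density DIM('a) s))"
proof (rule measure_eqI_generator_eq[where E = "range (\<lambda>a::real. {..a})" and \<Omega> = UNIV and A = "\<lambda>i. {..real i}"])
  let ?n = "DIM('a)"
  let ?M = "distr lborel borel (\<lambda>x::'a. x \<bullet> x)"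
  let ?N = "density lborel (\<lambda>s. ennreal (radial_density ?n s))"
  show "Int_stable (range (\<lambda>a::real. {..a}))"
    by (auto simp: Int_stable_def)
  have meas: "emeasure ?M {..a} = (if a < 0 then 0 else ennreal (unit_ball_vol ?n * a powr (?n / 2)))" for a
  proof (cases "a < 0")
    case True
    have "{x::'a. x \<bullet> x \<le> a} = {}" using True by (auto simp: not_le intro: less_le_trans[OF _ inner_ge_zero])
    then show ?thesis using True by (simp add: emeasure_distr vimage_def)
  next
    case False
    have "{x::'a. x \<bullet> x \<le> a} = cball 0 (sqrt a)"
      by (auto simp: norm_eq_sqrt_inner)
    moreover have "sqrt a ^ ?n = a powr (?n / 2)"
    proof -
      have "sqrt a ^ ?n = (a powr (1 / 2)) powr real ?n" using False
        by (simp add: powr_half_sqrt powr_realpow')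
      then show ?thesis by (simp add: powr_powr)
    qed
    ultimately show ?thesis using False
      by (simp add: emeasure_distr vimage_def emeasure_cball)
  qed
  show "emeasure ?M X = emeasure ?N X" if X: "X \<in> range (\<lambda>a::real. {..a})" for X
  proof -
    obtain a where a: "X = {..a}" using X by auto
    have "emeasure ?N X = (\<integral>\<^sup>+s. ennreal (radial_density ?n s) * indicator {..a} s \<partial>lborel)"
      unfolding a by (subst emeasure_density) auto
    also have "\<dots> = (if a < 0 then 0 else ennreal (unit_ball_vol ?n * a powr (?n / 2)))"
    proof (cases "a < 0")
      case True
      then have "(\<integral>\<^sup>+s. ennreal (radial_density ?n s) * indicator {..a} s \<partial>lborel) = (\<integral>\<^sup>+s. 0 \<partial>(lborel::real measure))"
        by (intro nn_integral_cong) (auto simp: radial_density_def indicator_def)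
      then show ?thesis using True by simp
    next
      case False
      have I: "((\<lambda>s. radial_density ?n s) has_integral unit_ball_vol ?n * a powr (?n / 2)) {0..a}"
      proof -
        have n: "real ?n / 2 - 1 > - 1" "real ?n > 0" by auto
        have "((\<lambda>s. s powr (?n / 2 - 1)) has_integral a powr (?n / 2) / (?n / 2)) {0..a}"
          using has_integral_powr_from_0[OF n(1), of a] False by simp
        from has_integral_mult_right[OF this, of "unit_ball_vol ?n * (?n / 2)"]
        have "((\<lambda>s. unit_ball_vol ?n * (?n / 2) * s powr (?n / 2 - 1)) has_integral unit_ball_vol ?n * a powr (?n / 2)) {0..a}"
          using n(2) by simp
        then show ?thesis
          by (rule has_integral_eq[rotated]) (auto simp: radial_density_def)
      qed
      have "(\<integral>\<^sup>+s. ennreal (radial_density ?n s) * indicator {..a} s \<partial>lborel)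
          = (\<integral>\<^sup>+s. indicator {0..a} s * ennreal (radial_density ?n s) \<partial>lborel)"
        by (intro nn_integral_cong) (auto simp: radial_density_def indicator_def)
      also have "\<dots> = ennreal (unit_ball_vol ?n * a powr (?n / 2))"
        using nn_integral_has_integral_lebesgue'[OF radial_density_nonneg I]
        by (simp add: nn_integral_completion mult.commute)
      finally show ?thesis using False by simp
    qed
    finally show ?thesis unfolding a meas by simp
  qed
  have b: "sets borel = sigma_sets UNIV (range (\<lambda>a::real. {..a}))"
    by (subst borel_eq_atMost) (simp add: sets_measure_of)
  show "sets ?M = sigma_sets UNIV (range (\<lambda>a::real. {..a}))" using b by simp
  show "sets ?N = sigma_sets UNIV (range (\<lambda>a::real. {..a}))" using b by simp
  show "(\<Union>i. {..real i}) = UNIV"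
    using real_arch_simple by (auto simp: set_eq_iff)
  show "emeasure ?M {..real i} \<noteq> \<infinity>" for i by (simp add: meas)
qed auto

lemma integrable_radial_iff:
  fixes h :: "real \<Rightarrow> real"
  assumes [measurable]: "h \<in> borel_measurable borel"
  shows "integrable lborel (\<lambda>x::'a::euclidean_space. h (x \<bullet> x)) \<longleftrightarrow>
    integrable lborel (\<lambda>s. radial_density DIM('a) s * h s)"
proof -
  have "integrable lborel (\<lambda>x::'a. h (x \<bullet> x)) \<longleftrightarrow> integrable (distr lborel borel (\<lambda>x::'a. x \<bullet> x)) h"
    by (subst integrable_distr_eq) auto
  also have "\<dots> \<longleftrightarrow> integrable lborel (\<lambda>s. radial_density DIM('a) s * h s)"
    unfolding distr_inner_self by (subst integrable_real_density) (auto simp: radial_density_nonneg)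
  finally show ?thesis .
qed

lemma integral_radial:
  fixes h :: "real \<Rightarrow> real"
  assumes [measurable]: "h \<in> borel_measurable borel"
  shows "integral\<^sup>L lborel (\<lambda>x::'a::euclidean_space. h (x \<bullet> x)) = (\<integral>s. radial_density DIM('a) s * h s \<partial>lborel)"
proof -
  have "integral\<^sup>L lborel (\<lambda>x::'a. h (x \<bullet> x)) = integral\<^sup>L (distr lborel borel (\<lambda>x::'a. x \<bullet> x)) h"
    by (subst integral_distr) auto
  also have "\<dots> = (\<integral>s. radial_density DIM('a) s * h s \<partial>lborel)"
    unfolding distr_inner_self by (subst integral_real_density) (auto simp: radial_density_nonneg)
  finally show ?thesis .
qed

lemma null_radial_iff:
  assumes [measurable]: "Z \<in> sets borel"
  shows "emeasure lborel {x::'a::euclidean_space. x \<bullet> x \<in> Z} = 0 \<longleftrightarrow> emeasure lborel (Z \<inter> {0<..}) = 0"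
proof -
  have "emeasure lborel {x::'a. x \<bullet> x \<in> Z} = emeasure (distr lborel borel (\<lambda>x::'a. x \<bullet> x)) Z"
    by (subst emeasure_distr) (auto simp: vimage_def)
  also have "\<dots> = (\<integral>\<^sup>+s. ennreal (radial_density DIM('a) s) * indicator Z s \<partial>lborel)"
    unfolding distr_inner_self by (subst emeasure_density) auto
  also have "\<dots> = 0 \<longleftrightarrow> (AE s in lborel. ennreal (radial_density DIM('a) s) * indicator Z s = 0)"
    by (subst nn_integral_0_iff_AE) auto
  also have "\<dots> \<longleftrightarrow> (AE s in lborel. s \<notin> Z \<inter> {0<..})"
  proof (rule AE_cong)
    fix s :: real
    show "ennreal (radial_density DIM('a) s) * indicator Z s = 0 \<longleftrightarrow> s \<notin> Z \<inter> {0<..}"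
    proof (cases "0 < s")
      case True
      then show ?thesis
        using radial_density_pos[OF True, of "DIM('a)"] by (auto simp: indicator_def ennreal_eq_0_iff)
    qed (simp add: radial_density_def)
  qed
  also have "\<dots> \<longleftrightarrow> emeasure lborel (Z \<inter> {0<..}) = 0"
    by (subst AE_iff_measurable[of "Z \<inter> {0<..}"]) auto
  finally show ?thesis .
qed

text \<open>Inner regularity with errors 1/(j+1). Compact pieces are wanted because a continuous
  image of a compact set is again Borel, which fails for general measurable sets.\<close>

lemma inner_sigma_compact:
  fixes S :: "'b::euclidean_space set"
  assumes "S \<in> sets lebesgue" "bounded S"
  obtains C where "\<And>j::nat. compact (C j)" "\<And>j. C j \<subseteq> S" "S - (\<Union>j. C j) \<in> null_sets lebesgue"
proof -
  have "\<exists>C. \<forall>j::nat. closed (C j) \<and> C j \<subseteq> S \<and> S - C j \<in> lmeasurable \<and> emeasure lebesgue (S - C j) < ennreal (inverse (real (Suc j)))"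
    by (intro choice allI) (metis sets_lebesgue_inner_closed[OF assms(1)] inverse_positive_iff_positive of_nat_0_less_iff zero_less_Suc)
  then obtain C where C: "\<And>j. closed (C j)" "\<And>j. C j \<subseteq> S"
    "\<And>j. emeasure lebesgue (S - C j) < ennreal (inverse (real (Suc j)))" by blast
  have "emeasure lebesgue (S - (\<Union>j. C j)) \<le> ennreal e" if e: "e > 0" for e
  proof -
    obtain j where j: "inverse (real (Suc j)) < e" using reals_Archimedean[OF e] by blast
    have "emeasure lebesgue (S - (\<Union>j. C j)) \<le> emeasure lebesgue (S - C j)"
      using assms(1) C(1)[of j] by (intro emeasure_mono) auto
    also have "\<dots> \<le> ennreal e" using C(3)[of j] j by (meson ennreal_leI less_imp_le order_trans)
    finally show ?thesis .
  qed
  then have "emeasure lebesgue (S - (\<Union>j. C j)) = 0"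
    by (metis ennreal_le_epsilon add_0 le_zero_eq)
  moreover have "S - (\<Union>j. C j) \<in> sets lebesgue" using assms(1) C(1) by auto
  ultimately have "S - (\<Union>j. C j) \<in> null_sets lebesgue" by auto
  moreover have "compact (C j)" for j
    using C(1,2)[of j] assms(2) bounded_subset by (auto simp: compact_eq_bounded_closed)
  ultimately show ?thesis using that C(2) by blast
qed

text \<open>Compact subsets of the preimage have compact image, so inner regularity on \<open>\<real>\<^sup>N \<times> [t1, t2]\<close> passes
  to the radial variable.\<close>

lemma radial_set_measurable:
  fixes E :: "real set" and t1 t2 :: real
  assumes t: "t1 < t2" and E: "E \<subseteq> {0..}"
    and meas: "\<And>n::nat. {z \<in> cball (0::'a::euclidean_space) (real n) \<times> {t1..t2}. fst z \<bullet> fst z \<in> E} \<in> sets lebesgue"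
  shows "E \<in> sets lebesgue"
proof -
  let ?P = "\<lambda>z::'a \<times> real. fst z \<bullet> fst z"
  have "E \<inter> {0..(real n)\<^sup>2} \<in> sets lebesgue" for n :: nat
  proof -
    define K where "K = cball (0::'a) (real n) \<times> {t1..t2}"
    have K: "compact K" unfolding K_def by (intro compact_Times compact_cball compact_Icc)
    define S where "S = {z \<in> K. ?P z \<in> E}"
    define S' where "S' = {z \<in> K. ?P z \<notin> E}"
    have S: "S \<in> sets lebesgue" using meas[of n] by (simp add: S_def K_def)
    have "S' = K - S" by (auto simp: S_def S'_def)
    then have S': "S' \<in> sets lebesgue" using S compact_imp_closed[OF K] by auto
    have bd: "bounded S" "bounded S'"
      using compact_imp_bounded[OF K] by (auto simp: S_def S'_def intro: bounded_subset)
    obtain C where C: "\<And>j::nat. compact (C j)" "\<And>j. C j \<subseteq> S" "S - (\<Union>j. C j) \<in> null_sets lebesgue"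
      using inner_sigma_compact[OF S bd(1)] by blast
    obtain C' where C': "\<And>j::nat. compact (C' j)" "\<And>j. C' j \<subseteq> S'" "S' - (\<Union>j. C' j) \<in> null_sets lebesgue"
      using inner_sigma_compact[OF S' bd(2)] by blast
    define B where "B = (\<Union>j. ?P ` C j)"
    define B' where "B' = (\<Union>j. ?P ` C' j)"
    have cl: "closed (?P ` D)" if "compact D" for D
      using that by (intro compact_imp_closed compact_continuous_image continuous_intros)
    have [measurable]: "B \<in> sets borel" "B' \<in> sets borel"
      unfolding B_def B'_def using cl C(1) C'(1) by (auto intro!: sets.countable_UN)
    have BE: "B \<subseteq> E" and B'E: "B' \<inter> E = {}" using C(2) C'(2) by (force simp: B_def B'_def S_def S'_def)+
    \<comment> \<open>B lies inside E and B' outside, and both are Borel. The undecided gap Z has a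
      null preimage, so by Fubini and the positive radial density it is null itself, apart from the
      point 0.\<close>
    define Z where "Z = {0..(real n)\<^sup>2} - B - B'"
    have [measurable]: "Z \<in> sets borel" unfolding Z_def by auto
    have Zprod: "{z \<in> K. ?P z \<in> Z} = {x::'a. x \<bullet> x \<in> Z} \<times> {t1..t2}"
    proof -
      have "norm x \<le> real n" if "x \<bullet> x \<in> Z" for x :: 'a
      proof -
        have "(norm x)\<^sup>2 \<le> (real n)\<^sup>2" using that by (simp add: Z_def power2_norm_eq_inner)
        then show ?thesis by (rule power2_le_imp_le) simp
      qed
      then show ?thesis by (auto simp: K_def)
    qed
    have "{z \<in> K. ?P z \<in> Z} \<subseteq> (S - (\<Union>j. C j)) \<union> (S' - (\<Union>j. C' j))"
      by (force simp: Z_def B_def B'_def S_def S'_def)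
    moreover have "(S - (\<Union>j. C j)) \<union> (S' - (\<Union>j. C' j)) \<in> null_sets lebesgue"
      using C(3) C'(3) by auto
    ultimately have "{z \<in> K. ?P z \<in> Z} \<in> null_sets lebesgue"
      by (rule null_sets_completion_subset)
    moreover have [measurable]: "{x::'a. x \<bullet> x \<in> Z} \<in> sets borel" by measurable
    then have bor: "{x::'a. x \<bullet> x \<in> Z} \<times> {t1..t2} \<in> sets borel"
      by (intro borel_Times) auto
    ultimately have "emeasure lborel ({x::'a. x \<bullet> x \<in> Z} \<times> {t1..t2}) = 0"
      unfolding Zprod by (auto simp: null_sets_def main_part_sets emeasure_completion)
    then have "emeasure (lborel \<Otimes>\<^sub>M lborel) ({x::'a. x \<bullet> x \<in> Z} \<times> {t1..t2}) = 0"
      by (simp add: lborel_prod)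
    then have "emeasure lborel {x::'a. x \<bullet> x \<in> Z} = 0"
      using t by (subst (asm) lborel.emeasure_pair_measure_Times) auto
    then have "emeasure lborel (Z \<inter> {0<..}) = 0" by (simp add: null_radial_iff)
    then have "Z \<inter> {0<..} \<in> null_sets lebesgue"
      by (intro null_sets_completionI) (auto simp: null_sets_def)
    moreover have "{0::real} \<in> null_sets lebesgue" by (intro null_sets_completionI) (auto simp: null_sets_def)
    ultimately have "Z \<inter> {0<..} \<union> {0} \<in> null_sets lebesgue" by auto
    then have "E \<inter> Z \<in> null_sets lebesgue"
      by (rule null_sets_completion_subset[rotated]) (auto simp: Z_def)
    moreover have "E \<inter> {0..(real n)\<^sup>2} = B \<inter> {0..(real n)\<^sup>2} \<union> (E \<inter> Z)"
      using BE B'E by (auto simp: Z_def)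
    ultimately show ?thesis by auto
  qed
  then have "(\<Union>n. E \<inter> {0..(real n)\<^sup>2}) \<in> sets lebesgue" by (intro sets.countable_UN image_subsetI)
  moreover have "(\<Union>n. E \<inter> {0..(real n)\<^sup>2}) = E"
  proof -
    have "\<exists>n. s \<le> (real n)\<^sup>2" for s
    proof -
      obtain n :: nat where n: "max 1 s \<le> real n" using real_arch_simple by blast
      then have "real n \<le> (real n)\<^sup>2" by (simp add: power2_eq_square)
      then show ?thesis using n by (intro exI[of _ n]) linarith
    qed
    then show ?thesis using E by auto
  qed
  ultimately show ?thesis by simp
qed

lemma AE_radial_lift:
  assumes "AE s in lborel. 0 < s \<longrightarrow> Q s"
  shows "AE x in lborel. (x::'a::euclidean_space) \<noteq> 0 \<longrightarrow> Q (x \<bullet> x)"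
proof -
  obtain Z where Z: "Z \<in> sets lborel" "emeasure lborel Z = 0" "{s. \<not> (0 < s \<longrightarrow> Q s)} \<subseteq> Z"
    using AE_E[OF assms] by auto
  have "emeasure lborel (Z \<inter> {0<..}) = 0"
    using Z(1,2) emeasure_mono[of "Z \<inter> {0<..}" Z lborel] by auto
  then have "emeasure lborel {x::'a. x \<bullet> x \<in> Z} = 0" using Z(1) by (subst null_radial_iff) auto
  moreover have [measurable]: "Z \<in> sets borel" using Z(1) by simp
  have "{x::'a. x \<bullet> x \<in> Z} \<in> sets lborel" by simp
  ultimately have "AE x in lborel. x \<notin> {x::'a. x \<bullet> x \<in> Z}"
    by (intro AE_not_in) (auto simp: null_sets_def)
  moreover have "\<And>x::'a. x \<noteq> 0 \<Longrightarrow> 0 < x \<bullet> x" by simp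
  ultimately show ?thesis
    by (elim eventually_mono) (use Z(3) in blast)
qed

lemma AE_lborel_fst:
  assumes "AE x in lborel. Q (x::'a::euclidean_space)"
  shows "AE z in lborel. Q (fst (z :: 'a \<times> 'b::euclidean_space))"
proof -
  obtain Z where Z: "Z \<in> sets lborel" "emeasure lborel Z = 0" "{x. \<not> Q x} \<subseteq> Z"
    using AE_E[OF assms] by auto
  have "emeasure (lborel \<Otimes>\<^sub>M lborel) (Z \<times> (UNIV :: 'b set)) = 0"
    using Z by (subst lborel.emeasure_pair_measure_Times) auto
  then have "Z \<times> (UNIV :: 'b set) \<in> null_sets lborel"
    using Z(1) by (auto simp: null_sets_def lborel_prod intro!: borel_Times)
  then have "AE z in lborel. z \<notin> Z \<times> (UNIV :: 'b set)" by (rule AE_not_in)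
  then show ?thesis by eventually_elim (use Z(3) in auto)
qed

section \<open>Radial test functions\<close>

text \<open>The chain rule along lines for |x|^2, whose second derivative in a basis direction is 2;
  summing the squares of the coordinates produces the factor |x|^2 in the Laplacian.\<close>

lemma test_function_radial:
  fixes \<phi> :: "'a::euclidean_space \<times> real \<Rightarrow> real"
  assumes d\<zeta>: "\<And>s. (\<zeta> has_real_derivative \<zeta>' s) (at s)" "\<And>s. (\<zeta>' has_real_derivative \<zeta>'' s) (at s)"
    and c\<zeta>'': "continuous_on UNIV \<zeta>''" and \<zeta>0: "\<And>s. s \<ge> S \<Longrightarrow> \<zeta> s = 0"
    and d\<eta>: "\<And>t. (\<eta> has_real_derivative \<eta>' t) (at t)" and c\<eta>': "continuous_on UNIV \<eta>'"
    and \<eta>0: "\<And>t. t \<notin> {ta..tb} \<Longrightarrow> \<eta> t = 0" and t: "0 < ta" "tb < T"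
    and \<phi>: "\<And>x t. \<phi> (x, t) = \<eta> t * \<zeta> (x \<bullet> x)"
  shows "test_function T \<phi>"
    and "time_deriv \<phi> (x, t) = \<eta>' t * \<zeta> (x \<bullet> x)"
    and "space_laplacian \<phi> (x, t) = \<eta> t * (2 * real DIM('a) * \<zeta>' (x \<bullet> x) + 4 * (x \<bullet> x) * \<zeta>'' (x \<bullet> x))"
proof -
  have c\<zeta>: "continuous_on UNIV \<zeta>" "continuous_on UNIV \<zeta>'"
    using DERIV_isCont[OF d\<zeta>(1)] DERIV_isCont[OF d\<zeta>(2)] by (auto intro!: continuous_at_imp_continuous_on)
  have c\<eta>: "continuous_on UNIV \<eta>" using DERIV_isCont[OF d\<eta>] by (auto intro!: continuous_at_imp_continuous_on)
  have cs: "continuous_on UNIV (\<lambda>z::'a \<times> real. f (fst z \<bullet> fst z))" if "continuous_on UNIV f" for f :: "real \<Rightarrow> real"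
  proof -
    have "continuous_on UNIV (\<lambda>z::'a \<times> real. fst z \<bullet> fst z)" by (intro continuous_intros)
    from continuous_on_compose2[OF that this] show ?thesis by simp
  qed
  have ct: "continuous_on UNIV (\<lambda>z::'a \<times> real. f (snd z))" if "continuous_on UNIV f" for f :: "real \<Rightarrow> real"
    by (rule continuous_on_compose2[OF that]) (auto intro: continuous_intros)
  have \<phi>': "\<phi> = (\<lambda>z. \<eta> (snd z) * \<zeta> (fst z \<bullet> fst z))" using \<phi> by (auto simp: fun_eq_iff)
  have dt: "((\<lambda>s. \<phi> (x, s)) has_real_derivative \<eta>' t * \<zeta> (x \<bullet> x)) (at t)" for x t
    unfolding \<phi> by (rule DERIV_cmult_right[OF d\<eta>])
  have td: "time_deriv \<phi> (x, t) = \<eta>' t * \<zeta> (x \<bullet> x)" for x t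
    unfolding time_deriv_def by (simp add: DERIV_imp_deriv[OF dt])
  then have td': "time_deriv \<phi> = (\<lambda>z. \<eta>' (snd z) * \<zeta> (fst z \<bullet> fst z))" by (auto simp: fun_eq_iff)
  have line: "((\<lambda>h. g ((x + h *\<^sub>R b) \<bullet> (x + h *\<^sub>R b))) has_real_derivative g' (x \<bullet> x) * (2 * (x \<bullet> b))) (at 0)"
    if "\<And>s. (g has_real_derivative g' s) (at s)" for g g' and x b :: 'a
    using radial_line_derivative[of g "g' (x \<bullet> x)" x 0 b] that[of "x \<bullet> x"] by simp
  have ds: "((\<lambda>h. \<phi> (x + h *\<^sub>R b, t)) has_real_derivative \<eta> t * (\<zeta>' (x \<bullet> x) * (2 * (x \<bullet> b)))) (at 0)" for x b t
    unfolding \<phi> by (rule DERIV_cmult[OF line[OF d\<zeta>(1)]])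
  have sd: "space_deriv b \<phi> (x, t) = \<eta> t * (\<zeta>' (x \<bullet> x) * (2 * (x \<bullet> b)))" for x b t
    unfolding space_deriv_def by (simp add: DERIV_imp_deriv[OF ds])
  then have sd': "space_deriv b \<phi> = (\<lambda>z. \<eta> (snd z) * (\<zeta>' (fst z \<bullet> fst z) * (2 * (fst z \<bullet> b))))" for b
    by (auto simp: fun_eq_iff)
  have ds2: "((\<lambda>h. space_deriv b \<phi> (x + h *\<^sub>R b, t)) has_real_derivative
      \<eta> t * (2 * \<zeta>' (x \<bullet> x) + 4 * (x \<bullet> b)\<^sup>2 * \<zeta>'' (x \<bullet> x))) (at 0)" if b: "b \<in> Basis" for x b t
  proof -
    have 1: "((\<lambda>h. 2 * ((x + h *\<^sub>R b) \<bullet> b)) has_real_derivative 2) (at 0)"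
      using b by (auto intro!: derivative_eq_intros simp: inner_add_left)
    show ?thesis unfolding sd
      by (rule DERIV_cong[OF DERIV_cmult[OF DERIV_mult[OF line[OF d\<zeta>(2)] 1]]]) (simp add: power2_eq_square)
  qed
  have sd2: "space_deriv b (space_deriv b \<phi>) (x, t) = \<eta> t * (2 * \<zeta>' (x \<bullet> x) + 4 * (x \<bullet> b)\<^sup>2 * \<zeta>'' (x \<bullet> x))"
    if "b \<in> Basis" for x b t
    unfolding space_deriv_def[of b "space_deriv b \<phi>"] by (simp add: DERIV_imp_deriv[OF ds2[OF that]])
  then have sd2': "space_deriv b (space_deriv b \<phi>) =
      (\<lambda>z. \<eta> (snd z) * (2 * \<zeta>' (fst z \<bullet> fst z) + 4 * (fst z \<bullet> b)\<^sup>2 * \<zeta>'' (fst z \<bullet> fst z)))" if "b \<in> Basis" for b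
    using that by (auto simp: fun_eq_iff)
  have "C1_in_space \<phi>"
    unfolding C1_in_space_def sd'
  proof (intro ballI conjI allI)
    show "(\<lambda>h. \<phi> (x + h *\<^sub>R b, t)) differentiable at 0" for x b t
      using ds unfolding real_differentiable_def by blast
    show "continuous_on UNIV (\<lambda>z. \<eta> (snd z) * (\<zeta>' (fst z \<bullet> fst z) * (2 * (fst z \<bullet> b))))" for b :: 'a
      by (intro continuous_on_mult ct[OF c\<eta>] cs[OF c\<zeta>(2)] continuous_intros)
  qed
  moreover have "C1_in_space (space_deriv b \<phi>)" if b: "b \<in> Basis" for b
    unfolding C1_in_space_def
  proof (intro ballI conjI allI)
    fix b' :: 'a assume b': "b' \<in> Basis"
    have 1: "((\<lambda>h. 2 * ((x + h *\<^sub>R b') \<bullet> b)) has_real_derivative 2 * (b' \<bullet> b)) (at 0)" for x :: 'a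
      by (auto intro!: derivative_eq_intros simp: inner_add_left)
    have d: "((\<lambda>h. space_deriv b \<phi> (x + h *\<^sub>R b', t)) has_real_derivative
      \<eta> t * (\<zeta>'' (x \<bullet> x) * (2 * (x \<bullet> b')) * (2 * (x \<bullet> b)) + 2 * (b' \<bullet> b) * \<zeta>' (x \<bullet> x))) (at 0)" for x t
      unfolding sd
      by (rule DERIV_cong[OF DERIV_cmult[OF DERIV_mult[OF line[OF d\<zeta>(2)] 1]]]) simp
    then show "(\<lambda>h. space_deriv b \<phi> (x + h *\<^sub>R b', t)) differentiable at 0" for x t
      unfolding real_differentiable_def by blast
    have "space_deriv b' (space_deriv b \<phi>) (x, t) =
        \<eta> t * (\<zeta>'' (x \<bullet> x) * (2 * (x \<bullet> b')) * (2 * (x \<bullet> b)) + 2 * (b' \<bullet> b) * \<zeta>' (x \<bullet> x))" for x t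
      unfolding space_deriv_def[of b' "space_deriv b \<phi>"] by (simp add: DERIV_imp_deriv[OF d])
    then have e: "space_deriv b' (space_deriv b \<phi>) = (\<lambda>z. \<eta> (snd z) * (\<zeta>'' (fst z \<bullet> fst z) * (2 * (fst z \<bullet> b')) * (2 * (fst z \<bullet> b))
        + 2 * (b' \<bullet> b) * \<zeta>' (fst z \<bullet> fst z)))" by (auto simp: fun_eq_iff)
    show "continuous_on UNIV (space_deriv b' (space_deriv b \<phi>))" unfolding e
      by (intro continuous_on_mult continuous_on_add ct[OF c\<eta>] cs[OF c\<zeta>(2)] cs[OF c\<zeta>''] continuous_intros)
  qed
  moreover have "C1_in_time \<phi>"
    unfolding C1_in_time_def td'
  proof (intro conjI allI)
    show "(\<lambda>s. \<phi> (x, s)) differentiable at t" for x t using dt unfolding real_differentiable_def by blast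
    show "continuous_on UNIV (\<lambda>z::'a \<times> real. \<eta>' (snd z) * \<zeta> (fst z \<bullet> fst z))"
      by (intro continuous_on_mult ct[OF c\<eta>'] cs[OF c\<zeta>(1)])
  qed
  moreover have "continuous_on UNIV \<phi>" unfolding \<phi>' by (intro continuous_on_mult ct[OF c\<eta>] cs[OF c\<zeta>(1)])
  moreover have "\<exists>K. compact K \<and> K \<subseteq> UNIV \<times> {0<..<T} \<and> (\<forall>z. z \<notin> K \<longrightarrow> \<phi> z = 0)"
  proof (intro exI[of _ "cball 0 (sqrt (max S 0)) \<times> {ta..tb}"] conjI allI impI)
    show "compact (cball (0::'a) (sqrt (max S 0)) \<times> {ta..tb})"
      by (intro compact_Times compact_cball compact_Icc)
    show "cball (0::'a) (sqrt (max S 0)) \<times> {ta..tb} \<subseteq> UNIV \<times> {0<..<T}" using t by auto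
    fix z :: "'a \<times> real" assume z: "z \<notin> cball 0 (sqrt (max S 0)) \<times> {ta..tb}"
    show "\<phi> z = 0"
    proof (cases "snd z \<in> {ta..tb}")
      case True
      then have "sqrt (max S 0) < norm (fst z)" using z by (cases z) auto
      then have "S < fst z \<bullet> fst z" by (simp add: norm_eq_sqrt_inner)
      then show ?thesis by (simp add: \<phi>' \<zeta>0)
    qed (simp add: \<phi>' \<eta>0)
  qed
  ultimately show "test_function T \<phi>" unfolding test_function_def by blast
  show "time_deriv \<phi> (x, t) = \<eta>' t * \<zeta> (x \<bullet> x)" by (rule td)
  have "space_laplacian \<phi> (x, t) = (\<Sum>b\<in>Basis. \<eta> t * (2 * \<zeta>' (x \<bullet> x) + 4 * (x \<bullet> b)\<^sup>2 * \<zeta>'' (x \<bullet> x)))"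
    unfolding space_laplacian_def by (intro sum.cong refl sd2)
  also have "\<dots> = \<eta> t * (2 * real DIM('a) * \<zeta>' (x \<bullet> x) + 4 * (\<Sum>b\<in>Basis. (x \<bullet> b)\<^sup>2) * \<zeta>'' (x \<bullet> x))"
    by (simp add: sum.distrib sum_distrib_left[symmetric] sum_distrib_right[symmetric] mult_ac)
  finally show "space_laplacian \<phi> (x, t) = \<eta> t * (2 * real DIM('a) * \<zeta>' (x \<bullet> x) + 4 * (x \<bullet> x) * \<zeta>'' (x \<bullet> x))"
    by (simp add: sum_inner_Basis_square)
qed

section \<open>Reduction of space-time integrals to the radial variable\<close>

lemma integrable_product:
  fixes a :: "'a::euclidean_space \<Rightarrow> real" and b :: "real \<Rightarrow> real"
  assumes a: "integrable lborel a" and b: "integrable lborel b"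
  shows "integrable lborel (\<lambda>z::'a \<times> real. a (fst z) * b (snd z))"
    and "integral\<^sup>L lborel (\<lambda>z::'a \<times> real. a (fst z) * b (snd z)) = integral\<^sup>L lborel a * integral\<^sup>L lborel b"
proof -
  have [measurable]: "a \<in> borel_measurable borel" "b \<in> borel_measurable borel" using a b by auto
  have I: "integrable (lborel \<Otimes>\<^sub>M lborel) (\<lambda>z::'a \<times> real. a (fst z) * b (snd z))"
  proof (rule lborel_pair.Fubini_integrable)
    show "(\<lambda>z::'a \<times> real. a (fst z) * b (snd z)) \<in> borel_measurable (lborel \<Otimes>\<^sub>M lborel)" by measurable
    show "integrable lborel (\<lambda>x. LINT y|lborel. norm (a (fst (x, y)) * b (snd (x, y))))"
      using a by (simp add: abs_mult)
    show "AE x in lborel. integrable lborel (\<lambda>y. a (fst (x, y)) * b (snd (x, y)))"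
      using b by simp
  qed
  then show "integrable lborel (\<lambda>z::'a \<times> real. a (fst z) * b (snd z))" by (simp add: lborel_prod)
  have "integral\<^sup>L (lborel \<Otimes>\<^sub>M lborel) (\<lambda>z::'a \<times> real. a (fst z) * b (snd z))
      = (LINT x|lborel. LINT y|lborel. a (fst (x, y)) * b (snd (x, y)))"
    by (rule lborel_pair.integral_fst'[OF I, symmetric])
  then show "integral\<^sup>L lborel (\<lambda>z::'a \<times> real. a (fst z) * b (snd z)) = integral\<^sup>L lborel a * integral\<^sup>L lborel b"
    by (simp add: lborel_prod)
qed

text \<open>The time factor is bounded below on the slab and can be divided out; Fubini in time and
  the density of |x|^2 then leave a one-dimensional function.\<close>

lemma radial_local_integrability:
  fixes f :: "'a::euclidean_space \<times> real \<Rightarrow> real" and h A :: "real \<Rightarrow> real"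
  assumes f: "f absolutely_integrable_on (cball 0 R \<times> {t1..t2})" and t: "t1 < t2" and R: "R \<ge> 0"
    and [measurable]: "h \<in> borel_measurable borel" "A \<in> borel_measurable borel"
    and a0: "a0 > 0" "\<And>t. t \<in> {t1..t2} \<Longrightarrow> a0 \<le> A t"
    and eq: "AE z in lborel. snd z \<in> {t1..t2} \<longrightarrow> f z = A (snd z) * h (fst z \<bullet> fst z)"
  shows "integrable lborel (\<lambda>s. radial_density DIM('a) s * (indicator {..R\<^sup>2} s * h s))"
proof -
  let ?K = "cball (0::'a) R \<times> {t1..t2}"
  have [measurable]: "?K \<in> sets borel" by (intro borel_Times) auto
  define J where "J = (\<lambda>z. indicator ?K z * (A (snd z) * h (fst z \<bullet> fst z)))"
  define J2 where "J2 = (\<lambda>z. indicator ?K z * h (fst z \<bullet> fst z))"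
  have [measurable]: "(\<lambda>z::'a \<times> real. A (snd z)) \<in> borel_measurable borel"
    "(\<lambda>z::'a \<times> real. h (fst z \<bullet> fst z)) \<in> borel_measurable borel"
  proof -
    have "(\<lambda>z::'a \<times> real. snd z) \<in> borel_measurable borel" "(\<lambda>z::'a \<times> real. fst z \<bullet> fst z) \<in> borel_measurable borel"
      by (intro borel_measurable_continuous_onI continuous_intros)+
    then show "(\<lambda>z::'a \<times> real. A (snd z)) \<in> borel_measurable borel"
      "(\<lambda>z::'a \<times> real. h (fst z \<bullet> fst z)) \<in> borel_measurable borel"
      using assms(4,5) by (auto intro: measurable_compose)
  qed
  have [measurable]: "J \<in> borel_measurable borel" "J2 \<in> borel_measurable borel"
    unfolding J_def J2_def by measurable
  have i: "integrable lebesgue (\<lambda>z. indicator ?K z *\<^sub>R f z)" using f by (simp add: set_integrable_def)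
  have "AE z in lebesgue. indicator ?K z *\<^sub>R f z = J z"
    using AE_completion[OF eq] by eventually_elim (auto simp: J_def indicator_def)
  then have "integrable lebesgue J"
    by (intro integrable_cong_AE_imp[OF i]) (auto intro!: measurable_completion)
  then have J: "integrable lborel J" by (subst (asm) integrable_completion) auto
  have "integrable lborel J2"
  proof (rule Bochner_Integration.integrable_bound[OF integrable_mult_right[OF J, of "1 / a0"]])
    show "AE z in lborel. norm (J2 z) \<le> norm (1 / a0 * J z)"
    proof (intro always_eventually allI)
      fix z :: "'a \<times> real"
      show "norm (J2 z) \<le> norm (1 / a0 * J z)"
      proof (cases "z \<in> ?K")
        case True
        then have "snd z \<in> {t1..t2}" by auto
        then have A: "a0 \<le> A (snd z)" by (rule a0)
        then have "\<bar>h (fst z \<bullet> fst z)\<bar> * 1 \<le> \<bar>h (fst z \<bullet> fst z)\<bar> * (A (snd z) / a0)"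
          using a0(1) by (intro mult_left_mono) auto
        then show ?thesis using True A a0(1) by (simp add: J_def J2_def abs_mult mult_ac)
      qed (simp add: J2_def)
    qed
  qed simp
  then have "integrable (lborel \<Otimes>\<^sub>M lborel) J2" by (simp add: lborel_prod)
  then have "integrable lborel (\<lambda>x. LINT t|lborel. J2 (x, t))" by (rule lborel_pair.integrable_fst')
  moreover have "(LINT t|lborel. J2 (x, t)) = (t2 - t1) * (indicator {..R\<^sup>2} (x \<bullet> x) * h (x \<bullet> x))" for x
  proof -
    have "norm x \<le> R \<longleftrightarrow> x \<bullet> x \<le> R\<^sup>2"
      using R abs_le_square_iff[of "norm x" R] by (simp add: power2_norm_eq_inner)
    then have "J2 (x, t) = (indicator {..R\<^sup>2} (x \<bullet> x) * h (x \<bullet> x)) * indicator {t1..t2} t" for t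
      by (auto simp: J2_def indicator_def)
    then show ?thesis using t by simp
  qed
  ultimately have "integrable lborel (\<lambda>x::'a. indicator {..R\<^sup>2} (x \<bullet> x) * h (x \<bullet> x))" using t by simp
  then show ?thesis
    using integrable_radial_iff[of "\<lambda>s. indicator {..R\<^sup>2} s * h s", where 'a = 'a] by simp
qed

lemma integrable_weighted_mult:
  fixes h c :: "real \<Rightarrow> real"
  assumes I: "integrable lborel (\<lambda>s. radial_density n s * (indicator {..S} s * h s))"
    and [measurable]: "h \<in> borel_measurable borel" and c: "continuous_on UNIV c" "\<And>s. s > S \<Longrightarrow> c s = 0"
  shows "integrable lborel (\<lambda>s. radial_density n s * (h s * c s))"
proof -
  have [measurable]: "c \<in> borel_measurable borel" using c(1) by (rule borel_measurable_continuous_onI)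
  have "bounded (c ` {0..S})"
    by (intro compact_imp_bounded compact_continuous_image continuous_on_subset[OF c(1)]) auto
  then obtain M where M: "M > 0" "\<And>s. s \<in> {0..S} \<Longrightarrow> \<bar>c s\<bar> \<le> M" unfolding bounded_pos by auto
  show ?thesis
  proof (rule Bochner_Integration.integrable_bound[OF integrable_mult_right[OF I, of M]])
    show "AE s in lborel. norm (radial_density n s * (h s * c s)) \<le> norm (M * (radial_density n s * (indicator {..S} s * h s)))"
    proof (intro always_eventually allI)
      fix s
      show "norm (radial_density n s * (h s * c s)) \<le> norm (M * (radial_density n s * (indicator {..S} s * h s)))"
      proof (cases "s \<in> {0..S}")
        case True
        have "\<bar>radial_density n s * h s\<bar> * \<bar>c s\<bar> \<le> \<bar>radial_density n s * h s\<bar> * M"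
          using M(2)[OF True] by (intro mult_left_mono) auto
        then show ?thesis using True M(1) by (simp add: abs_mult mult_ac)
      next
        case False
        then have "radial_density n s = 0 \<or> c s = 0" using c(2)[of s] by (auto simp: radial_density_def)
        then show ?thesis by auto
      qed
    qed
  qed simp
qed

text \<open>The equation satisfied by \<open>G(|x|\<^sup>2) = F(|x|)\<^sup>m\<close>, tested with radial functions \<open>\<zeta>(|x|\<^sup>2)\<close>; the Laplacian of
  \<open>\<zeta>(|x|\<^sup>2)\<close> is \<open>2 n \<zeta>' + 4 s \<zeta>''\<close> at \<open>s = |x|\<^sup>2\<close>.\<close>

definition weak_profile :: "nat \<Rightarrow> real \<Rightarrow> real \<Rightarrow> real \<Rightarrow> real \<Rightarrow> (real \<Rightarrow> real) \<Rightarrow> bool" where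
  "weak_profile n \<sigma>1 \<sigma>2 \<alpha> q G \<longleftrightarrow> G \<in> borel_measurable borel \<and> (\<forall>s. 0 \<le> G s) \<and>
     (\<forall>R\<ge>0. integrable lborel (\<lambda>s. radial_density n s * (indicator {..R\<^sup>2} s * (s powr (\<sigma>1 / 2) * G s powr q)))) \<and>
     (\<forall>R\<ge>0. integrable lborel (\<lambda>s. radial_density n s * (indicator {..R\<^sup>2} s * G s))) \<and>
     (\<forall>R\<ge>0. integrable lborel (\<lambda>s. radial_density n s * (indicator {..R\<^sup>2} s * (s powr (\<sigma>2 / 2) * G s)))) \<and>
     (\<forall>\<zeta> \<zeta>1 \<zeta>2 S. (\<forall>s. (\<zeta> has_real_derivative \<zeta>1 s) (at s)) \<longrightarrow> (\<forall>s. (\<zeta>1 has_real_derivative \<zeta>2 s) (at s)) \<longrightarrow>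
       continuous_on UNIV \<zeta>2 \<longrightarrow> (\<forall>s\<ge>S. \<zeta> s = 0) \<longrightarrow> (\<forall>s\<ge>S. \<zeta>1 s = 0) \<longrightarrow> (\<forall>s\<ge>S. \<zeta>2 s = 0) \<longrightarrow>
       (LINT s|lborel. radial_density n s * (G s * (2 * real n * \<zeta>1 s + 4 * s * \<zeta>2 s)
         + s powr (\<sigma>2 / 2) * G s * \<zeta> s - \<alpha> * (s powr (\<sigma>1 / 2) * G s powr q) * \<zeta> s)) = 0)"

text \<open>For a test function \<eta>(t) \<zeta>(|x|^2) the weak formulation factorises. Since the
  time integrals satisfy \<integral> A \<eta>' = - \<alpha> \<integral> A2 \<eta>, and the latter is
  nonzero, the time factor cancels. Before that, F^m has to be replaced by a Borel function, its
  measurability being inherited from u^m.\<close>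

lemma radial_identity:
  fixes u :: "'a::euclidean_space \<Rightarrow> real \<Rightarrow> real" and F :: "real \<Rightarrow> real"
  assumes m: "m > 1" and T: "T > 0" and weak: "weak_solution m \<sigma>1 \<sigma>2 T u"
    and F: "\<And>r. r \<ge> 0 \<Longrightarrow> 0 \<le> F r"
    and u: "\<And>x t. t \<in> {0<..<T} \<Longrightarrow> u x t = (T - t) powr (- (1 / (m - 1))) * F (norm x)"
  obtains G where "weak_profile DIM('a) \<sigma>1 \<sigma>2 (1 / (m - 1)) (1 / m) G"
    "AE s in lebesgue. 0 \<le> s \<longrightarrow> F (sqrt s) powr m = G s"
proof -
  define \<alpha> where "\<alpha> = 1 / (m - 1)"
  have \<alpha>: "\<alpha> > 0" "m * \<alpha> = \<alpha> + 1" using m by (auto simp: \<alpha>_def field_simps)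
  define A where "A = (\<lambda>t. (T - t) powr (- \<alpha>))"
  define A2 where "A2 = (\<lambda>t. (T - t) powr (- \<alpha> - 1))"
  define t1 where "t1 = T / 3"
  define t2 where "t2 = 2 * T / 3"
  have t: "0 < t1" "t1 < t2" "t2 < T" using T by (auto simp: t1_def t2_def)
  have tsub: "{t1..t2} \<subseteq> {0<..<T}" using t by auto
  define g where "g = (\<lambda>s. if 0 \<le> s then F (sqrt s) powr m else 0)"
  have g0: "0 \<le> g s" for s by (simp add: g_def)
  have Fg: "F (norm x) = g (x \<bullet> x) powr (1 / m)" for x :: 'a
    using m F[of "norm x"] by (simp add: g_def powr_powr norm_eq_sqrt_inner)
  have uA: "u x t = A t * g (x \<bullet> x) powr (1 / m)" if "t \<in> {0<..<T}" for x t
    using u[OF that] by (simp add: A_def \<alpha>_def Fg)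
  have uA2: "u x t powr m = A2 t * g (x \<bullet> x)" if "t \<in> {0<..<T}" for x t
  proof -
    have "u x t powr m = ((T - t) powr (- \<alpha>)) powr m * (g (x \<bullet> x) powr (1 / m)) powr m"
      using that by (simp add: uA A_def powr_mult)
    also have "((T - t) powr (- \<alpha>)) powr m = A2 t" using \<alpha>(2) by (simp add: powr_powr A2_def mult.commute)
    also have "(g (x \<bullet> x) powr (1 / m)) powr m = g (x \<bullet> x)" using m g0 by (simp add: powr_powr)
    finally show ?thesis .
  qed
  have loc: "(\<lambda>(x, t). norm x powr \<sigma>1 * u x t) absolutely_integrable_on (cball 0 R \<times> {t1..t2})"
    "(\<lambda>(x, t). u x t powr m) absolutely_integrable_on (cball 0 R \<times> {t1..t2})"
    "(\<lambda>(x, t). norm x powr \<sigma>2 * u x t powr m) absolutely_integrable_on (cball 0 R \<times> {t1..t2})" for R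
  proof -
    have "compact (cball (0::'a) R \<times> {t1..t2})" "cball (0::'a) R \<times> {t1..t2} \<subseteq> UNIV \<times> {0<..<T}"
      using tsub by (auto intro!: compact_Times)
    then show "(\<lambda>(x, t). norm x powr \<sigma>1 * u x t) absolutely_integrable_on (cball 0 R \<times> {t1..t2})"
      "(\<lambda>(x, t). u x t powr m) absolutely_integrable_on (cball 0 R \<times> {t1..t2})"
      "(\<lambda>(x, t). norm x powr \<sigma>2 * u x t powr m) absolutely_integrable_on (cball 0 R \<times> {t1..t2})"
      using weak unfolding weak_solution_def locally_integrable_def by blast+
  qed
  have Am[measurable]: "A \<in> borel_measurable borel" "A2 \<in> borel_measurable borel"
    unfolding A_def A2_def by measurable
  have gm: "g \<in> borel_measurable lebesgue"
  proof (subst borel_measurable_iff_greater, rule allI)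
    fix c :: real
    show "{s \<in> space lebesgue. c < g s} \<in> sets lebesgue"
    proof (cases "c < 0")
      case True
      then have "{s \<in> space lebesgue. c < g s} = UNIV" using g0 by (auto intro: less_le_trans)
      then show ?thesis by simp
    next
      case False
      have "{s. c < g s} \<in> sets lebesgue"
      proof (rule radial_set_measurable[OF t(2)])
        show "{s. c < g s} \<subseteq> {0..}" using False by (auto simp: g_def split: if_splits)
        fix n :: nat
        let ?K = "cball (0::'a) (real n) \<times> {t1..t2}"
        \<comment> \<open>The factor undoes the time dependence of u^m, so the superlevel sets of ?f
          are cylinders over those of g(|x|^2).\<close>
        let ?f = "\<lambda>z::'a \<times> real. (T - snd z) powr (\<alpha> + 1) * (indicator ?K z *\<^sub>R (case z of (x, t) \<Rightarrow> u x t powr m))"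
        have "(\<lambda>z. indicator ?K z *\<^sub>R (case z of (x, t) \<Rightarrow> u x t powr m)) \<in> borel_measurable lebesgue"
          using loc(2)[of "real n"] unfolding set_integrable_def by (rule borel_measurable_integrable)
        moreover have "(\<lambda>z::'a \<times> real. (T - snd z) powr (\<alpha> + 1)) \<in> borel_measurable lebesgue"
        proof (rule measurable_completion)
          have "(\<lambda>z::'a \<times> real. (T - snd z)) \<in> borel_measurable borel"
            by (intro borel_measurable_continuous_onI continuous_intros)
          then show "(\<lambda>z::'a \<times> real. (T - snd z) powr (\<alpha> + 1)) \<in> borel_measurable lborel" by simp
        qed
        ultimately have "?f \<in> borel_measurable lebesgue" by (intro borel_measurable_times)
        then have "{z \<in> space lebesgue. c < ?f z} \<in> sets lebesgue"
          by (simp only: borel_measurable_iff_greater)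
        moreover have "{z \<in> space lebesgue. c < ?f z} = {z \<in> ?K. fst z \<bullet> fst z \<in> {s. c < g s}}"
        proof -
          have 1: "?f z = g (fst z \<bullet> fst z)" if "z \<in> ?K" for z
          proof -
            obtain x t where z: "z = (x, t)" by (cases z)
            have tt: "t \<in> {0<..<T}" using that tsub z by auto
            have "(T - t) powr (\<alpha> + 1) * A2 t = 1"
              using tt by (simp add: A2_def flip: powr_add)
            then have "(T - t) powr (\<alpha> + 1) * (A2 t * g (x \<bullet> x)) = g (x \<bullet> x)"
              by (simp flip: mult.assoc)
            then show ?thesis using that by (simp add: z uA2[OF tt, of x])
          qed
          show ?thesis
          proof (rule set_eqI)
            fix z
            show "z \<in> {z \<in> space lebesgue. c < ?f z} \<longleftrightarrow> z \<in> {z \<in> ?K. fst z \<bullet> fst z \<in> {s. c < g s}}"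
            proof (cases "z \<in> ?K")
              case True
              then show ?thesis unfolding mem_Collect_eq 1[OF True] by simp
            next
              case F: False
              then have "?f z = 0" by (simp only: indicator_simps scaleR_zero_left mult_zero_right not_False_eq_True)
              then show ?thesis using F False unfolding mem_Collect_eq by simp
            qed
          qed
        qed
        ultimately show "{z \<in> ?K. fst z \<bullet> fst z \<in> {s. c < g s}} \<in> sets lebesgue" by simp
      qed
      then show ?thesis by simp
    qed
  qed
  obtain G0 where G0: "G0 \<in> borel_measurable lborel" "AE s in lborel. g s = G0 s"
    using completion_ex_borel_measurable_real[OF gm] by blast
  define G where "G = (\<lambda>s. \<bar>G0 s\<bar>)"
  have Gm[measurable]: "G \<in> borel_measurable borel" using G0(1) unfolding G_def by simp
  have Gnn: "0 \<le> G s" for s by (simp add: G_def)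
  have gG: "AE s in lborel. g s = G s"
    using G0(2)
  proof eventually_elim
    case (elim s)
    then show ?case using g0[of s] by (simp add: G_def)
  qed
  have AEz: "AE z in lborel. g (fst (z :: 'a \<times> real) \<bullet> fst z) = G (fst z \<bullet> fst z)"
  proof -
    have "AE x in lborel. (x::'a) \<noteq> 0 \<longrightarrow> g (x \<bullet> x) = G (x \<bullet> x)"
      using gG by (intro AE_radial_lift) auto
    moreover have "AE x in lborel. (x::'a) \<noteq> 0" by (rule AE_lborel_singleton)
    ultimately have "AE x in lborel. g (x \<bullet> x) = G ((x::'a) \<bullet> x)" by eventually_elim auto
    then show ?thesis by (rule AE_lborel_fst)
  qed
  have a0: "T powr (- b) \<le> (T - t) powr (- b)" if "b \<ge> 0" "t \<in> {t1..t2}" for b t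
    using that tsub by (intro powr_mono2') auto
  have hm[measurable]: "(\<lambda>s. s powr (\<sigma>1 / 2) * G s powr (1 / m)) \<in> borel_measurable borel"
    "(\<lambda>s. s powr (\<sigma>2 / 2) * G s) \<in> borel_measurable borel" by measurable
  have I1: "integrable lborel (\<lambda>s. radial_density DIM('a) s * (indicator {..R\<^sup>2} s * (s powr (\<sigma>1 / 2) * G s powr (1 / m))))"
    if "R \<ge> 0" for R
  proof (rule radial_local_integrability[OF loc(1) t(2) that hm(1) Am(1), of "T powr (- \<alpha>)"])
    show "T powr (- \<alpha>) \<le> A t" if "t \<in> {t1..t2}" for t
      unfolding A_def using that \<alpha> by (intro a0) auto
    show "AE z in lborel. snd z \<in> {t1..t2} \<longrightarrow> (case z of (x, t) \<Rightarrow> norm x powr \<sigma>1 * u x t) =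
       A (snd z) * ((fst z \<bullet> fst z) powr (\<sigma>1 / 2) * G (fst z \<bullet> fst z) powr (1 / m))"
      using AEz by eventually_elim (use tsub in \<open>auto simp: uA norm_powr_eq_inner split: prod.splits\<close>)
  qed (use T in auto)
  have I2: "integrable lborel (\<lambda>s. radial_density DIM('a) s * (indicator {..R\<^sup>2} s * G s))"
    if "R \<ge> 0" for R
  proof (rule radial_local_integrability[OF loc(2) t(2) that Gm Am(2), of "T powr (- (\<alpha> + 1))"])
    show "T powr (- (\<alpha> + 1)) \<le> A2 t" if "t \<in> {t1..t2}" for t
      using that \<alpha> a0[of "\<alpha> + 1" t] by (simp add: A2_def)
    show "AE z in lborel. snd z \<in> {t1..t2} \<longrightarrow> (case z of (x, t) \<Rightarrow> u x t powr m) = A2 (snd z) * G (fst z \<bullet> fst z)"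
      using AEz by eventually_elim (use tsub in \<open>auto simp: uA2 split: prod.splits\<close>)
  qed (use T in auto)
  have I3: "integrable lborel (\<lambda>s. radial_density DIM('a) s * (indicator {..R\<^sup>2} s * (s powr (\<sigma>2 / 2) * G s)))"
    if "R \<ge> 0" for R
  proof (rule radial_local_integrability[OF loc(3) t(2) that hm(2) Am(2), of "T powr (- (\<alpha> + 1))"])
    show "T powr (- (\<alpha> + 1)) \<le> A2 t" if "t \<in> {t1..t2}" for t
      using that \<alpha> a0[of "\<alpha> + 1" t] by (simp add: A2_def)
    show "AE z in lborel. snd z \<in> {t1..t2} \<longrightarrow> (case z of (x, t) \<Rightarrow> norm x powr \<sigma>2 * u x t powr m) =
       A2 (snd z) * ((fst z \<bullet> fst z) powr (\<sigma>2 / 2) * G (fst z \<bullet> fst z))"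
      using AEz by eventually_elim (use tsub in \<open>auto simp: uA2 norm_powr_eq_inner split: prod.splits\<close>)
  qed (use T in auto)
  \<comment> \<open>A bump on [t1, t2]; squaring the positive part makes it continuously
    differentiable.\<close>
  define \<eta> where "\<eta> = (\<lambda>t. max ((t - t1) * (t2 - t)) 0 powr 2)"
  define \<eta>1 where "\<eta>1 = (\<lambda>t. 2 * max ((t - t1) * (t2 - t)) 0 * ((t2 - t) - (t - t1)))"
  have d\<eta>: "(\<eta> has_real_derivative \<eta>1 t) (at t)" for t
  proof -
    have "((\<lambda>t. (t - t1) * (t2 - t)) has_real_derivative (t2 - t) - (t - t1)) (at t)"
      by (auto intro!: derivative_eq_intros)
    from DERIV_chain2[OF DERIV_max_powr[of 2] this] show ?thesis by (simp add: \<eta>_def \<eta>1_def)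
  qed
  have c\<eta>1: "continuous_on UNIV \<eta>1" unfolding \<eta>1_def by (intro continuous_intros)
  have c\<eta>: "continuous_on UNIV \<eta>" using DERIV_isCont[OF d\<eta>] by (auto intro!: continuous_at_imp_continuous_on)
  have \<eta>0: "\<eta> s = 0" "\<eta>1 s = 0" if "s \<notin> {t1..t2}" for s
  proof -
    have "(s - t1) * (t2 - s) \<le> 0" using that t by (cases "s < t1") (auto intro: mult_nonpos_nonneg mult_nonneg_nonpos)
    then show "\<eta> s = 0" "\<eta>1 s = 0" by (auto simp: \<eta>_def \<eta>1_def max_absorb2)
  qed
  have \<eta>pos: "\<eta> s > 0" if "s \<in> {t1<..<t2}" for s using that by (simp add: \<eta>_def)
  have cA: "continuous_on {..<T} A" "continuous_on {..<T} A2"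
    unfolding A_def A2_def by (auto intro!: continuous_intros)
  have K: "{t1..t2} \<subseteq> {..<T}" using t by auto
  define \<tau>1 where "\<tau>1 = (\<lambda>t. A t * \<eta>1 t)"
  define \<tau>2 where "\<tau>2 = (\<lambda>t. A2 t * \<eta> t)"
  have c\<tau>: "continuous_on {..<T} \<tau>1" "continuous_on {..<T} \<tau>2" "continuous_on {..<T} (\<lambda>t. A t * \<eta> t)"
    unfolding \<tau>1_def \<tau>2_def using c\<eta> c\<eta>1
    by (auto intro!: continuous_on_mult cA intro: continuous_on_subset)
  have i\<tau>: "integrable lborel \<tau>1" "integrable lborel \<tau>2"
    using c\<tau> \<eta>0 K
    by (auto intro!: integrable_continuous_compact_support[where K = "{t1..t2}"]
        continuous_on_zero_extension[where U = "{..<T}" and K = "{t1..t2}"] simp: \<tau>1_def \<tau>2_def)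
  \<comment> \<open>Integration by parts in time, with A' = \<alpha> A2.\<close>
  have rel: "integral\<^sup>L lborel \<tau>1 = - \<alpha> * integral\<^sup>L lborel \<tau>2"
  proof -
    have "integral\<^sup>L lborel (\<lambda>t. \<alpha> * \<tau>2 t + \<tau>1 t) = 0"
    proof (rule integral_directional_derivative(2)[where f = "\<lambda>t. A t * \<eta> t" and U = "{..<T}" and K = "{t1..t2}" and v = "1::real"])
      fix z assume z: "z \<in> {..<T}"
      have "((\<lambda>h. T - (z + h)) has_real_derivative - 1) (at 0)" by (auto intro!: derivative_eq_intros)
      from DERIV_fun_powr[OF this, of "- \<alpha>"] z
      have 1: "((\<lambda>h. A (z + h)) has_real_derivative \<alpha> * A2 z) (at 0)" by (auto simp: A_def A2_def)
      have "(\<eta> has_real_derivative \<eta>1 z) (at (0 + z))" using d\<eta>[of z] by simp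
      then have 2: "((\<lambda>h. \<eta> (z + h)) has_real_derivative \<eta>1 z) (at 0)"
        by (subst (asm) DERIV_shift) (simp add: add.commute)
      show "((\<lambda>h. A (z + h *\<^sub>R 1) * \<eta> (z + h *\<^sub>R 1)) has_real_derivative \<alpha> * \<tau>2 z + \<tau>1 z) (at 0)"
        using DERIV_mult[OF 1 2] by (simp add: \<tau>1_def \<tau>2_def mult_ac)
    qed (use c\<tau> K \<eta>0 in \<open>auto simp: \<tau>1_def \<tau>2_def intro!: continuous_intros\<close>)
    then show ?thesis using i\<tau> by simp
  qed
  have c_pos: "integral\<^sup>L lborel \<tau>2 \<noteq> 0"
  proof
    assume "integral\<^sup>L lborel \<tau>2 = 0"
    moreover have "AE t in lborel. 0 \<le> \<tau>2 t" by (simp add: \<tau>2_def A2_def \<eta>_def)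
    ultimately have "AE t in lborel. \<tau>2 t = 0" using integral_nonneg_eq_0_iff_AE[OF i\<tau>(2)] by blast
    then have "AE s in lborel. s \<notin> {t1<..<t2}"
      by eventually_elim (use \<eta>pos t in \<open>force simp: \<tau>2_def A2_def\<close>)
    then have "{t1<..<t2} \<in> null_sets lborel" by (subst AE_iff_null_sets) auto
    then show False using t by (simp add: null_sets_def)
  qed
  have ident: "(LINT s|lborel. radial_density DIM('a) s * (G s * (2 * real DIM('a) * \<zeta>1 s + 4 * s * \<zeta>2 s)
         + s powr (\<sigma>2 / 2) * G s * \<zeta> s - 1 / (m - 1) * (s powr (\<sigma>1 / 2) * G s powr (1 / m)) * \<zeta> s)) = 0"
    if d\<zeta>: "\<And>s. (\<zeta> has_real_derivative \<zeta>1 s) (at s)" "\<And>s. (\<zeta>1 has_real_derivative \<zeta>2 s) (at s)"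
      and c\<zeta>2: "continuous_on UNIV \<zeta>2" and \<zeta>0: "\<And>s. s \<ge> S \<Longrightarrow> \<zeta> s = 0" "\<And>s. s \<ge> S \<Longrightarrow> \<zeta>1 s = 0" "\<And>s. s \<ge> S \<Longrightarrow> \<zeta>2 s = 0"
    for \<zeta> \<zeta>1 \<zeta>2 S
  proof -
    have c\<zeta>: "continuous_on UNIV \<zeta>" "continuous_on UNIV \<zeta>1"
      using DERIV_isCont[OF d\<zeta>(1)] DERIV_isCont[OF d\<zeta>(2)] by (auto intro!: continuous_at_imp_continuous_on)
    have [measurable]: "\<zeta> \<in> borel_measurable borel" "\<zeta>1 \<in> borel_measurable borel" "\<zeta>2 \<in> borel_measurable borel"
      using c\<zeta> c\<zeta>2 by (auto intro: borel_measurable_continuous_onI)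
    define R where "R = sqrt (max S 0)"
    have R: "R \<ge> 0" "R\<^sup>2 \<ge> S" by (auto simp: R_def)
    define a where "a = (\<lambda>s. (s powr (\<sigma>1 / 2) * G s powr (1 / m)) * \<zeta> s)"
    define b where "b = (\<lambda>s. G s * (2 * real DIM('a) * \<zeta>1 s + 4 * s * \<zeta>2 s) + (s powr (\<sigma>2 / 2) * G s) * \<zeta> s)"
    have [measurable]: "a \<in> borel_measurable borel" "b \<in> borel_measurable borel" unfolding a_def b_def by measurable
    have ia: "integrable lborel (\<lambda>s. radial_density DIM('a) s * a s)"
      unfolding a_def by (rule integrable_weighted_mult[OF I1[OF R(1)] _ c\<zeta>(1)]) (use \<zeta>0 R in auto)
    have "integrable lborel (\<lambda>s. radial_density DIM('a) s * (G s * (2 * real DIM('a) * \<zeta>1 s + 4 * s * \<zeta>2 s)))"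
      by (rule integrable_weighted_mult[OF I2[OF R(1)] Gm]) (use \<zeta>0 R c\<zeta> c\<zeta>2 in \<open>auto intro!: continuous_intros\<close>)
    moreover have "integrable lborel (\<lambda>s. radial_density DIM('a) s * ((s powr (\<sigma>2 / 2) * G s) * \<zeta> s))"
      by (rule integrable_weighted_mult[OF I3[OF R(1)] _ c\<zeta>(1)]) (use \<zeta>0 R in auto)
    ultimately have ib: "integrable lborel (\<lambda>s. radial_density DIM('a) s * b s)"
      unfolding b_def distrib_left[of "radial_density _ _"] by (rule Bochner_Integration.integrable_add)
    have ia': "integrable lborel (\<lambda>x::'a. a (x \<bullet> x))" and ib': "integrable lborel (\<lambda>x::'a. b (x \<bullet> x))"
      using ia ib by (auto simp: integrable_radial_iff)
    define \<phi> where "\<phi> = (\<lambda>z::'a \<times> real. \<eta> (snd z) * \<zeta> (fst z \<bullet> fst z))"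
    have \<phi>: "\<phi> (x, t) = \<eta> t * \<zeta> (x \<bullet> x)" for x t by (simp add: \<phi>_def)
    note tf0 = test_function_radial[where \<zeta> = \<zeta> and \<zeta>' = \<zeta>1 and \<zeta>'' = \<zeta>2 and \<eta> = \<eta> and \<eta>' = \<eta>1
        and S = S and ta = t1 and tb = t2 and T = T and \<phi> = \<phi>, OF d\<zeta> c\<zeta>2 \<zeta>0(1) d\<eta> c\<eta>1 \<eta>0(1) t(1) t(3) \<phi>]
    have tf: "test_function T \<phi>"
      "time_deriv \<phi> (x, t) = \<eta>1 t * \<zeta> (x \<bullet> x)"
      "space_laplacian \<phi> (x, t) = \<eta> t * (2 * real DIM('a) * \<zeta>1 (x \<bullet> x) + 4 * (x \<bullet> x) * \<zeta>2 (x \<bullet> x))" for x t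
      by (rule tf0(1), assumption+) (rule tf0(2) tf0(3), assumption+)+
    define \<Xi> where "\<Xi> = (\<lambda>z::'a \<times> real. a (fst z \<bullet> fst z) * \<tau>1 (snd z) + b (fst z \<bullet> fst z) * \<tau>2 (snd z))"
    note P1 = integrable_product[OF ia' i\<tau>(1)] and P2 = integrable_product[OF ib' i\<tau>(2)]
    have \<Xi>: "integrable lborel \<Xi>" unfolding \<Xi>_def by (intro Bochner_Integration.integrable_add P1 P2)
    let ?I = "\<lambda>(x, t). norm x powr \<sigma>1 * u x t * time_deriv \<phi> (x, t) + u x t powr m * space_laplacian \<phi> (x, t)
           + norm x powr \<sigma>2 * u x t powr m * \<phi> (x, t)"
    have eqI: "AE z in lebesgue. indicator (UNIV \<times> {0<..<T}) z *\<^sub>R ?I z = \<Xi> z"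
      using AE_completion[OF AEz]
    proof eventually_elim
      case (elim z)
      obtain x t where z: "z = (x, t)" by (cases z)
      show ?case
      proof (cases "t \<in> {0<..<T}")
        case True
        have e1: "u x t powr m = A2 t * G (x \<bullet> x)" and e2: "u x t = A t * G (x \<bullet> x) powr (1 / m)"
          using uA2[OF True, of x] uA[OF True, of x] elim by (simp_all add: z)
        have "?I (x, t) = \<Xi> (x, t)"
          unfolding prod.case e1 tf(2)[of x t] tf(3)[of x t] unfolding e2
          by (simp add: \<phi> \<Xi>_def a_def b_def \<tau>1_def \<tau>2_def norm_powr_eq_inner algebra_simps)
        then show ?thesis using True by (simp add: z)
      next
        case False
        then have "t \<notin> {t1..t2}" using tsub by auto
        then have "\<tau>1 t = 0" "\<tau>2 t = 0" by (auto simp: \<tau>1_def \<tau>2_def \<eta>0)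
        then show ?thesis using False by (simp add: z \<Xi>_def)
      qed
    qed
    have \<Xi>m: "\<Xi> \<in> borel_measurable lebesgue" using \<Xi> by (intro measurable_completion borel_measurable_integrable)
    have "0 = (LINT z : UNIV \<times> {0<..<T} | lebesgue. ?I z)"
      using weak tf(1) unfolding weak_solution_def by simp
    also have "\<dots> = integral\<^sup>L lebesgue \<Xi>"
      unfolding set_lebesgue_integral_def
    proof (rule integral_cong_AE)
      show "(\<lambda>z. indicator (UNIV \<times> {0<..<T}) z *\<^sub>R ?I z) \<in> borel_measurable lebesgue"
        by (rule borel_measurable_AE[OF \<Xi>m]) (use eqI in \<open>auto elim: eventually_mono\<close>)
    qed (use eqI \<Xi>m in auto)
    also have "\<dots> = integral\<^sup>L lborel \<Xi>" using \<Xi> by (intro integral_completion) auto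
    also have "\<dots> = integral\<^sup>L lborel (\<lambda>x::'a. a (x \<bullet> x)) * integral\<^sup>L lborel \<tau>1 + integral\<^sup>L lborel (\<lambda>x::'a. b (x \<bullet> x)) * integral\<^sup>L lborel \<tau>2"
      unfolding \<Xi>_def by (subst Bochner_Integration.integral_add[OF P1(1) P2(1)]) (simp only: P1(2) P2(2))
    finally have "(integral\<^sup>L lborel (\<lambda>x::'a. b (x \<bullet> x)) - \<alpha> * integral\<^sup>L lborel (\<lambda>x::'a. a (x \<bullet> x))) * integral\<^sup>L lborel \<tau>2 = 0"
      unfolding rel by (auto simp: algebra_simps)
    then have "integral\<^sup>L lborel (\<lambda>x::'a. b (x \<bullet> x)) - \<alpha> * integral\<^sup>L lborel (\<lambda>x::'a. a (x \<bullet> x)) = 0"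
      using c_pos by simp
    then have "(LINT s|lborel. radial_density DIM('a) s * b s) - (LINT s|lborel. \<alpha> * (radial_density DIM('a) s * a s)) = 0"
      by (simp add: integral_radial)
    then have "(LINT s|lborel. radial_density DIM('a) s * b s - \<alpha> * (radial_density DIM('a) s * a s)) = 0"
      using ia ib by (subst Bochner_Integration.integral_diff) auto
    moreover have "radial_density DIM('a) s * b s - \<alpha> * (radial_density DIM('a) s * a s) =
      radial_density DIM('a) s * (G s * (2 * real DIM('a) * \<zeta>1 s + 4 * s * \<zeta>2 s)
         + s powr (\<sigma>2 / 2) * G s * \<zeta> s - 1 / (m - 1) * (s powr (\<sigma>1 / 2) * G s powr (1 / m)) * \<zeta> s)" for s
      unfolding a_def b_def \<alpha>_def by algebra
    ultimately show ?thesis by simp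
  qed
  have AEF: "AE s in lebesgue. 0 \<le> s \<longrightarrow> F (sqrt s) powr m = G s"
    using AE_completion[OF gG] by eventually_elim (auto simp: g_def)
  have "weak_profile DIM('a) \<sigma>1 \<sigma>2 (1 / (m - 1)) (1 / m) G"
    unfolding weak_profile_def
  proof (intro conjI allI impI)
    fix \<zeta> \<zeta>1 \<zeta>2 :: "real \<Rightarrow> real" and S :: real
    assume "\<forall>s. (\<zeta> has_real_derivative \<zeta>1 s) (at s)" "\<forall>s. (\<zeta>1 has_real_derivative \<zeta>2 s) (at s)"
      "continuous_on UNIV \<zeta>2" "\<forall>s\<ge>S. \<zeta> s = 0" "\<forall>s\<ge>S. \<zeta>1 s = 0" "\<forall>s\<ge>S. \<zeta>2 s = 0"
    then show "(LINT s|lborel. radial_density DIM('a) s * (G s * (2 * real DIM('a) * \<zeta>1 s + 4 * s * \<zeta>2 s)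
         + s powr (\<sigma>2 / 2) * G s * \<zeta> s - 1 / (m - 1) * (s powr (\<sigma>1 / 2) * G s powr (1 / m)) * \<zeta> s)) = 0"
      by (intro ident[where S = S]) auto
  qed (rule Gm Gnn I1 I2 I3; assumption)+
  then show ?thesis using AEF by (rule that)
qed

section \<open>The fundamental lemma of the calculus of variations\<close>

text \<open>On a fixed compact interval the sets over which g integrates to 0 contain the half-lines
  and are closed under complements and disjoint unions, so they include all Borel sets; then g is a
  zero density. A countable exhaustion of (0, \<infinity>) finishes.\<close>

lemma AE_zero_of_interval_integrals:
  fixes g :: "real \<Rightarrow> real"
  assumes int: "\<And>l S. 0 < l \<Longrightarrow> integrable lborel (\<lambda>s. indicator {l..S} s * g s)"
    and zero: "\<And>a b. 0 < a \<Longrightarrow> a \<le> b \<Longrightarrow> (LINT s|lborel. indicator {a..b} s * g s) = 0"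
  shows "AE s in lborel. 0 < s \<longrightarrow> g s = 0"
proof -
  have "AE s in lborel. indicator {inverse (real (Suc n))..real (Suc n)} s * g s = 0" for n
  proof -
    define l where "l = inverse (real (Suc n))"
    define S where "S = real (Suc n)"
    have lS: "0 < l" "l \<le> S" by (auto simp: l_def S_def field_simps)
    define f where "f = (\<lambda>s. indicator {l..S} s * g s)"
    have f: "integrable lborel f" unfolding f_def by (rule int[OF lS(1)])
    have set_int: "set_integrable lborel A f" if "A \<in> sets borel" for A
      unfolding set_integrable_def using f that by (intro integrable_mult_indicator) auto
    have f0: "integral\<^sup>L lborel f = 0" unfolding f_def by (rule zero[OF lS])
    have IS: "Int_stable (range (\<lambda>a::real. {..a}))" "range (\<lambda>a::real. {..a}) \<subseteq> Pow UNIV"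
      by (auto simp: Int_stable_def)
    have "(LINT s:A|lborel. f s) = 0" if "A \<in> sigma_sets UNIV (range (\<lambda>a::real. {..a}))" for A
      using IS that
    proof (induction A rule: sigma_sets_induct_disjoint)
      case (basic A)
      then obtain a where A: "A = {..a}" by auto
      have "indicator A s *\<^sub>R f s = indicator {l..min a S} s * g s" for s
        by (auto simp: A f_def indicator_def)
      then have "(LINT s:A|lborel. f s) = (LINT s|lborel. indicator {l..min a S} s * g s)"
        by (simp add: set_lebesgue_integral_def)
      also have "\<dots> = 0"
        using zero[OF lS(1), of "min a S"] by (cases "l \<le> min a S") auto
      finally show ?case .
    next
      case (compl A)
      then have A: "A \<in> sets borel" by (subst borel_eq_atMost) simp
      have "(LINT s:UNIV - A|lborel. f s) + (LINT s:A|lborel. f s) = (LINT s:(UNIV - A) \<union> A|lborel. f s)"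
        using A by (intro set_integral_Un[symmetric] set_int) auto
      moreover have "(UNIV - A) \<union> A = UNIV" by auto
      ultimately show ?case using compl.IH f0 by (simp add: set_lebesgue_integral_def)
    next
      case (union A)
      then have A: "A i \<in> sets borel" for i by (subst borel_eq_atMost) auto
      have "(LINT s:(\<Union>i. A i)|lborel. f s) = (\<Sum>i. (LINT s:A i|lborel. f s))"
        using A union(1) by (intro lebesgue_integral_countable_add set_int) (auto simp: disjoint_family_on_def)
      then show ?case using union.IH by simp
    qed (simp add: set_lebesgue_integral_def)
    then have "(LINT s:A|lborel. f s) = (LINT s:A|lborel. 0)" if "A \<in> sets lborel" for A
      using that by (simp add: borel_eq_atMost set_lebesgue_integral_def)
    then have "AE s in lborel. f s = 0"
      by (intro density_unique_real[OF f]) auto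
    then show ?thesis by (simp add: f_def l_def S_def)
  qed
  then have "AE s in lborel. \<forall>n. indicator {inverse (real (Suc n))..real (Suc n)} s * g s = 0"
    unfolding AE_all_countable by (rule allI)
  then show ?thesis
  proof eventually_elim
    case (elim s)
    show ?case
    proof
      assume s: "0 < s"
      obtain n1 where n1: "inverse (real (Suc n1)) < s" using reals_Archimedean[OF s] by blast
      obtain n2 :: nat where n2: "s \<le> real n2" using real_arch_simple by blast
      define n where "n = max n1 n2"
      have "inverse (real (Suc n)) \<le> inverse (real (Suc n1))"
        by (intro le_imp_inverse_le) (auto simp: n_def)
      moreover have "s \<le> real (Suc n)" using n2 by (simp add: n_def)
      ultimately have "s \<in> {inverse (real (Suc n))..real (Suc n)}" using n1 unfolding atLeastAtMost_iff by linarith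
      then show "g s = 0" using elim[rule_format, of n] by simp
    qed
  qed
qed

lemma integrable_mult_compact_support:
  fixes g \<rho> :: "real \<Rightarrow> real"
  assumes g: "integrable lborel (\<lambda>s. indicator {l..S} s * g s)"
    and \<rho>: "continuous_on UNIV \<rho>" "\<And>s. s \<notin> {l..S} \<Longrightarrow> \<rho> s = 0"
  shows "integrable lborel (\<lambda>s. g s * \<rho> s)"
proof -
  have "bounded (\<rho> ` {l..S})"
    by (intro compact_imp_bounded compact_continuous_image continuous_on_subset[OF \<rho>(1)]) auto
  then obtain M where M: "M > 0" "\<And>s. s \<in> {l..S} \<Longrightarrow> \<bar>\<rho> s\<bar> \<le> M" unfolding bounded_pos by auto
  have eq: "g s * \<rho> s = (indicator {l..S} s * g s) * \<rho> s" for s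
    using \<rho>(2)[of s] by (auto simp: indicator_def)
  have [measurable]: "\<rho> \<in> borel_measurable borel" using \<rho>(1) by (rule borel_measurable_continuous_onI)
  show ?thesis unfolding eq
  proof (rule Bochner_Integration.integrable_bound[OF integrable_mult_right[OF g, of M]])
    show "(\<lambda>s. indicator {l..S} s * g s * \<rho> s) \<in> borel_measurable lborel"
      using borel_measurable_integrable[OF g] by measurable
    show "AE s in lborel. norm (indicator {l..S} s * g s * \<rho> s) \<le> norm (M * (indicator {l..S} s * g s))"
    proof (intro always_eventually allI)
      fix s
      show "norm (indicator {l..S} s * g s * \<rho> s) \<le> norm (M * (indicator {l..S} s * g s))"
      proof (cases "s \<in> {l..S}")
        case True
        have "\<bar>g s\<bar> * \<bar>\<rho> s\<bar> \<le> \<bar>g s\<bar> * M" using M(2)[OF True] by (intro mult_left_mono) auto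
        then show ?thesis using True M(1) by (simp add: abs_mult mult.commute)
      qed simp
    qed
  qed
qed

text \<open>Subtracting a multiple of one fixed bump makes every test function mean-zero, so g - C
  annihilates all of them. Continuous trapezoids decreasing to indicators of intervals transfer this
  to interval integrals.\<close>

lemma du_Bois_Reymond:
  fixes g :: "real \<Rightarrow> real"
  assumes int: "\<And>l S. 0 < l \<Longrightarrow> integrable lborel (\<lambda>s. indicator {l..S} s * g s)"
    and test: "\<And>\<rho> l S. 0 < l \<Longrightarrow> l < S \<Longrightarrow> continuous_on UNIV \<rho> \<Longrightarrow> (\<And>s. s \<notin> {l..S} \<Longrightarrow> \<rho> s = 0) \<Longrightarrow>
      integral\<^sup>L lborel \<rho> = 0 \<Longrightarrow> (LINT s|lborel. g s * \<rho> s) = 0"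
  shows "\<exists>C. AE s in lborel. 0 < s \<longrightarrow> g s = C"
proof -
  define \<rho>0 where "\<rho>0 = (\<lambda>s::real. max 0 (1 - \<bar>s - 2\<bar>))"
  have c0: "continuous_on UNIV \<rho>0" unfolding \<rho>0_def by (intro continuous_intros)
  have z0: "\<rho>0 s = 0" if "s \<notin> {1..3}" for s using that by (auto simp: \<rho>0_def)
  have i0: "integrable lborel \<rho>0" by (rule integrable_continuous_compact_support[OF c0, of "{1..3}"]) (use z0 in auto)
  define J where "J = integral\<^sup>L lborel \<rho>0"
  have J: "J \<noteq> 0"
  proof
    assume "J = 0"
    moreover have "AE s in lborel. 0 \<le> \<rho>0 s" by (simp add: \<rho>0_def)
    ultimately have "AE s in lborel. \<rho>0 s = 0" using integral_nonneg_eq_0_iff_AE[OF i0] by (simp add: J_def)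
    then have "AE s in lborel. s \<notin> {1<..<3::real}"
      by eventually_elim (auto simp: \<rho>0_def max_def abs_if split: if_splits)
    then have "{1<..<3::real} \<in> null_sets lborel" by (subst AE_iff_null_sets) auto
    then show False by (simp add: null_sets_def)
  qed
  define C where "C = (LINT s|lborel. g s * \<rho>0 s) / J"
  have key: "(LINT s|lborel. (g s - C) * \<rho> s) = 0"
    if l: "0 < l" and \<rho>: "continuous_on UNIV \<rho>" "\<And>s. s \<notin> {l..S} \<Longrightarrow> \<rho> s = 0" for \<rho> l S
  proof -
    have i\<rho>: "integrable lborel \<rho>" by (rule integrable_continuous_compact_support[OF \<rho>(1), of "{l..S}"]) (use \<rho>(2) in auto)
    have ig: "integrable lborel (\<lambda>s. g s * \<rho> s)" "integrable lborel (\<lambda>s. g s * \<rho>0 s)"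
      using integrable_mult_compact_support[OF int[OF l] \<rho>] integrable_mult_compact_support[OF int[of 1] c0 z0] by auto
    define R where "R = integral\<^sup>L lborel \<rho>"
    have "(LINT s|lborel. g s * (\<rho> s - R / J * \<rho>0 s)) = 0"
    proof (rule test[of "min l 1" "max S 3"])
      show "continuous_on UNIV (\<lambda>s. \<rho> s - R / J * \<rho>0 s)" by (intro continuous_intros \<rho>(1) c0)
      show "\<rho> s - R / J * \<rho>0 s = 0" if "s \<notin> {min l 1..max S 3}" for s
      proof -
        have "\<rho> s = 0" using that by (intro \<rho>(2)) auto
        moreover have "\<rho>0 s = 0" using that by (intro z0) auto
        ultimately show ?thesis by simp
      qed
      show "(LINT s|lborel. \<rho> s - R / J * \<rho>0 s) = 0"
        using i\<rho> i0 J by (simp add: R_def J_def)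
    qed (use l in auto)
    moreover have "(LINT s|lborel. g s * (\<rho> s - R / J * \<rho>0 s)) = (LINT s|lborel. g s * \<rho> s) - R / J * (LINT s|lborel. g s * \<rho>0 s)"
    proof -
      have "(LINT s|lborel. g s * (\<rho> s - R / J * \<rho>0 s)) = (LINT s|lborel. g s * \<rho> s - R / J * (g s * \<rho>0 s))"
        by (intro Bochner_Integration.integral_cong) (auto simp: algebra_simps)
      then show ?thesis using ig by simp
    qed
    moreover have "(LINT s|lborel. (g s - C) * \<rho> s) = (LINT s|lborel. g s * \<rho> s) - C * R"
      using ig i\<rho> by (simp add: left_diff_distrib R_def)
    ultimately show ?thesis by (simp add: C_def)
  qed
  have "AE s in lborel. 0 < s \<longrightarrow> g s - C = 0"
  proof (rule AE_zero_of_interval_integrals)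
    show int': "integrable lborel (\<lambda>s. indicator {l..S} s * (g s - C))" if "0 < l" for l S
    proof -
      have "integrable lborel (\<lambda>s. indicator {l..S} s * g s - C * indicator {l..S} s)"
        by (intro Bochner_Integration.integrable_diff int[OF that] integrable_mult_right integrable_real_indicator)
          (auto simp: emeasure_lborel_Icc_eq)
      moreover have "indicator {l..S} s * g s - C * indicator {l..S} s = indicator {l..S} s * (g s - C)" for s
        by (simp add: indicator_def)
      ultimately show ?thesis by simp
    qed
    fix a b :: real assume ab: "0 < a" "a \<le> b"
    obtain N :: nat where N: "2 / a \<le> real N" using real_arch_simple by blast
    \<comment> \<open>Trapezoids equal to 1 on [a, b]. The choice of N makes their flanks at least
      2/a steep, so all supports lie in [a/2, b + 1], away from 0.\<close>
    define \<rho> where "\<rho> = (\<lambda>n s. max 0 (1 - real (Suc (N + n)) * max 0 (max (a - s) (s - b))))"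
    have z: "\<rho> n s = 0" if "s \<notin> {a/2..b + 1}" for n s
    proof -
      have N': "real (Suc (N + n)) \<ge> 2 / a" "real (Suc (N + n)) \<ge> 1" using N by auto
      consider "s < a / 2" | "s > b + 1" using \<open>s \<notin> _\<close> by fastforce
      then have "real (Suc (N + n)) * max 0 (max (a - s) (s - b)) \<ge> 1"
      proof cases
        case 1
        have "2 / a * (a / 2) \<le> real (Suc (N + n)) * max 0 (max (a - s) (s - b))"
          using 1 ab N' by (intro mult_mono) auto
        then show ?thesis using ab by simp
      next
        case 2
        have "1 * 1 \<le> real (Suc (N + n)) * max 0 (max (a - s) (s - b))"
          using 2 ab N' by (intro mult_mono) auto
        then show ?thesis by simp
      qed
      then show ?thesis by (simp add: \<rho>_def)
    qed
    have c: "continuous_on UNIV (\<rho> n)" for n unfolding \<rho>_def by (intro continuous_intros)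
    have b01: "0 \<le> \<rho> n s" "\<rho> n s \<le> 1" for n s by (auto simp: \<rho>_def)
    have "(\<lambda>n. LINT s|lborel. (g s - C) * \<rho> n s) \<longlonglongrightarrow> (LINT s|lborel. (g s - C) * indicator {a..b} s)"
    proof (rule integral_dominated_convergence[where w = "\<lambda>s. \<bar>indicator {a/2..b + 1} s * (g s - C)\<bar>"])
      show "integrable lborel (\<lambda>s. \<bar>indicator {a/2..b + 1} s * (g s - C)\<bar>)"
        using int'[of "a/2" "b + 1"] ab by simp
      show "(\<lambda>s. (g s - C) * \<rho> n s) \<in> borel_measurable lborel" for n
        using integrable_mult_compact_support[OF int'[of "a/2" "b + 1"] c[of n] z] ab by (intro borel_measurable_integrable) simp
      show "(\<lambda>s. (g s - C) * indicator {a..b} s) \<in> borel_measurable lborel"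
        using int'[OF ab(1), of b] by (simp add: mult.commute borel_measurable_integrable)
      show "AE s in lborel. norm ((g s - C) * \<rho> n s) \<le> \<bar>indicator {a/2..b + 1} s * (g s - C)\<bar>" for n
      proof (intro always_eventually allI)
        fix s show "norm ((g s - C) * \<rho> n s) \<le> \<bar>indicator {a/2..b + 1} s * (g s - C)\<bar>"
          using z[of s n] b01[of n s] by (cases "s \<in> {a/2..b + 1}") (auto simp: abs_mult mult_left_le)
      qed
      show "AE s in lborel. (\<lambda>n. (g s - C) * \<rho> n s) \<longlonglongrightarrow> (g s - C) * indicator {a..b} s"
      proof (intro always_eventually allI tendsto_mult tendsto_const)
        fix s
        show "(\<lambda>n. \<rho> n s) \<longlonglongrightarrow> indicator {a..b} s"
        proof (cases "s \<in> {a..b}")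
          case True
          then have "\<rho> n s = 1" for n by (auto simp: \<rho>_def max_def)
          then show ?thesis using True by simp
        next
          case False
          define d where "d = max (a - s) (s - b)"
          have d: "d > 0" using False by (auto simp: d_def)
          obtain M :: nat where M: "1 / d \<le> real M" using real_arch_simple by blast
          have "\<rho> n s = 0" if "n \<ge> M" for n
          proof -
            have "real M \<le> real (Suc (N + n))" using that by simp
            then have "1 / d \<le> real (Suc (N + n))" using M by linarith
            then have "1 \<le> real (Suc (N + n)) * d" using d by (simp only: pos_divide_le_eq)
            then show ?thesis using d unfolding \<rho>_def d_def[symmetric] by (simp add: max_absorb2)
          qed
          then have "\<forall>\<^sub>F n in sequentially. \<rho> n s = 0" unfolding eventually_sequentially by blast
          then show ?thesis using False by (simp add: tendsto_eventually)
        qed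
      qed
    qed
    moreover have "(LINT s|lborel. (g s - C) * \<rho> n s) = 0" for n
      by (rule key[where l = "a / 2" and S = "b + 1", OF _ c z]) (use ab in auto)
    ultimately have "(LINT s|lborel. (g s - C) * indicator {a..b} s) = 0"
      using LIMSEQ_unique[OF _ tendsto_const] by force
    then show "(LINT s|lborel. indicator {a..b} s * (g s - C)) = 0" by (simp add: mult.commute)
  qed
  then show ?thesis by auto
qed

text \<open>For s < l the integral over the empty interval is 0 by convention, which agrees with the
  primitive because g vanishes there.\<close>

lemma primitive_from_left:
  fixes g :: "real \<Rightarrow> real"
  assumes g: "continuous_on UNIV g" "\<And>s. s \<le> l \<Longrightarrow> g s = 0"
  shows "((\<lambda>s. integral {l..s} g) has_real_derivative g s) (at s)"
proof -
  define a where "a = min l s - 1"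
  have eq: "integral {l..t} g = integral {a..t} g" if "a < t" for t
  proof (cases "l \<le> t")
    case True
    have "integral {a..l} g + integral {l..t} g = integral {a..t} g"
      using True by (intro Henstock_Kurzweil_Integration.integral_combine integrable_continuous_real continuous_on_subset[OF g(1)])
        (auto simp: a_def)
    moreover have "integral {a..l} g = integral {a..l} (\<lambda>_. 0)"
      by (intro Henstock_Kurzweil_Integration.integral_cong) (use g(2) in auto)
    ultimately show ?thesis by simp
  next
    case False
    have "integral {a..t} g = integral {a..t} (\<lambda>_. 0)"
      by (intro Henstock_Kurzweil_Integration.integral_cong) (use g(2) False in auto)
    then show ?thesis using False by simp
  qed
  have "((\<lambda>t. integral {a..t} g) has_real_derivative g s) (at s within {a..s + 1})"
    by (intro integral_has_real_derivative continuous_on_subset[OF g(1)]) (auto simp: a_def)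
  then have d: "((\<lambda>t. integral {a..t} g) has_real_derivative g s) (at s)"
    by (subst (asm) at_within_Icc_at) (auto simp: a_def)
  have "\<forall>\<^sub>F t in nhds s. a < t" by (intro eventually_nhds_in_open[of "{a<..}", simplified]) (auto simp: a_def)
  then have "\<forall>\<^sub>F t in nhds s. integral {l..t} g = integral {a..t} g" by eventually_elim (rule eq)
  then show ?thesis using d by (subst DERIV_cong_ev[OF refl _ refl])
qed

lemma primitive_on_positive_reals:
  fixes g :: "real \<Rightarrow> real"
  assumes g: "continuous_on {0<..} g"
  obtains W where "\<And>s. s > 0 \<Longrightarrow> (W has_real_derivative g s) (at s)"
proof
  \<comment> \<open>Integrals over empty intervals are 0, so the difference is the oriented integral
    from 1 to s on both sides of 1.\<close>
  define W where "W = (\<lambda>s. integral {1..s} g - integral {s..1} g)"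
  fix s :: real assume s: "s > 0"
  define a where "a = min s 1 / 2"
  have a: "0 < a" "a < s" "a < 1" using s by (auto simp: a_def)
  have int: "g integrable_on {x..y}" if "a \<le> x" for x y
    using that a by (intro integrable_continuous_real continuous_on_subset[OF g]) auto
  have eq: "W t = integral {a..t} g - integral {a..1} g" if t: "a < t" for t
  proof (cases "1 \<le> t")
    case True
    then have "integral {a..1} g + integral {1..t} g = integral {a..t} g"
      using a by (intro Henstock_Kurzweil_Integration.integral_combine int) auto
    moreover have "integral {t..1} g = 0" using True by (cases "t = 1") auto
    ultimately show ?thesis by (simp add: W_def)
  next
    case False
    then have "integral {a..t} g + integral {t..1} g = integral {a..1} g"
      using t by (intro Henstock_Kurzweil_Integration.integral_combine int) auto
    then show ?thesis using False by (simp add: W_def)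
  qed
  have "((\<lambda>t. integral {a..t} g) has_real_derivative g s) (at s within {a..s + 1})"
    using a by (intro integral_has_real_derivative continuous_on_subset[OF g]) auto
  then have "((\<lambda>t. integral {a..t} g) has_real_derivative g s) (at s)"
    using a by (subst (asm) at_within_Icc_at) auto
  from DERIV_diff[OF this DERIV_const]
  have d: "((\<lambda>t. integral {a..t} g - integral {a..1} g) has_real_derivative g s) (at s)" by simp
  have "\<forall>\<^sub>F t in nhds s. a < t" using a by (intro eventually_nhds_in_open[of "{a<..}", simplified]) auto
  then have "\<forall>\<^sub>F t in nhds s. W t = integral {a..t} g - integral {a..1} g" by eventually_elim (rule eq)
  then show "(W has_real_derivative g s) (at s)" using d by (subst DERIV_cong_ev[OF refl _ refl])
qed

lemma integral_lborel_eq_integral_Icc: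
  fixes f :: "real \<Rightarrow> real"
  assumes "continuous_on {l..S} f" "\<And>s. s \<notin> {l..S} \<Longrightarrow> h s = 0" "\<And>s. s \<in> {l..S} \<Longrightarrow> h s = f s"
  shows "integrable lborel h" "integral\<^sup>L lborel h = integral {l..S} f"
proof -
  have "integrable lborel (\<lambda>s. indicator {l..S} s *\<^sub>R f s)" using assms(1) by (intro borel_integrable_compact) auto
  moreover have h: "(\<lambda>s. indicator {l..S} s *\<^sub>R f s) = h" using assms(2,3) by (auto simp: indicator_def fun_eq_iff)
  ultimately show "integrable lborel h" by simp
  have "set_integrable lborel {l..S} f" using \<open>integrable lborel (\<lambda>s. indicator {l..S} s *\<^sub>R f s)\<close> by (simp add: set_integrable_def)
  from set_borel_integral_eq_integral(2)[OF this] show "integral\<^sup>L lborel h = integral {l..S} f"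
    by (simp only: set_lebesgue_integral_def h)
qed

section \<open>From weak solutions to profiles\<close>

context radial_profile begin

text \<open>Two integrations of the equation give a function W with (s^k W')' = s^k source(s, G).
  The weak identity says that G - W annihilates mean-zero test functions, so it is constant almost
  everywhere. The continuous representative of G then makes the source continuous and the
  derivatives classical.\<close>

lemma profile_of_identity:
  fixes G :: "real \<Rightarrow> real" and n :: nat
  assumes n: "n > 0" "k = n / 2" and \<beta>: "\<beta> = 1 / 4" and \<gamma>: "\<gamma> = \<alpha> / 4"
    and \<sigma>: "\<sigma>1 / 2 = \<tau>1 + 1" "\<sigma>2 / 2 = \<tau>2 + 1"
    and weak: "weak_profile n \<sigma>1 \<sigma>2 \<alpha> q G"
  obtains w p where "\<And>s. s > 0 \<Longrightarrow> solves_at w p s" "\<And>s. s > 0 \<Longrightarrow> 0 \<le> w s"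
    "((\<lambda>s. s powr k * p s) \<longlongrightarrow> 0) (at_right 0)" "AE s in lborel. 0 < s \<longrightarrow> G s = w s"
proof -
  note wp = weak[unfolded weak_profile_def]
  have Gm[measurable]: "G \<in> borel_measurable borel" and Gnn: "\<And>s. 0 \<le> G s" using wp by auto
  note I1 = wp[THEN conjunct2, THEN conjunct2, THEN conjunct1, rule_format]
    and I2 = wp[THEN conjunct2, THEN conjunct2, THEN conjunct2, THEN conjunct1, rule_format]
    and I3 = wp[THEN conjunct2, THEN conjunct2, THEN conjunct2, THEN conjunct2, THEN conjunct1, rule_format]
    and ident = wp[THEN conjunct2, THEN conjunct2, THEN conjunct2, THEN conjunct2, THEN conjunct2, rule_format]
  define \<kappa> where "\<kappa> = unit_ball_vol (real n) * k"
  have \<kappa>: "\<kappa> > 0" using k_pos by (simp add: \<kappa>_def)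
  have rd: "radial_density n s = \<kappa> * s powr (k - 1)" if "s > 0" for s
    using that by (simp add: radial_density_def \<kappa>_def n)
  have rd0: "radial_density n s = 0" if "s \<le> 0" for s
    using that by (simp add: radial_density_def)
  define f1 where "f1 = (\<lambda>s. if 0 < s then s powr k * source s (G s) else 0)"
  have f1_eq: "4 * \<kappa> * f1 s = radial_density n s * (\<alpha> * (s powr (\<sigma>1 / 2) * G s powr q) - s powr (\<sigma>2 / 2) * G s)" for s
  proof (cases "s > 0")
    case True
    have "s powr (k - 1) * s powr (\<sigma>1 / 2) = s powr k * s powr \<tau>1" "s powr (k - 1) * s powr (\<sigma>2 / 2) = s powr k * s powr \<tau>2"
      unfolding \<sigma> by (simp_all flip: powr_add)
    then have "radial_density n s * (\<alpha> * (s powr (\<sigma>1 / 2) * G s powr q) - s powr (\<sigma>2 / 2) * G s)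
        = \<kappa> * (\<alpha> * (s powr k * s powr \<tau>1 * G s powr q) - s powr k * s powr \<tau>2 * G s)"
      unfolding rd[OF True] by algebra
    moreover have "4 * source s (G s) = \<alpha> * (s powr \<tau>1 * G s powr q) - s powr \<tau>2 * G s"
      unfolding source_def unfolding \<beta> \<gamma> using Gnn[of s] by simp
    then have "4 * \<kappa> * f1 s = \<kappa> * s powr k * (\<alpha> * (s powr \<tau>1 * G s powr q) - s powr \<tau>2 * G s)"
      using True by (simp add: f1_def)
    ultimately show ?thesis by (simp add: algebra_simps)
  qed (simp add: f1_def rd0)
  have [measurable]: "f1 \<in> borel_measurable borel" unfolding f1_def source_def by measurable
  have f1_int: "integrable lborel (\<lambda>s. indicator {..S} s * f1 s)" if "S \<ge> 0" for S
  proof -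
    have "integrable lborel (\<lambda>s. \<alpha> * (radial_density n s * (indicator {..(sqrt S)\<^sup>2} s * (s powr (\<sigma>1 / 2) * G s powr q)))
        - radial_density n s * (indicator {..(sqrt S)\<^sup>2} s * (s powr (\<sigma>2 / 2) * G s)))"
      using that by (intro Bochner_Integration.integrable_diff integrable_mult_right I1 I3) auto
    moreover have "\<alpha> * (radial_density n s * (indicator {..(sqrt S)\<^sup>2} s * (s powr (\<sigma>1 / 2) * G s powr q)))
        - radial_density n s * (indicator {..(sqrt S)\<^sup>2} s * (s powr (\<sigma>2 / 2) * G s)) = 4 * \<kappa> * (indicator {..S} s * f1 s)" for s
    proof -
      have "4 * \<kappa> * (indicator {..S} s * f1 s) = indicator {..S} s * (4 * \<kappa> * f1 s)" by simp
      also have "\<dots> = indicator {..S} s * (radial_density n s * (\<alpha> * (s powr (\<sigma>1 / 2) * G s powr q) - s powr (\<sigma>2 / 2) * G s))"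
        unfolding f1_eq ..
      finally show ?thesis using that by (simp add: algebra_simps)
    qed
    ultimately have "integrable lborel (\<lambda>s. 4 * \<kappa> * (indicator {..S} s * f1 s))" by simp
    then show ?thesis using \<kappa> by simp
  qed
  have G_int: "integrable lborel (\<lambda>s. indicator {l..S} s * G s)" if l: "0 < l" for l S
  proof (cases "l \<le> S")
    case True
    have "integrable lborel (\<lambda>s. radial_density n s * (indicator {..(sqrt S)\<^sup>2} s * G s))"
      using True l by (intro I2) auto
    then have I: "integrable lborel (\<lambda>s. radial_density n s * (indicator {..S} s * G s))" using True l by simp
    have "compact ((\<lambda>s. s powr (1 - k)) ` {l..S})"
      using l by (intro compact_continuous_image continuous_intros) auto
    then have "bounded ((\<lambda>s. s powr (1 - k)) ` {l..S})" by (rule compact_imp_bounded)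
    then obtain M where M: "M > 0" "\<And>s. s \<in> {l..S} \<Longrightarrow> s powr (1 - k) \<le> M" unfolding bounded_pos by auto
    show ?thesis
    proof (rule Bochner_Integration.integrable_bound[OF integrable_mult_right[OF I, of "M / \<kappa>"]])
      show "AE s in lborel. norm (indicator {l..S} s * G s) \<le> norm (M / \<kappa> * (radial_density n s * (indicator {..S} s * G s)))"
      proof (intro always_eventually allI)
        fix s
        show "norm (indicator {l..S} s * G s) \<le> norm (M / \<kappa> * (radial_density n s * (indicator {..S} s * G s)))"
        proof (cases "s \<in> {l..S}")
          case s: True
          then have s0: "s > 0" using l by auto
          have "G s = s powr (1 - k) * (s powr (k - 1) * G s)"
            using s0 by (simp add: mult.assoc[symmetric] flip: powr_add)
          also have "\<dots> \<le> M * (s powr (k - 1) * G s)" using M(2)[OF s] Gnn by (intro mult_right_mono) auto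
          finally show ?thesis using s s0 Gnn[of s] M(1) \<kappa> by (simp add: rd abs_mult)
        qed simp
      qed
    qed simp
  qed simp
  \<comment> \<open>The candidate for the flux s^k w'. Integrating from 0 builds in its zero limit
    at the origin.\<close>
  define H where "H = (\<lambda>t. integral {0..t} f1)"
  have f1_set: "set_integrable lborel {0..S} f1" for S
  proof (cases "S \<ge> 0")
    case True
    have "(\<lambda>s. indicator {0..S} s *\<^sub>R f1 s) = (\<lambda>s. indicator {..S} s * f1 s)"
      by (auto simp: f1_def indicator_def fun_eq_iff)
    then show ?thesis using f1_int[OF True] unfolding set_integrable_def by simp
  qed (simp add: set_integrable_def)
  have f1_HK: "f1 integrable_on {0..S}" for S
    using f1_set by (rule set_borel_integral_eq_integral(1))
  have H_lint: "H t = (LINT s|lborel. indicator {..t} s * f1 s)" for t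
  proof -
    have "(LINT s|lborel. indicator {..t} s * f1 s) = (LINT s:{0..t}|lborel. f1 s)"
      unfolding set_lebesgue_integral_def
      by (intro Bochner_Integration.integral_cong) (auto simp: f1_def indicator_def)
    then show ?thesis using set_borel_integral_eq_integral(2)[OF f1_set] by (simp add: H_def)
  qed
  have H_cont: "continuous_on {0..S} H" for S
    unfolding H_def using f1_HK by (rule indefinite_integral_continuous_1)
  have H_cont': "continuous_on {0<..} H"
  proof (intro continuous_at_imp_continuous_on ballI)
    fix t :: real assume "t \<in> {0<..}"
    then show "isCont H t"
      using continuous_on_interior[OF H_cont[of "t + 1"], of t] by simp
  qed
  have H0: "(H \<longlongrightarrow> 0) (at_right 0)"
  proof -
    have "(H \<longlongrightarrow> H 0) (at 0 within {0..1})" using H_cont[of 1] by (simp add: continuous_on_def)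
    then show ?thesis by (simp add: at_within_Icc_at_right H_def)
  qed
  have cpw: "continuous_on {0<..} (\<lambda>s. s powr b)" for b :: real by (intro continuous_intros) auto
  obtain W where W: "\<And>s. s > 0 \<Longrightarrow> (W has_real_derivative s powr (- k) * H s) (at s)"
    using primitive_on_positive_reals[OF continuous_on_mult[OF cpw H_cont'], of "- k"] by blast
  have W_cont: "continuous_on {0<..} W"
    by (intro continuous_at_imp_continuous_on ballI DERIV_isCont[OF W]) auto
  define W0 where "W0 = (\<lambda>s. if 0 < s then W s else 0)"
  have W0_int: "integrable lborel (\<lambda>s. indicator {l..S} s * W0 s)" if "0 < l" for l S
    by (rule integral_lborel_eq_integral_Icc(1)[where l = l and S = S and f = W])
      (use that in \<open>auto simp: W0_def intro!: continuous_on_subset[OF W_cont]\<close>)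
  have test: "(LINT s|lborel. (G s - W0 s) * \<rho> s) = 0"
    if lS: "0 < l" "l < S" and \<rho>: "continuous_on UNIV \<rho>" "\<And>s. s \<notin> {l..S} \<Longrightarrow> \<rho> s = 0" "integral\<^sup>L lborel \<rho> = 0" for \<rho> l S
  proof -
    \<comment> \<open>Against the radial density the Laplacian of \<zeta>(|x|^2) is a constant times
      (s^k \<zeta>')', so \<zeta>' = s^(-k) \<theta> realises a prescribed \<rho>. Mean zero makes
      \<theta> vanish beyond S.\<close>
    define \<theta> where "\<theta> = (\<lambda>s. integral {l..s} \<rho>)"
    have \<rho>l: "\<rho> s = 0" if "s \<le> l" for s
    proof (cases "s = l")
      case True
      have "closed {s. \<rho> s = 0}" using \<rho>(1) by (intro closed_Collect_eq) auto
      moreover have "{..<l} \<subseteq> {s. \<rho> s = 0}" using \<rho>(2) by auto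
      ultimately have "closure {..<l} \<subseteq> {s. \<rho> s = 0}" by (rule closure_minimal[rotated])
      then show ?thesis using True by (auto simp: closure_lessThan)
    qed (use \<rho>(2) that in auto)
    have d\<theta>: "(\<theta> has_real_derivative \<rho> s) (at s)" for s
      unfolding \<theta>_def by (rule primitive_from_left[OF \<rho>(1) \<rho>l])
    have \<theta>l: "\<theta> s = 0" if "s \<le> l" for s using that by (cases "s = l") (auto simp: \<theta>_def)
    have \<theta>S: "\<theta> s = 0" if "s \<ge> S" for s
    proof -
      have "integral\<^sup>L lborel \<rho> = integral {l..s} \<rho>"
        by (rule integral_lborel_eq_integral_Icc(2)) (use \<rho> that in \<open>auto intro: continuous_on_subset\<close>)
      then show ?thesis using \<rho>(3) by (simp add: \<theta>_def)
    qed
    have c\<theta>: "continuous_on UNIV \<theta>" using DERIV_isCont[OF d\<theta>] by (auto intro!: continuous_at_imp_continuous_on)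
    \<comment> \<open>\<theta> vanishes up to l, so replacing s by v changes nothing there and makes
      the negative powers continuous on the whole line.\<close>
    define v where "v = (\<lambda>s. max s (l / 2))"
    have v: "v s > 0" for s using lS by (simp add: v_def)
    have cv: "continuous_on UNIV (\<lambda>s. v s powr b)" for b
      using v lS by (intro continuous_on_powr continuous_intros) (auto simp: v_def less_imp_neq[symmetric] intro!: continuous_intros)
    define \<zeta>1 where "\<zeta>1 = (\<lambda>s. v s powr (- k) * \<theta> s)"
    define \<zeta>2 where "\<zeta>2 = (\<lambda>s. v s powr (- k) * \<rho> s - k * v s powr (- k - 1) * \<theta> s)"
    have c\<zeta>1: "continuous_on UNIV \<zeta>1" unfolding \<zeta>1_def by (intro continuous_on_mult cv c\<theta>)
    have c\<zeta>2: "continuous_on UNIV \<zeta>2" unfolding \<zeta>2_def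
      by (intro continuous_on_mult continuous_on_diff continuous_on_const cv c\<theta> \<rho>(1))
    have z1l: "\<zeta>1 s = 0" "\<zeta>2 s = 0" if "s \<le> l" for s using \<theta>l[OF that] \<rho>l[OF that] by (auto simp: \<zeta>1_def \<zeta>2_def)
    have z1S: "\<zeta>1 s = 0" if "s \<ge> S" for s using \<theta>S[OF that] by (auto simp: \<zeta>1_def)
    have d\<zeta>1: "(\<zeta>1 has_real_derivative \<zeta>2 s) (at s)" for s
    proof (cases "s > l / 2")
      case True
      then have s: "s > 0" using lS by simp
      have "((\<lambda>s. s powr (- k) * \<theta> s) has_real_derivative \<zeta>2 s) (at s)"
        using DERIV_mult[OF has_real_derivative_powr[OF s, of "- k"] d\<theta>[of s]] True
        by (simp add: \<zeta>2_def v_def mult_ac)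
      moreover have "\<forall>\<^sub>F t in nhds s. t \<in> {l/2<..}"
        using True by (intro eventually_nhds_in_open) auto
      then have "\<forall>\<^sub>F t in nhds s. \<zeta>1 t = t powr (- k) * \<theta> t"
        by eventually_elim (simp add: \<zeta>1_def v_def max_absorb1)
      ultimately show ?thesis by (subst DERIV_cong_ev[OF refl _ refl])
    next
      case False
      then have s: "s < l" using lS by simp
      have "\<forall>\<^sub>F t in nhds s. t < l"
        using s by (intro eventually_nhds_in_open[of "{..<l}", simplified]) auto
      then have "\<forall>\<^sub>F t in nhds s. \<zeta>1 t = 0" by eventually_elim (use z1l in auto)
      then have "(\<zeta>1 has_real_derivative 0) (at s)"
        by (subst DERIV_cong_ev[OF refl _ refl, where g = "\<lambda>_. 0"]) auto
      then show ?thesis using z1l(2)[of s] s by simp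
    qed
    \<comment> \<open>Normalised to vanish beyond S; near 0 it is a constant, in general nonzero.
      Hence the identity sees f1 all the way down to the origin, which is what fixes the flux as
      H.\<close>
    define \<zeta> where "\<zeta> = (\<lambda>s. integral {l..s} \<zeta>1 - integral {l..S} \<zeta>1)"
    have d\<zeta>: "(\<zeta> has_real_derivative \<zeta>1 s) (at s)" for s
      unfolding \<zeta>_def using DERIV_diff[OF primitive_from_left[OF c\<zeta>1 z1l(1)] DERIV_const] by simp
    have z1_int: "\<zeta>1 integrable_on {x..y}" for x y
      by (intro integrable_continuous_real continuous_on_subset[OF c\<zeta>1]) auto
    have \<zeta>S: "\<zeta> s = 0" if "s \<ge> S" for s
    proof -
      have "integral {l..S} \<zeta>1 + integral {S..s} \<zeta>1 = integral {l..s} \<zeta>1"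
        using that lS by (intro Henstock_Kurzweil_Integration.integral_combine z1_int) auto
      moreover have "integral {S..s} \<zeta>1 = integral {S..s} (\<lambda>_. 0)"
        by (intro Henstock_Kurzweil_Integration.integral_cong) (use z1S in auto)
      ultimately show ?thesis by (simp add: \<zeta>_def)
    qed
    have c\<zeta>: "continuous_on UNIV \<zeta>" using DERIV_isCont[OF d\<zeta>] by (auto intro!: continuous_at_imp_continuous_on)
    have G\<rho>: "integrable lborel (\<lambda>s. G s * \<rho> s)"
      by (rule integrable_mult_compact_support[OF G_int[OF lS(1)] \<rho>(1,2)])
    have z1_supp: "integrable lborel \<zeta>1"
      by (rule integrable_continuous_compact_support[OF c\<zeta>1, of "{l..S}"]) (use z1l z1S in auto)
    define fS where "fS = (\<lambda>s. indicator {..S} s * f1 s)"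
    have fS: "integrable lborel fS" unfolding fS_def using lS by (intro f1_int) auto
    have [measurable]: "fS \<in> borel_measurable borel" unfolding fS_def by measurable
    have [measurable]: "\<zeta>1 \<in> borel_measurable borel" using c\<zeta>1 by (rule borel_measurable_continuous_onI)
    \<comment> \<open>Fubini on the triangle s <= t replaces integration by parts, as f1 is merely
      integrable and H not yet known to be differentiable.\<close>
    define Q where "Q = (\<lambda>z. fS (fst z) * \<zeta>1 (snd z) * (if fst z \<le> snd z then 1 else 0 :: real))"
    have Q: "integrable (lborel \<Otimes>\<^sub>M lborel) Q"
    proof (rule Bochner_Integration.integrable_bound)
      show "integrable (lborel \<Otimes>\<^sub>M lborel) (\<lambda>z. fS (fst z) * \<zeta>1 (snd z))"
        using integrable_product(1)[OF fS z1_supp] by (simp add: lborel_prod)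
      show "Q \<in> borel_measurable (lborel \<Otimes>\<^sub>M lborel)" unfolding Q_def by measurable
    qed (auto simp: Q_def)
    have inner1: "(LINT t|lborel. Q (s, t)) = - (f1 s * \<zeta> s)" for s
    proof -
      consider "s \<le> 0" | "0 < s" "s \<le> S" | "S < s" by linarith
      then show ?thesis
      proof cases
        case 1
        then show ?thesis by (simp add: Q_def fS_def f1_def)
      next
        case 2
        have "(LINT t|lborel. \<zeta>1 t * (if s \<le> t then 1 else 0)) = integral {s..S} \<zeta>1"
          by (rule integral_lborel_eq_integral_Icc(2)) (use z1S 2 in \<open>auto intro!: continuous_on_subset[OF c\<zeta>1]\<close>)
        also have "\<dots> = - \<zeta> s"
        proof (cases "l \<le> s")
          case True
          have "integral {l..s} \<zeta>1 + integral {s..S} \<zeta>1 = integral {l..S} \<zeta>1"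
            using True 2 by (intro Henstock_Kurzweil_Integration.integral_combine z1_int) auto
          then show ?thesis by (simp add: \<zeta>_def)
        next
          case False
          have "integral {s..l} \<zeta>1 + integral {l..S} \<zeta>1 = integral {s..S} \<zeta>1"
            using False lS by (intro Henstock_Kurzweil_Integration.integral_combine z1_int) auto
          moreover have "integral {s..l} \<zeta>1 = integral {s..l} (\<lambda>_. 0)"
            by (intro Henstock_Kurzweil_Integration.integral_cong) (use z1l in auto)
          ultimately show ?thesis using False by (simp add: \<zeta>_def)
        qed
        finally have "(LINT t|lborel. \<zeta>1 t * (if s \<le> t then 1 else 0)) = - \<zeta> s" .
        moreover have "(LINT t|lborel. Q (s, t)) = f1 s * (LINT t|lborel. \<zeta>1 t * (if s \<le> t then 1 else 0))"
          using 2 by (simp add: Q_def fS_def mult.assoc)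
        ultimately show ?thesis by simp
      next
        case 3
        then show ?thesis using \<zeta>S[of s] by (simp add: Q_def fS_def)
      qed
    qed
    have inner2: "(LINT s|lborel. Q (s, t)) = \<zeta>1 t * H t" for t
    proof (cases "t \<ge> S")
      case True
      then show ?thesis using z1S[OF True] by (simp add: Q_def)
    next
      case False
      have "Q (s, t) = \<zeta>1 t * (indicator {..t} s * f1 s)" for s
        using False by (auto simp: Q_def fS_def indicator_def)
      then show ?thesis by (simp add: H_lint)
    qed
    have "(LINT s|lborel. f1 s * \<zeta> s) = - (LINT s|lborel. LINT t|lborel. Q (s, t))"
      by (simp add: inner1)
    also have "(LINT s|lborel. LINT t|lborel. Q (s, t)) = (LINT t|lborel. LINT s|lborel. Q (s, t))"
      using lborel_pair.Fubini_integral[of "\<lambda>s t. Q (s, t)"] Q by simp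
    finally have fz: "(LINT s|lborel. f1 s * \<zeta> s) = - (LINT t|lborel. \<zeta>1 t * H t)" by (simp add: inner2)
    have f1\<zeta>: "integrable lborel (\<lambda>s. f1 s * \<zeta> s)"
      using lborel_pair.integrable_fst'[OF Q] by (simp add: inner1)
    have sub: "{l..S} \<subseteq> {0<..}" using lS by auto
    have c1: "continuous_on {l..S} (\<lambda>s. \<theta> s * (s powr (- k) * H s))"
      by (intro continuous_on_mult continuous_on_subset[OF c\<theta>] continuous_on_subset[OF cpw sub] continuous_on_subset[OF H_cont' sub]) auto
    have c2: "continuous_on {l..S} (\<lambda>s. \<rho> s * W s)"
      by (intro continuous_on_mult continuous_on_subset[OF \<rho>(1)] continuous_on_subset[OF W_cont sub]) auto
    have zH: "(LINT t|lborel. \<zeta>1 t * H t) = integral {l..S} (\<lambda>s. \<theta> s * (s powr (- k) * H s))"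
    proof (rule integral_lborel_eq_integral_Icc(2)[OF c1])
      show "\<zeta>1 s * H s = 0" if "s \<notin> {l..S}" for s using that z1l z1S by (cases "s \<le> l") auto
      show "\<zeta>1 s * H s = \<theta> s * (s powr (- k) * H s)" if "s \<in> {l..S}" for s
        using that lS by (auto simp: \<zeta>1_def v_def max_absorb1)
    qed
    have W0\<rho>: "integrable lborel (\<lambda>s. W0 s * \<rho> s)" "(LINT s|lborel. W0 s * \<rho> s) = integral {l..S} (\<lambda>s. \<rho> s * W s)"
      using lS \<rho>(2) by (intro integral_lborel_eq_integral_Icc[OF c2]; force simp: W0_def)+
    have "((\<lambda>s. \<theta> s * W s) has_real_derivative \<rho> s * W s + s powr (- k) * H s * \<theta> s) (at s)" if "s > 0" for s
      by (rule DERIV_mult[OF d\<theta> W[OF that]])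
    then have "((\<lambda>s. \<rho> s * W s + s powr (- k) * H s * \<theta> s) has_integral \<theta> S * W S - \<theta> l * W l) {l..S}"
      using lS by (intro fundamental_theorem_of_calculus)
        (auto simp: has_real_derivative_iff_has_vector_derivative[symmetric] intro: has_field_derivative_at_within)
    then have "integral {l..S} (\<lambda>s. \<rho> s * W s + \<theta> s * (s powr (- k) * H s)) = 0"
      using \<theta>l[of l] \<theta>S[of S] by (simp add: integral_unique mult_ac)
    then have "integral {l..S} (\<lambda>s. \<rho> s * W s) + integral {l..S} (\<lambda>s. \<theta> s * (s powr (- k) * H s)) = 0"
      using c1 c2 by (subst Henstock_Kurzweil_Integration.integral_add[symmetric]) (auto intro: integrable_continuous_real)
    then have fW: "(LINT s|lborel. f1 s * \<zeta> s) = (LINT s|lborel. W0 s * \<rho> s)"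
      using fz zH W0\<rho>(2) by linarith
    have "(LINT s|lborel. radial_density n s * (G s * (2 * real n * \<zeta>1 s + 4 * s * \<zeta>2 s)
         + s powr (\<sigma>2 / 2) * G s * \<zeta> s - \<alpha> * (s powr (\<sigma>1 / 2) * G s powr q) * \<zeta> s)) = 0"
    proof (rule ident[where S = "S + 1", OF d\<zeta> d\<zeta>1 c\<zeta>2])
      show "\<zeta>2 s = 0" if "S + 1 \<le> s" for s using \<rho>(2)[of s] \<theta>S[of s] that by (simp add: \<zeta>2_def)
    qed (use \<zeta>S z1S in auto)
    moreover have "radial_density n s * (G s * (2 * real n * \<zeta>1 s + 4 * s * \<zeta>2 s)
         + s powr (\<sigma>2 / 2) * G s * \<zeta> s - \<alpha> * (s powr (\<sigma>1 / 2) * G s powr q) * \<zeta> s) = 4 * \<kappa> * (G s * \<rho> s - f1 s * \<zeta> s)" for s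
    proof -
      have "radial_density n s * (2 * real n * \<zeta>1 s + 4 * s * \<zeta>2 s) = 4 * \<kappa> * \<rho> s"
      proof (cases "s \<le> l")
        case True
        then show ?thesis using z1l[OF True] \<rho>l[OF True] by simp
      next
        case False
        then have s: "s > 0" "v s = s" using lS by (auto simp: v_def)
        have e: "s * s powr (- k - 1) = s powr (- k)" "s powr (k - 1) * (s * s powr (- k)) = 1"
          using s by (simp_all add: powr_diff powr_minus field_simps)
        have "2 * real n * \<zeta>1 s + 4 * s * \<zeta>2 s = 4 * k * (s powr (- k) * \<theta> s) + 4 * (s * s powr (- k)) * \<rho> s - 4 * k * (s * s powr (- k - 1)) * \<theta> s"
          using n(2) by (simp add: \<zeta>1_def \<zeta>2_def s(2) algebra_simps)
        also have "\<dots> = 4 * (s * s powr (- k)) * \<rho> s" unfolding e(1) by simp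
        finally have "radial_density n s * (2 * real n * \<zeta>1 s + 4 * s * \<zeta>2 s) = 4 * \<kappa> * (s powr (k - 1) * (s * s powr (- k))) * \<rho> s"
          unfolding rd[OF s(1)] by simp
        then show ?thesis unfolding e(2) by simp
      qed
      then have "radial_density n s * (G s * (2 * real n * \<zeta>1 s + 4 * s * \<zeta>2 s)) = 4 * \<kappa> * \<rho> s * G s"
        by (metis mult.assoc mult.commute)
      moreover have "radial_density n s * (s powr (\<sigma>2 / 2) * G s * \<zeta> s - \<alpha> * (s powr (\<sigma>1 / 2) * G s powr q) * \<zeta> s) = - (4 * \<kappa> * f1 s) * \<zeta> s"
        unfolding f1_eq by algebra
      ultimately show ?thesis by (simp add: algebra_simps)
    qed
    ultimately have "4 * \<kappa> * ((LINT s|lborel. G s * \<rho> s) - (LINT s|lborel. f1 s * \<zeta> s)) = 0"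
      using G\<rho> f1\<zeta> by simp
    then have "(LINT s|lborel. G s * \<rho> s) = (LINT s|lborel. W0 s * \<rho> s)" using \<kappa> fW by simp
    then show ?thesis using G\<rho> W0\<rho>(1) by (simp add: left_diff_distrib)
  qed
  have "\<exists>C. AE s in lborel. 0 < s \<longrightarrow> G s - W0 s = C"
  proof (rule du_Bois_Reymond)
    show "integrable lborel (\<lambda>s. indicator {l..S} s * (G s - W0 s))" if "0 < l" for l S
      using Bochner_Integration.integrable_diff[OF G_int[OF that, of S] W0_int[OF that, of S]]
      by (simp add: right_diff_distrib)
  qed (rule test)
  then obtain C where C: "AE s in lborel. 0 < s \<longrightarrow> G s - W0 s = C" by blast
  define w where "w = (\<lambda>s. W s + C)"
  have Gw: "AE s in lborel. 0 < s \<longrightarrow> G s = w s"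
    using C by eventually_elim (auto simp: W0_def w_def)
  have dw: "(w has_real_derivative s powr (- k) * H s) (at s)" if "s > 0" for s
    unfolding w_def using DERIV_add[OF W[OF that] DERIV_const] by simp
  have cw: "continuous_on {0<..} w" unfolding w_def by (intro continuous_intros W_cont)
  \<comment> \<open>w agrees almost everywhere with G >= 0, so the set where it is negative is open
    and null, hence empty.\<close>
  have wnn: "0 \<le> w s" if s: "s > 0" for s
  proof (rule ccontr)
    assume neg: "\<not> 0 \<le> w s"
    have op: "open ({0<..} \<inter> w -` {..<0})"
      by (rule continuous_open_preimage[OF cw]) auto
    have "AE s in lborel. s \<notin> {0<..} \<inter> w -` {..<0}"
      using Gw
    proof eventually_elim
      case (elim s)
      then show ?case using Gnn[of s] by auto
    qed
    then have "{0<..} \<inter> w -` {..<0} \<in> null_sets lborel"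
      using op by (subst AE_iff_null_sets) auto
    then have "negligible ({0<..} \<inter> w -` {..<0})" by (simp add: negligible_iff_null_sets null_sets_completionI)
    then have "{0<..} \<inter> w -` {..<0} = {}" using op open_not_negligible by blast
    then show False using s neg by auto
  qed
  define f2 where "f2 = (\<lambda>s. s powr k * source s (w s))"
  have cf2: "continuous_on {0<..} f2"
    unfolding f2_def by (intro continuous_on_mult cpw)
      (unfold source_def, intro continuous_intros continuous_on_powr' cw, use q_pos in auto)
  \<comment> \<open>Off a null set f1 equals the continuous function f2, so H is also a primitive of
    f2 up to a constant.\<close>
  have dH: "(H has_real_derivative f2 t) (at t)" if t: "t > 0" for t
  proof -
    define a where "a = t / 2"
    have a: "0 < a" "a < t" using t by (auto simp: a_def)
    obtain N where N: "N \<in> null_sets lborel" "{s. \<not> (0 < s \<longrightarrow> G s = w s)} \<subseteq> N"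
      using AE_E[OF Gw] by (auto simp: null_sets_def)
    have negN: "negligible N" using N(1) by (simp add: negligible_iff_null_sets null_sets_completionI)
    have eq: "H u = H a + integral {a..u} f2" if u: "a < u" for u
    proof -
      have "integral {0..a} f1 + integral {a..u} f1 = integral {0..u} f1"
        using a u by (intro Henstock_Kurzweil_Integration.integral_combine f1_HK) auto
      moreover have "integral {a..u} f1 = integral {a..u} f2"
      proof (rule integral_spike[OF negN])
        fix x assume x: "x \<in> {a..u} - N"
        then have "x > 0" using a by auto
        moreover from this x have "G x = w x" using N(2) by blast
        ultimately show "f2 x = f1 x" by (simp add: f1_def f2_def)
      qed
      ultimately show ?thesis by (simp add: H_def)
    qed
    have "((\<lambda>u. integral {a..u} f2) has_real_derivative f2 t) (at t within {a..t + 1})"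
      using a by (intro integral_has_real_derivative continuous_on_subset[OF cf2]) auto
    then have "((\<lambda>u. integral {a..u} f2) has_real_derivative f2 t) (at t)"
      using a by (subst (asm) at_within_Icc_at) auto
    from DERIV_add[OF DERIV_const this]
    have d: "((\<lambda>u. H a + integral {a..u} f2) has_real_derivative f2 t) (at t)" by simp
    have "\<forall>\<^sub>F u in nhds t. a < u" using a by (intro eventually_nhds_in_open[of "{a<..}", simplified]) auto
    then have "\<forall>\<^sub>F u in nhds t. H u = H a + integral {a..u} f2" by eventually_elim (rule eq)
    then show ?thesis using d by (subst DERIV_cong_ev[OF refl _ refl])
  qed
  define p where "p = (\<lambda>s. s powr (- k) * H s)"
  have "solves_at w p s" if s: "s > 0" for s
  proof -
    have "(p has_real_derivative (- k) * s powr (- k - 1) * H s + f2 s * s powr (- k)) (at s)"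
      unfolding p_def by (rule DERIV_mult[OF has_real_derivative_powr[OF s] dH[OF s]])
    moreover have "(- k) * s powr (- k - 1) * H s + f2 s * s powr (- k) = source s (w s) - k / s * p s"
      using s by (simp add: p_def f2_def powr_diff powr_minus field_simps)
    ultimately show ?thesis using dw[OF s] by (simp add: solves_at_def p_def)
  qed
  moreover have "((\<lambda>s. s powr k * p s) \<longlongrightarrow> 0) (at_right 0)"
  proof (rule Lim_transform_eventually[OF H0])
    show "\<forall>\<^sub>F s in at_right 0. H s = s powr k * p s"
      using eventually_at_right_less[of "0::real"]
      by eventually_elim (simp add: p_def powr_minus)
  qed
  ultimately show ?thesis using wnn Gw that by blast
qed

end

section \<open>Separate variable solutions\<close>

lemma no_separate_solution:
  fixes u :: "'a::euclidean_space \<Rightarrow> real \<Rightarrow> real"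
  assumes m: "m > 1" and T: "T > 0"
    and rp: "radial_profile (real DIM('a) / 2) (\<sigma>1 / 2 - 1) (\<sigma>2 / 2 - 1) (1 / 4) (1 / (m - 1) / 4) (1 / m)"
    and lt: "\<sigma>1 < \<sigma>2"
    and a: "a + (\<sigma>1 / 2 - 1) > 0" "a > 2 \<or> a = real DIM('a) / 2 + 1" and c: "c = (a + (\<sigma>1 / 2 - 1)) / (1 / m + 1)"
    and A: "0 \<le> a / 2 - real DIM('a) / 2 + c" and B: "0 \<le> (a + (\<sigma>2 / 2 - 1)) / 2 - c"
    and D: "0 \<le> c * (real DIM('a) / 2 + 1 - a) / 2 * (a - 2)"
    and strict: "0 < a / 2 - real DIM('a) / 2 + c \<or> 0 < c * (real DIM('a) / 2 + 1 - a) / 2 * (a - 2)"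
  shows "\<not> separate_variable_solution m \<sigma>1 \<sigma>2 T u F"
proof
  define k \<tau>1 \<tau>2 \<beta> \<gamma> q where k_def: "k = real DIM('a) / 2" and \<tau>1_def: "\<tau>1 = \<sigma>1 / 2 - 1" and \<tau>2_def: "\<tau>2 = \<sigma>2 / 2 - 1"
    and \<beta>_def: "\<beta> = (1 / 4 :: real)" and \<gamma>_def: "\<gamma> = 1 / (m - 1) / 4" and q_def: "q = 1 / m"
  interpret radial_profile k \<tau>1 \<tau>2 \<beta> \<gamma> q
    unfolding k_def \<tau>1_def \<tau>2_def \<beta>_def \<gamma>_def q_def by (rule rp)
  assume sol: "separate_variable_solution m \<sigma>1 \<sigma>2 T u F"
  then have weak: "weak_solution m \<sigma>1 \<sigma>2 T u" and F: "\<And>r. r \<ge> 0 \<Longrightarrow> 0 \<le> F r"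
    and nontriv: "\<not> (AE r in lebesgue. 0 \<le> r \<longrightarrow> F r = 0)"
    and u: "\<And>x t. t \<in> {0<..<T} \<Longrightarrow> u x t = (T - t) powr (- (1 / (m - 1))) * F (norm x)"
    by (auto simp: separate_variable_solution_def)
  obtain G where G: "weak_profile DIM('a) \<sigma>1 \<sigma>2 (1 / (m - 1)) q G"
    "AE s in lebesgue. 0 \<le> s \<longrightarrow> F (sqrt s) powr m = G s" unfolding q_def
  proof (rule radial_identity[OF m T weak])
    show "0 \<le> F r" if "r \<ge> 0" for r by (rule F[OF that])
    show "u x t = (T - t) powr (- (1 / (m - 1))) * F (norm x)" if "t \<in> {0<..<T}" for x t by (rule u[OF that])
  qed (rule that[unfolded q_def])
  obtain w p where wp: "\<And>s. s > 0 \<Longrightarrow> solves_at w p s" "\<And>s. s > 0 \<Longrightarrow> 0 \<le> w s"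
    "((\<lambda>s. s powr k * p s) \<longlongrightarrow> 0) (at_right 0)" "AE s in lborel. 0 < s \<longrightarrow> G s = w s"
  proof (rule profile_of_identity[where n = "DIM('a)" and G = G])
    show "0 < DIM('a)" "k = real DIM('a) / 2" "\<beta> = 1 / 4" "\<gamma> = 1 / (m - 1) / 4"
      by (simp_all add: k_def \<beta>_def \<gamma>_def)
    show "\<sigma>1 / 2 = \<tau>1 + 1" "\<sigma>2 / 2 = \<tau>2 + 1" by (simp_all add: \<tau>1_def \<tau>2_def)
  qed (rule G(1), rule that)
  have w0: "w s = 0" if "s > 0" for s
  proof (rule profile_trivial[OF _ wp(1-3), of a c])
    show "a > 2 \<or> a = k + 1" "a + \<tau>1 > 0" "c = (a + \<tau>1) / (q + 1)"
      using a c by (simp_all add: k_def \<tau>1_def q_def)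
    show "0 \<le> a / 2 - k + c" "0 \<le> (a + \<tau>2) / 2 - c" "0 \<le> c * (k + 1 - a) / 2 * (a - 2)"
      "0 < a / 2 - k + c \<or> 0 < c * (k + 1 - a) / 2 * (a - 2)"
      using A B D strict unfolding k_def \<tau>2_def by blast+
  qed (use lt that in \<open>auto simp: \<tau>1_def \<tau>2_def\<close>)
  have "AE s in lebesgue. 0 < s \<longrightarrow> F (sqrt s) = 0"
    using G(2) AE_completion[OF wp(4)]
  proof eventually_elim
    case (elim s)
    show ?case
    proof
      assume s: "0 < s"
      then have "F (sqrt s) powr m = 0" using elim w0 by auto
      then show "F (sqrt s) = 0" by simp
    qed
  qed
  then obtain Z where Z: "Z \<in> null_sets lebesgue" "{s. \<not> (0 < s \<longrightarrow> F (sqrt s) = 0)} \<subseteq> Z"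
    by (elim AE_E3) (auto simp: null_sets_def)
  \<comment> \<open>Differentiability of the square root on positive numbers carries null sets of s
    = r^2 to null sets of r; the origin is added separately.\<close>
  have "negligible (sqrt ` (Z \<inter> {0<..}))"
  proof (rule negligible_differentiable_image_negligible)
    show "negligible (Z \<inter> {0<..})" 
      using Z(1) unfolding negligible_iff_null_sets[symmetric] by (rule negligible_subset) auto
    show "sqrt differentiable_on Z \<inter> {0<..}"
      unfolding differentiable_on_def
    proof
      fix x assume "x \<in> Z \<inter> {0<..}"
      then have "(sqrt has_real_derivative inverse (sqrt x) / 2) (at x within Z \<inter> {0<..})"
        by (intro has_field_derivative_at_within[OF DERIV_real_sqrt]) auto
      then show "sqrt differentiable at x within Z \<inter> {0<..}"
        unfolding has_field_derivative_def by (rule differentiableI)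
    qed
  qed simp
  then have "insert 0 (sqrt ` (Z \<inter> {0<..})) \<in> null_sets lebesgue"
    by (simp only: negligible_insert negligible_iff_null_sets[symmetric])
  then have "AE r in lebesgue. r \<notin> insert 0 (sqrt ` (Z \<inter> {0<..}))" by (rule AE_not_in)
  then have "AE r in lebesgue. 0 \<le> r \<longrightarrow> F r = 0"
  proof eventually_elim
    case (elim r)
    show ?case
    proof (intro impI, rule ccontr)
      assume r: "0 \<le> r" "F r \<noteq> 0"
      then have r0: "r > 0" using elim by (cases "r = 0") simp_all
      have "\<not> (0 < r\<^sup>2 \<longrightarrow> F (sqrt (r\<^sup>2)) = 0)" using r0 r(2) by simp
      then have "r\<^sup>2 \<in> Z" using Z(2) by blast
      then have "r \<in> sqrt ` (Z \<inter> {0<..})" using r0 by (intro image_eqI[of _ _ "r\<^sup>2"]) auto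
      then show False using elim by simp
    qed
  qed
  with nontriv show False by contradiction
qed

text \<open>Boundedness of w keeps the essential supremum finite before T. By continuity the spatial
  factor exceeds half of a positive value on a nonempty open set, which is not null, so the factor
  (T - t)^(-1/(m-1)) is felt by the essential supremum.\<close>

lemma separated_solution_blows_up:
  fixes w :: "real \<Rightarrow> real"
  assumes m: "m > 1" and T: "T > 0" and w: "continuous_on UNIV w" "\<And>s. 0 \<le> w s" "\<And>s. w s \<le> M"
    and s1: "s1 > 0" "w s1 > 0"
    and u: "\<And>(x::'a::euclidean_space) t. u x t = (T - t) powr (- (1 / (m - 1))) * w (x \<bullet> x) powr (1 / m)"
  shows "blows_up_at T u"
proof -
  define \<alpha> where "\<alpha> = 1 / (m - 1)"
  have \<alpha>: "\<alpha> > 0" using m by (simp add: \<alpha>_def)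
  define W where "W = (\<lambda>x::'a. w (x \<bullet> x) powr (1 / m))"
  have cW: "continuous_on UNIV W"
  proof -
    have "continuous_on UNIV (\<lambda>x::'a. w (x \<bullet> x))"
      by (rule continuous_on_compose2[OF w(1)]) (auto intro: continuous_intros)
    then show ?thesis unfolding W_def using m w(2) by (intro continuous_on_powr' continuous_on_const) auto
  qed
  have u': "u x t = (T - t) powr (- \<alpha>) * W x" for x t by (simp add: u \<alpha>_def W_def)
  have meas: "(\<lambda>x. ereal \<bar>u x t\<bar>) \<in> borel_measurable lebesgue" for t
  proof -
    have "W \<in> borel_measurable borel" using cW by (rule borel_measurable_continuous_onI)
    then have "(\<lambda>x. ereal \<bar>u x t\<bar>) \<in> borel_measurable lborel" unfolding u' by simp
    then show ?thesis by (rule measurable_completion)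
  qed
  have fin: "esssup lebesgue (\<lambda>x. ereal \<bar>u x t\<bar>) < \<infinity>" for t
  proof -
    have "esssup lebesgue (\<lambda>x. ereal \<bar>u x t\<bar>) \<le> ereal ((T - t) powr (- \<alpha>) * M powr (1 / m))"
    proof (rule esssup_I[OF meas], intro always_eventually allI)
      fix x
      have "W x \<le> M powr (1 / m)" unfolding W_def using w m by (intro powr_mono2) auto
      then show "ereal \<bar>u x t\<bar> \<le> ereal ((T - t) powr (- \<alpha>) * M powr (1 / m))"
        by (simp add: u' abs_mult W_def mult_left_mono)
    qed
    then show ?thesis by (rule le_less_trans) simp
  qed
  define \<kappa> where "\<kappa> = w s1 powr (1 / m) / 2"
  have \<kappa>: "\<kappa> > 0" using s1 by (simp add: \<kappa>_def)
  define U where "U = {x. \<kappa> < W x}"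
  have U: "open U" unfolding U_def using cW by (intro open_Collect_less continuous_on_const)
  have "U \<noteq> {}"
  proof -
    obtain b :: 'a where b: "b \<in> Basis" using nonempty_Basis by blast
    have "(sqrt s1 *\<^sub>R b) \<bullet> (sqrt s1 *\<^sub>R b) = s1" using b s1 by (simp add: inner_Basis)
    then have "W (sqrt s1 *\<^sub>R b) = 2 * \<kappa>" by (simp add: W_def \<kappa>_def)
    then have "sqrt s1 *\<^sub>R b \<in> U" using \<kappa> by (simp add: U_def)
    then show ?thesis by blast
  qed
  then have nonneg: "\<not> negligible U" using U open_not_negligible by blast
  have low: "ereal ((T - t) powr (- \<alpha>) * \<kappa>) \<le> esssup lebesgue (\<lambda>x. ereal \<bar>u x t\<bar>)" if t: "t < T" for t
  proof (rule ccontr)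
    assume "\<not> ?thesis"
    then have less: "esssup lebesgue (\<lambda>x. ereal \<bar>u x t\<bar>) < ereal ((T - t) powr (- \<alpha>) * \<kappa>)" by simp
    have "AE x in lebesgue. x \<notin> U"
      using esssup_AE[where f = "\<lambda>x. ereal \<bar>u x t\<bar>" and M = lebesgue]
    proof eventually_elim
      case (elim x)
      then have "ereal \<bar>u x t\<bar> < ereal ((T - t) powr (- \<alpha>) * \<kappa>)" using less by (rule le_less_trans)
      then have "(T - t) powr (- \<alpha>) * W x < (T - t) powr (- \<alpha>) * \<kappa>"
        by (simp add: u' abs_mult W_def)
      then show ?case using t by (simp add: U_def)
    qed
    then have "U \<in> null_sets lebesgue" using U by (subst AE_iff_null_sets) auto
    then show False using nonneg by (simp add: negligible_iff_null_sets)
  qed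
  have "((\<lambda>t. esssup lebesgue (\<lambda>x. ereal \<bar>u x t\<bar>)) \<longlongrightarrow> \<infinity>) (at_left T)"
    unfolding tendsto_PInfty
  proof
    fix r :: real
    define L where "L = max 1 (r / \<kappa> + 1)"
    define \<delta> where "\<delta> = L powr (- (1 / \<alpha>))"
    have L: "L > 0" "r < L * \<kappa>"
    proof -
      show "L > 0" by (simp add: L_def)
      have "r / \<kappa> < L" by (simp add: L_def less_max_iff_disj)
      then show "r < L * \<kappa>" using \<kappa> by (simp add: pos_divide_less_eq)
    qed
    have \<delta>: "\<delta> > 0" "\<delta> powr (- \<alpha>) = L" using L \<alpha> by (auto simp: \<delta>_def powr_powr)
    have "T - \<delta> < T" using \<delta> by simp
    from eventually_at_left_real[OF this]
    show "\<forall>\<^sub>F t in at_left T. ereal r < esssup lebesgue (\<lambda>x. ereal \<bar>u x t\<bar>)"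
    proof eventually_elim
      case (elim t)
      then have "\<delta> powr (- \<alpha>) \<le> (T - t) powr (- \<alpha>)" using \<alpha> by (intro powr_mono2') auto
      then have "L * \<kappa> \<le> (T - t) powr (- \<alpha>) * \<kappa>" using \<delta>(2) \<kappa> by simp
      then have "ereal r < ereal ((T - t) powr (- \<alpha>) * \<kappa>)" using L(2) by simp
      also have "\<dots> \<le> esssup lebesgue (\<lambda>x. ereal \<bar>u x t\<bar>)" using elim by (intro low) auto
      finally show ?case .
    qed
  qed
  with fin show ?thesis by (simp add: blows_up_at_def)
qed

lemma blowing_up_separate_solution:
  assumes m: "m > 1" and T: "T > 0"
    and rp: "radial_profile (real DIM('a::euclidean_space) / 2) (\<sigma>1 / 2 - 1) (\<sigma>2 / 2 - 1) (1 / 4) (1 / (m - 1) / 4) (1 / m)"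
    and c: "c = (a + (\<sigma>1 / 2 - 1)) / (1 / m + 1)"
    and A: "a / 2 - real DIM('a) / 2 + c = 0" and B: "(a + (\<sigma>2 / 2 - 1)) / 2 - c < 0"
  shows "\<exists>(u :: 'a \<Rightarrow> real \<Rightarrow> real) F. separate_variable_solution m \<sigma>1 \<sigma>2 T u F \<and> blows_up_at T u"
proof -
  define k \<tau>1 \<tau>2 \<beta> \<gamma> q where k_def: "k = real DIM('a) / 2" and \<tau>1_def: "\<tau>1 = \<sigma>1 / 2 - 1" and \<tau>2_def: "\<tau>2 = \<sigma>2 / 2 - 1"
    and \<beta>_def: "\<beta> = (1 / 4 :: real)" and \<gamma>_def: "\<gamma> = 1 / (m - 1) / 4" and q_def: "q = 1 / m"
  interpret radial_profile k \<tau>1 \<tau>2 \<beta> \<gamma> q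
    unfolding k_def \<tau>1_def \<tau>2_def \<beta>_def \<gamma>_def q_def by (rule rp)
  obtain s0 w p M where s0: "s0 > 0" and sol: "\<And>s. s > 0 \<Longrightarrow> solves_at w p s"
    and core: "\<And>s. s \<le> s0 \<Longrightarrow> w s = 0 \<and> p s = 0" and pos: "\<And>s. s0 < s \<Longrightarrow> 0 < w s" and M: "\<And>s. w s \<le> M"
    using dead_core_profile[of c a] c A B unfolding k_def \<tau>1_def \<tau>2_def q_def by blast
  define r where "r = (\<lambda>s. source s (w s) - k / s * p s)"
  have src0: "source s 0 = 0" for s by (simp add: source_def)
  have r0: "r s = 0" if "s \<le> s0" for s using core[OF that] by (simp add: r_def src0)
  have nonneg: "0 \<le> w s" for s using core[of s] pos[of s] by (cases "s \<le> s0") auto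
  have zero: "(f has_real_derivative 0) (at s)" if "s \<le> 0" "\<And>s. s \<le> s0 \<Longrightarrow> f s = 0" for f :: "real \<Rightarrow> real" and s
  proof -
    have "\<forall>\<^sub>F t in nhds s. t \<in> {..<s0}" using that(1) s0 by (intro eventually_nhds_in_open) auto
    then have "\<forall>\<^sub>F t in nhds s. f t = 0" by eventually_elim (use that(2) in auto)
    then show ?thesis by (subst DERIV_cong_ev[OF refl _ refl, where g = "\<lambda>_. 0"]) auto
  qed
  have dw: "(w has_real_derivative p s) (at s)" for s
    using sol[of s] zero[of s w] core[of s] core s0 by (cases "s > 0") (auto simp: solves_at_def)
  have dp: "(p has_real_derivative r s) (at s)" for s
    using sol[of s] zero[of s p] core core[of s] r0[of s] s0 by (cases "s > 0") (auto simp: solves_at_def r_def)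
  have cw: "continuous_on UNIV w" "continuous_on UNIV p"
    using DERIV_isCont[OF dw] DERIV_isCont[OF dp] by (auto intro!: continuous_at_imp_continuous_on)
  \<comment> \<open>The singular coefficients at 0 are harmless because r vanishes on the dead
    core.\<close>
  have cr: "continuous_on UNIV r"
  proof (rule continuous_on_zero_extension[where U = "{0<..}" and K = "{s0..}"])
    have "continuous_on {0<..} (\<lambda>s. source s (w s))"
      by (intro continuous_on_source continuous_on_subset[OF cw(1)] continuous_on_id) auto
    then show "continuous_on {0<..} r" unfolding r_def
      by (intro continuous_on_diff continuous_on_mult continuous_on_divide continuous_on_const continuous_on_id
          continuous_on_subset[OF cw(2)]) auto
  qed (use s0 r0 in auto)
  have ode: "2 * real DIM('a) * p s + 4 * s * r s =
      1 / (m - 1) * s powr (\<sigma>1 / 2) * w s powr (1 / m) - s powr (\<sigma>2 / 2) * w s" if s: "s > 0" for s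
  proof -
    have "4 * s * r s = 4 * s * source s (w s) - 4 * k * p s" using s by (simp add: r_def right_diff_distrib)
    moreover have "4 * s * source s (w s) = 1 / (m - 1) * (s * s powr (\<sigma>1 / 2 - 1)) * w s powr (1 / m) - (s * s powr (\<sigma>2 / 2 - 1)) * w s"
    proof -
      have "4 * s * source s (w s) = (4 * \<gamma>) * (s * s powr \<tau>1) * w s powr q - (4 * \<beta>) * (s * s powr \<tau>2) * w s"
        using nonneg[of s] by (simp add: source_def algebra_simps)
      moreover have "4 * (x / 4) = x" for x :: real by simp
      then have "4 * \<gamma> = 1 / (m - 1)" "4 * \<beta> = 1" unfolding \<gamma>_def \<beta>_def by blast+
      ultimately show ?thesis by (simp add: \<tau>1_def \<tau>2_def q_def)
    qed
    moreover have "s * s powr (\<sigma> / 2 - 1) = s powr (\<sigma> / 2)" for \<sigma> using s by (simp add: powr_diff)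
    ultimately show ?thesis by (simp add: k_def)
  qed
  define F where "F = (\<lambda>r. w (r\<^sup>2) powr (1 / m))"
  define u where "u = (\<lambda>(x::'a) t. (T - t) powr (- (1 / (m - 1))) * w (x \<bullet> x) powr (1 / m))"
  have "weak_solution m \<sigma>1 \<sigma>2 T u"
    by (rule separated_weak_solution[OF m s0 dw dp cr nonneg _ ode]) (use core s0 in \<open>auto simp: u_def\<close>)
  moreover have "\<not> (AE r in lebesgue. 0 \<le> r \<longrightarrow> F r = 0)"
  proof
    assume "AE r in lebesgue. 0 \<le> r \<longrightarrow> F r = 0"
    then have "AE r in lebesgue. r \<notin> {sqrt s0<..}"
    proof eventually_elim
      case (elim r)
      show ?case
      proof
        assume r: "r \<in> {sqrt s0<..}"
        then have r': "sqrt s0 < r" by simp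
        then have "0 \<le> r" using s0 by (meson less_imp_le order_trans real_sqrt_ge_zero)
        moreover have "sqrt s0 < sqrt (r\<^sup>2)" using r' \<open>0 \<le> r\<close> by simp
        then have "s0 < r\<^sup>2" by (simp only: real_sqrt_less_iff)
        ultimately show False using elim pos[of "r\<^sup>2"] by (simp add: F_def)
      qed
    qed
    then have "{sqrt s0<..} \<in> null_sets lebesgue" by (subst AE_iff_null_sets) auto
    then have "negligible {sqrt s0<..}" by (simp add: negligible_iff_null_sets)
    then show False using open_not_negligible[of "{sqrt s0<..}"] by auto
  qed
  ultimately have "separate_variable_solution m \<sigma>1 \<sigma>2 T u F"
    unfolding separate_variable_solution_def by (auto simp: F_def u_def power2_norm_eq_inner)
  moreover have "blows_up_at T u"
    by (rule separated_solution_blows_up[OF m T cw(1) nonneg M, of "s0 + 1"]) (use s0 pos in \<open>auto simp: u_def\<close>)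
  ultimately show ?thesis by blast
qed

text \<open>a solves the linear equation a/2 - N/2 + c = 0. Substituting c = N/2 - a/2 into the
  other coefficient turns it into (\<sigma>2 - 2 - 2 N)/4 + a, affine in \<sigma>2 with its zero at
  \<open>sigma_2c\<close>.\<close>

lemma energy_exponents:
  fixes m \<sigma>1 \<sigma>2 N :: real
  assumes m: "m > 1"
  defines "a \<equiv> ((m + 1) * N - m * \<sigma>1 + 2 * m) / (3 * m + 1)"
  defines "c \<equiv> (a + (\<sigma>1 / 2 - 1)) / (1 / m + 1)"
  shows "a / 2 - N / 2 + c = 0" and "(a + (\<sigma>2 / 2 - 1)) / 2 - c = (\<sigma>2 - sigma_2c N m \<sigma>1) / 4"
proof -
  have a: "(3 * m + 1) * a = (m + 1) * N - m * \<sigma>1 + 2 * m" using m by (simp add: a_def)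
  have "1 / m + 1 = (m + 1) / m" using m by (simp add: field_simps)
  then have c: "(m + 1) * c = m * (a + (\<sigma>1 / 2 - 1))" using m by (simp add: c_def)
  have "2 * ((m + 1) * (a / 2 - N / 2 + c)) = (m + 1) * a - (m + 1) * N + 2 * ((m + 1) * c)" by algebra
  also have "\<dots> = (3 * m + 1) * a - (m + 1) * N + m * \<sigma>1 - 2 * m" unfolding c by (simp add: algebra_simps)
  also have "\<dots> = 0" unfolding a by simp
  finally show 1: "a / 2 - N / 2 + c = 0" using m by simp
  have s: "(3 * m + 1) * sigma_2c N m \<sigma>1 = (3 * m + 1) * \<sigma>1 + (2 * (N - 1) + \<sigma>1) * (m - 1)"
    using m by (simp add: sigma_2c_def distrib_left)
  have X: "4 * ((a + (\<sigma>2 / 2 - 1)) / 2 - c) = \<sigma>2 - 2 - 2 * N + 4 * a"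
  proof -
    have c': "c = N / 2 - a / 2" using 1 by simp
    show ?thesis unfolding c' by (simp add: field_simps)
  qed
  have "4 * ((3 * m + 1) * ((a + (\<sigma>2 / 2 - 1)) / 2 - c)) = (3 * m + 1) * (4 * ((a + (\<sigma>2 / 2 - 1)) / 2 - c))"
    by (simp only: mult.left_commute)
  also have "\<dots> = (3 * m + 1) * (\<sigma>2 - 2 - 2 * N) + 4 * ((3 * m + 1) * a)"
    unfolding X by (simp add: algebra_simps)
  also have "\<dots> = (3 * m + 1) * \<sigma>2 - (3 * m + 1) * sigma_2c N m \<sigma>1"
    unfolding a s by (simp add: algebra_simps)
  finally have "(3 * m + 1) * (4 * ((a + (\<sigma>2 / 2 - 1)) / 2 - c) - (\<sigma>2 - sigma_2c N m \<sigma>1)) = 0"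
    by (simp add: algebra_simps)
  then have 2: "4 * ((a + (\<sigma>2 / 2 - 1)) / 2 - c) - (\<sigma>2 - sigma_2c N m \<sigma>1) = 0"
    using m by (simp only: mult_eq_0_iff) auto
  have "x = y / 4" if "4 * x - y = 0" for x y :: real using that by simp
  from this[OF 2] show "(a + (\<sigma>2 / 2 - 1)) / 2 - c = (\<sigma>2 - sigma_2c N m \<sigma>1) / 4" .
qed

theorem theorem4p1:
  fixes m \<sigma>1 \<sigma>2 T N :: real
  defines "N \<equiv> real CARD('n::finite)"
  assumes "m > 1" and "T > 0"
    and "(N \<ge> 2 \<and> -2 < \<sigma>1 \<and> \<sigma>1 \<le> \<sigma>2) \<or> (N = 1 \<and> 0 \<le> \<sigma>1 \<and> \<sigma>1 \<le> \<sigma>2)"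
  shows "(\<sigma>2 < sigma_2c N m \<sigma>1 \<longrightarrow>
           (\<exists>(u :: real ^ 'n \<Rightarrow> real \<Rightarrow> real) F.
              separate_variable_solution m \<sigma>1 \<sigma>2 T u F \<and> blows_up_at T u)) \<and>
         sigma_2c N m \<sigma>1 < \<sigma>1 + (m - 1) * (N + \<sigma>1) / (m + 1) \<and>
         (\<sigma>2 \<ge> \<sigma>1 + (m - 1) * (N + \<sigma>1) / (m + 1) \<longrightarrow>
           \<not> (\<exists>(u :: real ^ 'n \<Rightarrow> real \<Rightarrow> real) F.
              separate_variable_solution m \<sigma>1 \<sigma>2 T u F)) \<and>
         (N > (m * \<sigma>1 + 4 * m + 2) / (m + 1) \<and> \<sigma>2 \<ge> sigma_2c N m \<sigma>1 \<longrightarrow>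
           \<not> (\<exists>(u :: real ^ 'n \<Rightarrow> real \<Rightarrow> real) F.
              separate_variable_solution m \<sigma>1 \<sigma>2 T u F))"
proof -
  note m = \<open>m > 1\<close> and T = \<open>T > 0\<close>
  have N: "N = real DIM(real ^ 'n)" by (simp add: N_def)
  have N1: "N \<ge> 1" and s1: "\<sigma>1 > -2" and le: "\<sigma>1 \<le> \<sigma>2" and sN: "N + \<sigma>1 > 0"
    and N12: "N \<ge> 2 \<or> (N = 1 \<and> \<sigma>1 \<ge> 0)"
    using assms(4) by auto
  have rp: "radial_profile (real DIM(real ^ 'n) / 2) (\<sigma>1 / 2 - 1) (\<sigma>2 / 2 - 1) (1 / 4) (1 / (m - 1) / 4) (1 / m)"
    unfolding N[symmetric] by unfold_locales (use m s1 le sN N1 in auto)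
  define a where "a = ((m + 1) * N - m * \<sigma>1 + 2 * m) / (3 * m + 1)"
  define c where "c = (a + (\<sigma>1 / 2 - 1)) / (1 / m + 1)"
  have a: "(3 * m + 1) * a = (m + 1) * N - m * \<sigma>1 + 2 * m" using m by (simp add: a_def)
  note ex = energy_exponents[OF m, of N \<sigma>1, folded a_def, folded c_def]
  have m0: "1 / m + 1 > 0" "1 / m + 1 = (m + 1) / m" using m by (auto simp: field_simps add_pos_pos)
  \<comment> \<open>One inequality with three uses: it orders the two thresholds for \<sigma>2, it
    is A > 0 for the exponent N/2 + 1, and it puts a below N/2 + 1. The case distinction between N =
    1 and N >= 2 enters here.\<close>
  have wide: "N * (m - 1) + 2 * m * \<sigma>1 + 2 * m + 2 > 0"
  proof -
    from N12 show ?thesis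
    proof
      assume "N \<ge> 2"
      then have "2 * (m - 1) \<le> N * (m - 1)" using m by (intro mult_right_mono) auto
      moreover have "(2 * m) * (-2) < (2 * m) * \<sigma>1" using m s1 by (intro mult_strict_left_mono) auto
      ultimately show ?thesis by (simp add: algebra_simps)
    next
      assume "N = 1 \<and> \<sigma>1 \<ge> 0"
      then have "0 \<le> 2 * m * \<sigma>1" "N * (m - 1) > 0" using m by auto
      then show ?thesis using m by linarith
    qed
  qed
  have part1: "\<exists>(u :: real ^ 'n \<Rightarrow> real \<Rightarrow> real) F. separate_variable_solution m \<sigma>1 \<sigma>2 T u F \<and> blows_up_at T u"
    if "\<sigma>2 < sigma_2c N m \<sigma>1"
  proof (rule blowing_up_separate_solution[OF m T rp c_def])
    show "a / 2 - real DIM(real ^ 'n) / 2 + c = 0" using ex(1) unfolding N .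
    show "(a + (\<sigma>2 / 2 - 1)) / 2 - c < 0" unfolding ex(2) using that by simp
  qed
  have between: "sigma_2c N m \<sigma>1 < \<sigma>1 + (m - 1) * (N + \<sigma>1) / (m + 1)"
  proof -
    have "(2 * (N - 1) + \<sigma>1) * (m + 1) < (N + \<sigma>1) * (3 * m + 1)"
      using wide by (simp add: algebra_simps)
    then have "(2 * (N - 1) + \<sigma>1) / (3 * m + 1) < (N + \<sigma>1) / (m + 1)"
      using m by (simp add: frac_less_eq pos_divide_less_eq pos_less_divide_eq mult.commute)
    then have "(m - 1) * ((2 * (N - 1) + \<sigma>1) / (3 * m + 1)) < (m - 1) * ((N + \<sigma>1) / (m + 1))"
      using m by (intro mult_strict_left_mono) auto
    then show ?thesis by (simp add: sigma_2c_def mult.commute)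
  qed
  have part2: "\<not> separate_variable_solution m \<sigma>1 \<sigma>2 T u F"
    if h: "\<sigma>2 \<ge> \<sigma>1 + (m - 1) * (N + \<sigma>1) / (m + 1)" for u :: "real ^ 'n \<Rightarrow> real \<Rightarrow> real" and F
  proof -
    \<comment> \<open>The value of c for the exponent N/2 + 1. The threshold for \<sigma>2 equals 4
      d - N, so the hypothesis is exactly the nonnegativity of B.\<close>
    define d where "d = (N / 2 + 1 + (\<sigma>1 / 2 - 1)) / (1 / m + 1)"
    have d: "d = m * (N + \<sigma>1) / (2 * (m + 1))"
      unfolding d_def m0(2) using m by (simp add: field_simps)
    have "(m - 1) * (N + \<sigma>1) / (m + 1) > 0" using m sN by simp
    then have lt: "\<sigma>1 < \<sigma>2" using h by linarith
    have A: "0 < (N / 2 + 1) / 2 - N / 2 + d"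
    proof -
      have "2 * (m + 1) * ((N / 2 + 1) / 2 - N / 2 + d) = (m + 1) * (1 - N / 2) + m * (N + \<sigma>1)"
        unfolding d using m by (simp add: field_simps)
      also have "\<dots> = (N * (m - 1) + 2 * m * \<sigma>1 + 2 * m + 2) / 2" by (simp add: field_simps)
      also have "\<dots> > 0" using wide by simp
      finally show ?thesis using m by (simp add: zero_less_mult_iff)
    qed
    have B: "0 \<le> (N / 2 + 1 + (\<sigma>2 / 2 - 1)) / 2 - d"
    proof -
      have "\<sigma>1 + (m - 1) * (N + \<sigma>1) / (m + 1) = 4 * d - N"
        unfolding d using m by (simp add: field_simps)
      then show ?thesis using h by simp
    qed
    show ?thesis
    proof (rule no_separate_solution[OF m T rp lt])
      show "0 < N / 2 + 1 + (\<sigma>1 / 2 - 1)" using sN by simp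
      show "N / 2 + 1 > 2 \<or> N / 2 + 1 = real DIM(real ^ 'n) / 2 + 1" unfolding N by simp
      show "d = (N / 2 + 1 + (\<sigma>1 / 2 - 1)) / (1 / m + 1)" by (rule d_def)
      show "0 \<le> (N / 2 + 1) / 2 - real DIM(real ^ 'n) / 2 + d"
        "0 < (N / 2 + 1) / 2 - real DIM(real ^ 'n) / 2 + d \<or>
         0 < d * (real DIM(real ^ 'n) / 2 + 1 - (N / 2 + 1)) / 2 * (N / 2 + 1 - 2)"
        using A unfolding N by auto
      show "0 \<le> (N / 2 + 1 + (\<sigma>2 / 2 - 1)) / 2 - d" by (rule B)
      show "0 \<le> d * (real DIM(real ^ 'n) / 2 + 1 - (N / 2 + 1)) / 2 * (N / 2 + 1 - 2)" unfolding N by simp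
    qed
  qed
  have part3: "\<not> separate_variable_solution m \<sigma>1 \<sigma>2 T u F"
    if h: "N > (m * \<sigma>1 + 4 * m + 2) / (m + 1)" "\<sigma>2 \<ge> sigma_2c N m \<sigma>1" for u :: "real ^ 'n \<Rightarrow> real \<Rightarrow> real" and F
  proof -
    have "m * \<sigma>1 + 4 * m + 2 < (m + 1) * N" using h(1) m by (simp add: pos_divide_less_eq mult.commute)
    then have "(3 * m + 1) * 2 < (3 * m + 1) * a" unfolding a by (simp add: algebra_simps)
    \<comment> \<open>The lower bound on N is equivalent to a > 2. Together with a < N/2 + 1 it
      makes D > 0, which supplies the strictness, since here A = 0.\<close>
    then have a2: "a > 2" using m by (subst (asm) mult_less_cancel_left_pos) auto
    have "2 * ((3 * m + 1) * a) < (3 * m + 1) * (N + 2)"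
      unfolding a using wide by (simp add: algebra_simps)
    then have "(3 * m + 1) * (2 * a) < (3 * m + 1) * (N + 2)" by (simp only: mult.left_commute)
    then have "2 * a < N + 2" using m by (subst (asm) mult_less_cancel_left_pos) auto
    then have aN: "a < N / 2 + 1" by simp
    have c0: "c > 0" unfolding c_def using m0 a2 s1 by (intro divide_pos_pos) auto
    have D: "0 < c * (N / 2 + 1 - a) / 2 * (a - 2)" using c0 aN a2 by (intro mult_pos_pos divide_pos_pos) auto
    have "0 < (2 * (N - 1) + \<sigma>1) * (m - 1) / (3 * m + 1)"
    proof -
      have "N > 2" using aN a2 by simp
      then have "2 * (N - 1) + \<sigma>1 > 0" using s1 by (simp add: right_diff_distrib)
      then show ?thesis using m by (intro divide_pos_pos mult_pos_pos) auto
    qed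
    then have lt: "\<sigma>1 < \<sigma>2" using h(2) by (simp add: sigma_2c_def)
    show ?thesis
    proof (rule no_separate_solution[OF m T rp lt])
      show "0 < a + (\<sigma>1 / 2 - 1)" "a > 2 \<or> a = real DIM(real ^ 'n) / 2 + 1" using a2 s1 by auto
      show "c = (a + (\<sigma>1 / 2 - 1)) / (1 / m + 1)" by (rule c_def)
      show "0 \<le> a / 2 - real DIM(real ^ 'n) / 2 + c" using ex(1) unfolding N by simp
      show "0 \<le> (a + (\<sigma>2 / 2 - 1)) / 2 - c" unfolding ex(2) using h(2) by simp
      show "0 \<le> c * (real DIM(real ^ 'n) / 2 + 1 - a) / 2 * (a - 2)"
        "0 < a / 2 - real DIM(real ^ 'n) / 2 + c \<or> 0 < c * (real DIM(real ^ 'n) / 2 + 1 - a) / 2 * (a - 2)"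
        using D unfolding N by auto
    qed
  qed
  show ?thesis
  proof (intro conjI)
    show "\<sigma>2 < sigma_2c N m \<sigma>1 \<longrightarrow>
        (\<exists>(u :: real ^ 'n \<Rightarrow> real \<Rightarrow> real) F. separate_variable_solution m \<sigma>1 \<sigma>2 T u F \<and> blows_up_at T u)"
      by (rule impI, rule part1)
    show "sigma_2c N m \<sigma>1 < \<sigma>1 + (m - 1) * (N + \<sigma>1) / (m + 1)" by (rule between)
    show "\<sigma>2 \<ge> \<sigma>1 + (m - 1) * (N + \<sigma>1) / (m + 1) \<longrightarrow>
        \<not> (\<exists>(u :: real ^ 'n \<Rightarrow> real \<Rightarrow> real) F. separate_variable_solution m \<sigma>1 \<sigma>2 T u F)"
      by (rule impI, rule notI, elim exE, erule part2[THEN notE])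
    show "N > (m * \<sigma>1 + 4 * m + 2) / (m + 1) \<and> \<sigma>2 \<ge> sigma_2c N m \<sigma>1 \<longrightarrow>
        \<not> (\<exists>(u :: real ^ 'n \<Rightarrow> real \<Rightarrow> real) F. separate_variable_solution m \<sigma>1 \<sigma>2 T u F)"
      by (rule impI, rule notI, elim exE conjE, erule (1) part3[THEN notE])
  qed
qed

end
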